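(* Assume that both the true propensity $e$ and the estimated propensity $\hat e$ are uniformly bounded away from zero, and that the estimators $\hat e$ and $\hat\mu^{model}_{Y|X}$ satisfy $$(\mathbb E_X|e(X)-\hat e(X)|^2)^{1/2}=O_p(\zeta_{n_t}),\qquad (\mathbb E_X\|\mu_{Y|X}-\hat\mu^{model}_{Y|X}\|_{\mathcal H_\ell}^2)^{1/2}=O_p(\eta_{n_t}),$$ with $\zeta_{n_t}=o(1)$ and $\eta_{n_t}=o(1)$. Assume further that: $k$ is continuous and bounded, i.e. there is $k_{\max}>0$ with $k(x,x)\le k_{\max}$ for all $x\in\mathcal X$; $\ell$ is characteristic; and within the equivalence class of Markov kernels for $P_{Y|X}$ there is a representative $\tilde\kappa_P$ such that for every $g\in\mathcal H_\ell$ the map $x\mapsto\int_{\mathcal Y}g(y)\,\tilde\kappa_P(x,dy)$ belongs to $\mathrm{range}(C_{XX}^\gamma)$ for some $\gamma\ge\tfrac12$, with the analogous condition for $Q_{Z|X}$. Then $$\|\mu_{Y|x}-\hat\mu^{DR}_{Y|x}\|_{\mathcal H_\ell}=O_p\big(\lambda^{1/2}+\lambda^{-1}n_t^{-1/2}+\lambda^{-1}\zeta_{n_t}\eta_{n_t}\big).$$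
   Context: $P$ and $Q$ are probability measures on a measurable space; $X$ takes values in $\mathcal X$ and $Y,Z$ take values in a measurable space $(\mathcal Y,\mathfrak Y)$. $P_X,Q_X$ are the laws of $X$ under $P,Q$; they have full support on $\mathcal X$ and are mutually absolutely continuous. The conditional distributions $P_{Y|X}$ (of $Y$ given $X$ under $P$) and $Q_{Z|X}$ (of $Z$ given $X$ under $Q$) admit regular versions, represented by equivalence classes (almost sure equality) of Markov kernels. $R_X=\alpha P_X+(1-\alpha)Q_X$ with $\alpha\in[0,1]$. $k$ and $\ell$ are positive definite kernels on $\mathcal X$ and $\mathcal Y$ with reproducing kernel Hilbert spaces $\mathcal H_k$ and $\mathcal H_\ell$; $\ell$ is characteristic if the mean embedding of probability measures into $\mathcal H_\ell$ is injective. $C_{XX}=\mathbb E_{X\sim R_X}[k(\cdot,X)\otimes k(\cdot,X)]$ is the (uncentered) covariance operator on $\mathcal H_k$. The conditional mean embedding at $x\in\mathcal X$ is $\mu_{Y|x}=\int\ell(\cdot,y)\,\tilde\kappa_P(x,dy)\in\mathcal H_\ell$, defined with the representative $\tilde\kappa_P$ of the claim. Mixture model: $(T,X,W)\sim P_{TXW}$, where $T\in\{0,1\}$ with $\mathbb E[T]=\alpha$; given $T=1$, $(X,W)$ has the law $P_{XY}=P_{Y|X}\otimes P_X$; given $T=0$, $(X,W)$ has the law $Q_{XZ}=Q_{Z|X}\otimes Q_X$. Thus $X\sim R_X$. The propensity score is $e(x)=\mathbb E[T\mid X=x]$, and the overlap condition $0<e(X)<1$ holds with probability one. Models $\hat e$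 of $e$ and $\hat\mu^{model}_{Y|X}$ (valued in $\mathcal H_\ell$) of $\mu_{Y|X}$ are fitted on training data; the test data are i.i.d. samples $\{(t_i,\tilde x_i,w_i)\}_{i=1}^{n_t}$ from $P_{TXW}$. $\mathbb E_X$ denotes expectation over $X\sim R_X$. "Uniformly bounded away from zero" means there is $\delta>0$ with $e(x)>\delta$ and $\hat e(x)>\delta$ for all $x$. With regularization parameter $\lambda>0$, the doubly robust estimator of $\mu_{Y|x}$ on the test data is $$\hat\mu^{DR}_{Y|x}=\sum_{i=1}^{n_t}\beta_i(x)\Big[\frac{t_i}{\hat e(\tilde x_i)}\big(\ell(\cdot,w_i)-\hat\mu^{model}_{Y|\tilde x_i}\big)+\hat\mu^{model}_{Y|\tilde x_i}\Big],$$ where $\beta(x)=(\beta_1(x),\dots,\beta_{n_t}(x))^\top=(K_{\tilde X\tilde X}+\lambda n_tI_{n_t})^{-1}K_{\tilde Xx}$, $[K_{\tilde X\tilde X}]_{ij}=k(\tilde x_i,\tilde x_j)$, $K_{\tilde Xx}=(k(\tilde x_1,x),\dots,k(\tilde x_{n_t},x))^\top$. *)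

theory Defs
  imports "HOL-Probability.Probability" "HOL-Library.Landau_Symbols"
begin

definition pd_kernel :: "'a set \<Rightarrow> ('a \<Rightarrow> 'a \<Rightarrow> real) \<Rightarrow> bool" where
  "pd_kernel S k \<longleftrightarrow>
     (\<forall>x\<in>S. \<forall>y\<in>S. k x y = k y x) \<and>
     (\<forall>F c. finite F \<and> F \<subseteq> S \<longrightarrow> 0 \<le> (\<Sum>x\<in>F. \<Sum>y\<in>F. c x * c y * k x y))"

text \<open>The RKHS of a kernel \<open>k\<close> on \<open>S\<close> is a Hilbert space of functions on \<open>S\<close>. Its elements form
  a type \<open>'h\<close>; \<open>fn f\<close> is the function that \<open>f\<close> stands for (only its values on \<open>S\<close> matter), so
  \<open>fn\<close> is linear and injective. \<open>\<phi> x\<close> is the element of \<open>'h\<close> that is the function \<open>k(\<cdot>,x)\<close>.\<close>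

definition is_rkhs ::
  "'a set \<Rightarrow> ('a \<Rightarrow> 'a \<Rightarrow> real) \<Rightarrow> ('h::{real_inner,complete_space} \<Rightarrow> 'a \<Rightarrow> real) \<Rightarrow> ('a \<Rightarrow> 'h) \<Rightarrow> bool"
where
  "is_rkhs S k fn \<phi> \<longleftrightarrow>
     (\<forall>f g. \<forall>x\<in>S. fn (f + g) x = fn f x + fn g x) \<and>
     (\<forall>c f. \<forall>x\<in>S. fn (c *\<^sub>R f) x = c * fn f x) \<and>
     (\<forall>f g. (\<forall>x\<in>S. fn f x = fn g x) \<longrightarrow> f = g) \<and>
     (\<forall>x\<in>S. \<forall>y\<in>S. fn (\<phi> x) y = k y x) \<and>
     (\<forall>f. \<forall>x\<in>S. fn f x = f \<bullet> \<phi> x)"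

text \<open>Hilbert-space valued integrals are weak (Pettis) integrals. The library's Bochner integral
  exists only for separable spaces, which is not assumed here; where the Bochner integral exists,
  it is the weak integral.\<close>

definition has_weak_integral :: "'a measure \<Rightarrow> ('a \<Rightarrow> 'h::real_inner) \<Rightarrow> 'h \<Rightarrow> bool" where
  "has_weak_integral M f m \<longleftrightarrow>
     (\<forall>g. integrable M (\<lambda>x. f x \<bullet> g) \<and> m \<bullet> g = (\<integral>x. f x \<bullet> g \<partial>M))"

definition weak_integral :: "'a measure \<Rightarrow> ('a \<Rightarrow> 'h::real_inner) \<Rightarrow> 'h" where
  "weak_integral M f = (THE m. has_weak_integral M f m)"

text \<open>With \<open>\<phi> y = \<ell>(\<cdot>,y)\<close>, the mean embedding of \<open>N\<close> is \<open>weak_integral N \<phi>\<close>. That it is an injective map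
  on all probability measures includes that it is defined for all of them.\<close>

definition characteristic :: "'y measure \<Rightarrow> ('y \<Rightarrow> 'h::real_inner) \<Rightarrow> bool" where
  "characteristic M \<phi> \<longleftrightarrow>
     (\<forall>N. prob_space N \<and> sets N = sets M \<longrightarrow> (\<exists>m. has_weak_integral N \<phi> m)) \<and>
     inj_on (\<lambda>N. weak_integral N \<phi>) {N. prob_space N \<and> sets N = sets M}"

definition strongly_measurable :: "'a measure \<Rightarrow> ('a \<Rightarrow> 'h::topological_space) \<Rightarrow> bool" where
  "strongly_measurable M f \<longleftrightarrow>
     (\<exists>s. (\<forall>i::nat. simple_function M (s i)) \<and> (\<forall>x\<in>space M. (\<lambda>i. s i x) \<longlonglongrightarrow> f x))"

text \<open>The operator \<open>k(\<cdot>,x) \<otimes> k(\<cdot>,x)\<close> maps \<open>f\<close> to \<open>f(x) k(\<cdot>,x)\<close>.\<close>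

definition cov_op ::
  "'x measure \<Rightarrow> ('h \<Rightarrow> 'x \<Rightarrow> real) \<Rightarrow> ('x \<Rightarrow> 'h::real_inner) \<Rightarrow> 'h \<Rightarrow> 'h" where
  "cov_op R fn \<phi> f = weak_integral R (\<lambda>x. fn f x *\<^sub>R \<phi> x)"

definition eigenspace :: "('h \<Rightarrow> 'h) \<Rightarrow> real \<Rightarrow> 'h::real_vector set" where
  "eigenspace A s = {f. A f = s *\<^sub>R f}"

definition orth_proj :: "'h set \<Rightarrow> 'h \<Rightarrow> 'h::real_inner" where
  "orth_proj S f = (THE p. p \<in> S \<and> (\<forall>g\<in>S. (f - p) \<bullet> g = 0))"

text \<open>For a compact positive self-adjoint operator \<open>A\<close> (such as the covariance operator of a bounded
  kernel) and \<open>\<gamma> > 0\<close> this is the power \<open>A\<^sup>\<gamma>\<close> of the functional calculus: the sum of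
  \<open>s\<^sup>\<gamma> P\<^sub>s\<close> over the positive eigenvalues \<open>s\<close>, with \<open>P\<^sub>s\<close> the projection onto the eigenspace.\<close>

definition op_power :: "('h \<Rightarrow> 'h) \<Rightarrow> real \<Rightarrow> 'h \<Rightarrow> 'h::real_inner" where
  "op_power A \<gamma> f =
     (\<Sum>\<^sub>\<infinity>s\<in>{s. 0 < s \<and> eigenspace A s \<noteq> {0}}. (s powr \<gamma>) *\<^sub>R orth_proj (eigenspace A s) f)"

definition full_support :: "'x::topological_space measure \<Rightarrow> bool" where
  "full_support M \<longleftrightarrow> (\<forall>U. open U \<and> U \<noteq> {} \<longrightarrow> 0 < emeasure M U)"

definition regular_cond_distr ::
  "'o measure \<Rightarrow> 'x measure \<Rightarrow> ('o \<Rightarrow> 'x) \<Rightarrow> 'y measure \<Rightarrow> ('o \<Rightarrow> 'y) \<Rightarrow> ('x \<Rightarrow> 'y measure) \<Rightarrow> bool" where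
  "regular_cond_distr P MX X MY Y \<kappa> \<longleftrightarrow>
     \<kappa> \<in> measurable MX (prob_algebra MY) \<and>
     (\<forall>A\<in>sets MX. \<forall>B\<in>sets MY.
        emeasure P {\<omega>\<in>space P. X \<omega> \<in> A \<and> Y \<omega> \<in> B} =
        (\<integral>\<^sup>+x. emeasure (\<kappa> x) B * indicator A x \<partial>distr P MX X))"

definition mixture :: "real \<Rightarrow> 'a measure \<Rightarrow> 'a measure \<Rightarrow> 'a measure" where
  "mixture \<alpha> M N =
     measure_of (space M) (sets M) (\<lambda>A. ennreal \<alpha> * emeasure M A + ennreal (1 - \<alpha>) * emeasure N A)"

lemma sets_mixture [simp, measurable_cong]: "sets (mixture \<alpha> M N) = sets M"
  by (simp add: mixture_def)

lemma space_mixture [simp]: "space (mixture \<alpha> M N) = space M"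
  by (simp add: mixture_def)

lemma emeasure_mixture:
  assumes "sets N = sets M" "A \<in> sets M"
  shows "emeasure (mixture \<alpha> M N) A = ennreal \<alpha> * emeasure M A + ennreal (1 - \<alpha>) * emeasure N A"
  unfolding mixture_def
proof (rule emeasure_measure_of_sigma)
  show "sigma_algebra (space M) (sets M)" ..
  show "positive (sets M) (\<lambda>A. ennreal \<alpha> * emeasure M A + ennreal (1 - \<alpha>) * emeasure N A)"
    by (simp add: positive_def)
  show "countably_additive (sets M) (\<lambda>A. ennreal \<alpha> * emeasure M A + ennreal (1 - \<alpha>) * emeasure N A)"
    using assms(1)
    by (auto simp: countably_additive_def suminf_add[symmetric] suminf_emeasure)
qed fact

text \<open>The law of \<open>(T,X,W)\<close>: given \<open>T\<close>, the pair \<open>(X,W)\<close> has law \<open>M1\<close>, given \<open>\<not> T\<close> it has law \<open>M0\<close>.\<close>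

definition treatment_law ::
  "real \<Rightarrow> ('x \<times> 'y) measure \<Rightarrow> ('x \<times> 'y) measure \<Rightarrow> (bool \<times> 'x \<times> 'y) measure" where
  "treatment_law \<alpha> M1 M0 =
     mixture \<alpha> (distr M1 (count_space UNIV \<Otimes>\<^sub>M M1) (Pair True))
               (distr M0 (count_space UNIV \<Otimes>\<^sub>M M0) (Pair False))"

definition T_of :: "bool \<times> 'x \<times> 'y \<Rightarrow> real" where "T_of z = of_bool (fst z)"
definition X_of :: "bool \<times> 'x \<times> 'y \<Rightarrow> 'x" where "X_of z = fst (snd z)"
definition W_of :: "bool \<times> 'x \<times> 'y \<Rightarrow> 'y" where "W_of z = snd (snd z)"

text \<open>\<open>e(x) = E[T | X = x]\<close>: \<open>e(X)\<close> is a version of the conditional expectation of \<open>T\<close> given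
  the sigma-algebra generated by \<open>X\<close>.\<close>

definition is_propensity ::
  "(bool \<times> 'x::topological_space \<times> 'y) measure \<Rightarrow> ('x \<Rightarrow> real) \<Rightarrow> bool" where
  "is_propensity M e \<longleftrightarrow>
     e \<in> borel_measurable borel \<and>
     (AE z in M. e (X_of z) = real_cond_exp M (vimage_algebra (space M) X_of borel) T_of z)"

text \<open>\<open>X\<^sub>n = O\<^sub>p(a\<^sub>n)\<close> for nonnegative \<open>X\<^sub>n\<close> and \<open>a\<^sub>n\<close>. The probability is an outer probability,
  so that a non-measurable event (to which \<^const>\<open>measure\<close> assigns 0) is not counted as null.\<close>

definition big_O_p :: "'w measure \<Rightarrow> (nat \<Rightarrow> 'w \<Rightarrow> ennreal) \<Rightarrow> (nat \<Rightarrow> real) \<Rightarrow> bool" where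
  "big_O_p M X a \<longleftrightarrow>
     (\<forall>\<epsilon>>0. \<exists>C>0. \<forall>\<^sub>F n in sequentially.
        \<exists>A\<in>sets M. {\<omega>\<in>space M. ennreal (C * a n) < X n \<omega>} \<subseteq> A \<and> measure M A \<le> \<epsilon>)"

text \<open>The root mean square takes the value \<open>\<infinity>\<close> (rather than 0) if \<open>f\<close> is not square integrable.\<close>

definition rms :: "'a measure \<Rightarrow> ('a \<Rightarrow> real) \<Rightarrow> ennreal" where
  "rms M f =
     (let I = (\<integral>\<^sup>+x. ennreal ((f x)\<^sup>2) \<partial>M) in if I = \<infinity> then \<infinity> else ennreal (sqrt (enn2real I)))"

text \<open>An \<open>n \<times> n\<close> matrix is a function on indices below \<open>n\<close>; the inverse is set to 0 elsewhere to
  make it unique.\<close>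

definition mat_inverse :: "nat \<Rightarrow> (nat \<Rightarrow> nat \<Rightarrow> real) \<Rightarrow> nat \<Rightarrow> nat \<Rightarrow> real" where
  "mat_inverse n A =
     (THE B. (\<forall>i j. \<not> (i < n \<and> j < n) \<longrightarrow> B i j = 0) \<and>
             (\<forall>i<n. \<forall>j<n. (\<Sum>m<n. A i m * B m j) = of_bool (i = j)) \<and>
             (\<forall>i<n. \<forall>j<n. (\<Sum>m<n. B i m * A m j) = of_bool (i = j)))"

definition ridge_weights ::
  "('x \<Rightarrow> 'x \<Rightarrow> real) \<Rightarrow> real \<Rightarrow> nat \<Rightarrow> (nat \<Rightarrow> 'x) \<Rightarrow> 'x \<Rightarrow> nat \<Rightarrow> real" where
  "ridge_weights k lam n xs x i =
     (\<Sum>j<n. mat_inverse n (\<lambda>i j. k (xs i) (xs j) + lam * real n * of_bool (i = j)) i j * k (xs j) x)"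

definition dr_estimator ::
  "('x \<Rightarrow> 'x \<Rightarrow> real) \<Rightarrow> ('y \<Rightarrow> 'h) \<Rightarrow> real \<Rightarrow> ('x \<Rightarrow> real) \<Rightarrow> ('x \<Rightarrow> 'h) \<Rightarrow>
     nat \<Rightarrow> (nat \<Rightarrow> bool \<times> 'x \<times> 'y) \<Rightarrow> 'x \<Rightarrow> 'h::real_vector" where
  "dr_estimator k \<phi> lam ehat muhat n D x =
     (\<Sum>i<n. ridge_weights k lam n (\<lambda>i. X_of (D i)) x i *\<^sub>R
        ((T_of (D i) / ehat (X_of (D i))) *\<^sub>R (\<phi> (W_of (D i)) - muhat (X_of (D i)))
          + muhat (X_of (D i))))"

end

theory Submission
  imports Defs
begin

text \<open>Write \<open>\<phi>(x) = k(\<cdot>,x)\<close> and let \<open>v = \<phi>(x) - \<Sum>\<^sub>i \<beta>\<^sub>i \<phi>(x\<^sub>i)\<close> be the residual of the ridge weights, so that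
  \<open>\<lambda> n \<beta>\<^sub>i = \<langle>\<phi>(x\<^sub>i), v\<rangle>\<close>. The error splits into the bias \<open>\<mu>(x) - \<Sum>\<^sub>i \<beta>\<^sub>i \<mu>(x\<^sub>i)\<close> and the noise \<open>\<Sum>\<^sub>i \<beta>\<^sub>i \<epsilon>\<^sub>i\<close>, where
  \<open>\<epsilon>\<^sub>i\<close> is the residual of the doubly robust pseudo-outcome at the \<open>i\<close>-th test point.

  Bias: the range condition bounds \<open>\<langle>bias, g\<rangle>\<^sup>2\<close> by a multiple of \<open>\<langle>C v, v\<rangle>\<close> for every \<open>g\<close>, and Banach-Steinhaus
  makes the constant uniform in \<open>g\<close>. The population solution \<open>u\<close> of \<open>(C + \<lambda>) u = \<lambda> \<phi>(x)\<close> has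
  \<open>\<langle>C u, u\<rangle> = O(\<lambda>)\<close>, and \<open>\<lambda> \<parallel>v - u\<parallel>\<close> is at most the norm of an average of i.i.d. centred vectors.

  Noise: \<open>(\<lambda> n)\<^sup>2 \<parallel>\<Sum>\<^sub>i \<beta>\<^sub>i \<epsilon>\<^sub>i\<parallel>\<^sup>2\<close> is at most \<open>\<parallel>v\<parallel>\<^sup>2 \<Sum>\<^sub>i\<^sub>j \<langle>\<epsilon>\<^sub>i, \<epsilon>\<^sub>j\<rangle> k(x\<^sub>i, x\<^sub>j)\<close> by the Schur product theorem. Given
  the training data this is a V-statistic; its diagonal contributes \<open>O(n)\<close> and its off-diagonal terms have
  mean at most \<open>k\<^sub>m\<^sub>a\<^sub>x \<parallel>E[\<epsilon> | X]\<parallel>\<^sup>2\<close> in \<open>L\<^sup>1\<close>, where \<open>E[\<epsilon> | X] = (1 - e / eh) (mh - \<mu>)\<close> is a product of the two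
  model errors. Markov's inequality conditionally on the training data concludes.\<close>

subsection \<open>Hilbert spaces and positive forms\<close>

text \<open>Three obstacles shape the argument. In the range condition the exponent and the preimage
  depend on g, so there is no bound uniform in g to start from; a category argument has to supply
  it. The ridge weights depend on all covariates at once, so the weighted residuals are not
  independent: the Schur bound trades the random vector v for its norm and leaves a double sum whose
  kernel does not involve the weights. For the same reason the bias is compared with the nonrandom
  u, which only needs the variance of an average of fixed functions of the covariates and no
  concentration of random operators. Finally, the Hilbert spaces may be nonseparable, where inner
  products of weakly measurable maps need not be jointly measurable and Fubini is not free. Each map
  gets joint measurability from its own source: continuity and full support for
  \<open>\<phi>k\<close>, the kernel for \<open>\<phi>l\<close>, parameter integrals for
  \<open>mu\<close>, strong measurability for \<open>muhat\<close>. A bound on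
  \<open>\<phi>l\<close> is extracted from the existence of all mean embeddings.\<close>

text \<open>By Baire, one of the closed sets \<open>F n\<close>, which cover the space, contains a
  ball \<open>cball g0 r\<close>. Subtracting the bounds at \<open>g0 + u\<close> and
  \<open>g0\<close>, with \<open>u\<close> the multiple of \<open>s\<close> of length
  \<open>r\<close>, bounds the norm of \<open>s\<close>.\<close>

lemma banach_steinhaus_inner:
  fixes S :: "'h::{real_inner,complete_space} set"
  assumes bd: "\<And>g. \<exists>M. \<forall>s\<in>S. \<bar>s \<bullet> g\<bar> \<le> M"
  shows "\<exists>M. \<forall>s\<in>S. norm s \<le> M"
proof -
  define F where "F n = (\<Inter>s\<in>S. {g. \<bar>s \<bullet> g\<bar> \<le> real n})" for n :: nat
  have cl: "closed (F n)" for n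
    unfolding F_def by (intro closed_INT ballI closed_Collect_le continuous_intros)
  have U: "(\<Union>n. F n) = UNIV"
  proof -
    have "\<exists>n. g \<in> F n" for g
    proof -
      obtain M where M: "\<forall>s\<in>S. \<bar>s \<bullet> g\<bar> \<le> M" using bd by blast
      obtain n where "M \<le> real n" using real_arch_simple by blast
      then have "\<bar>s \<bullet> g\<bar> \<le> real n" if "s \<in> S" for s using M that by fastforce
      then show ?thesis by (auto simp: F_def)
    qed
    then show ?thesis by auto
  qed
  have "\<exists>n. interior (F n) \<noteq> {}"
  proof (rule ccontr)
    assume "\<not> ?thesis"
    then have "Met_TC.mtopology interior_of (\<Union>(range F)) = {}"
      using cl by (intro Met_TC.metric_Baire_category_alt)
        (auto simp: complete_UNIV mtopology_is_euclidean)
    then show False using U by (simp add: mtopology_is_euclidean)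
  qed
  then obtain n g0 r where r: "r > 0" "cball g0 r \<subseteq> F n"
    by (metis ex_in_conv mem_interior_cball)
  have "norm s \<le> 2 * real n / r" if s: "s \<in> S" for s
  proof (cases "s = 0")
    case False
    define u where "u = (r / norm s) *\<^sub>R s"
    have "norm u = r" using False r by (simp add: u_def)
    then have "g0 + u \<in> F n" "g0 \<in> F n" using r by (auto simp: dist_norm subset_eq)
    then have "\<bar>s \<bullet> (g0 + u)\<bar> \<le> n" "\<bar>s \<bullet> g0\<bar> \<le> n" using s by (auto simp: F_def)
    then have "s \<bullet> u \<le> 2 * real n" by (simp add: inner_add_right)
    moreover have "s \<bullet> u = r * norm s"
      using False by (simp add: u_def dot_square_norm power2_eq_square)
    ultimately show ?thesis using r by (simp add: field_simps)
  qed (use r in simp)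
  then show ?thesis by blast
qed

text \<open>A sequence minimising the distance to \<open>f\<close> is Cauchy by the parallelogram
  law, because the midpoint of two of its members lies in \<open>S\<close> and cannot beat the
  infimum.\<close>

lemma hilbert_projection:
  fixes S :: "'h::{real_inner,complete_space} set"
  assumes S: "subspace S" "closed S"
  shows "\<exists>p\<in>S. \<forall>g\<in>S. (f - p) \<bullet> g = 0"
proof -
  define d where "d = (INF g\<in>S. (norm (f - g))\<^sup>2)"
  have ne: "S \<noteq> {}" using S by (auto simp: subspace_def)
  have bdd: "bdd_below ((\<lambda>g. (norm (f - g))\<^sup>2) ` S)" by (auto intro!: bdd_belowI[of _ 0])
  have low: "d \<le> (norm (f - g))\<^sup>2" if "g \<in> S" for g
    unfolding d_def by (rule cINF_lower[OF bdd that])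
  have "\<exists>g\<in>S. (norm (f - g))\<^sup>2 < d + inverse (real (Suc n))" for n
  proof -
    have "d < d + inverse (real (Suc n))" by simp
    then show ?thesis unfolding d_def using ne bdd by (subst (asm) cINF_less_iff) auto
  qed
  then obtain q where q: "\<And>n. q n \<in> S" "\<And>n. (norm (f - q n))\<^sup>2 < d + inverse (real (Suc n))"
    by metis
  have par: "(norm (q m - q n))\<^sup>2 \<le> 2 * (inverse (real (Suc m)) + inverse (real (Suc n)))" for m n
  proof -
    have "(1/2) *\<^sub>R (q m + q n) \<in> S" using S q by (simp add: subspace_def)
    then have "d \<le> (norm (f - (1/2) *\<^sub>R (q m + q n)))\<^sup>2" by (rule low)
    moreover have "(norm (q m - q n))\<^sup>2 + 4 * (norm (f - (1/2) *\<^sub>R (q m + q n)))\<^sup>2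
        = 2 * (norm (f - q m))\<^sup>2 + 2 * (norm (f - q n))\<^sup>2"
      by (simp add: power2_norm_eq_inner inner_simps inner_commute algebra_simps)
    ultimately show ?thesis using q(2)[of m] q(2)[of n] by simp
  qed
  have "Cauchy q"
  proof (rule metric_CauchyI)
    fix e :: real assume e: "e > 0"
    obtain K where K: "inverse (real (Suc K)) < e\<^sup>2 / 4"
      using e reals_Archimedean[of "e\<^sup>2/4"] by auto
    have "dist (q m) (q n) < e" if "m \<ge> K" "n \<ge> K" for m n
    proof -
      have "inverse (real (Suc m)) \<le> inverse (real (Suc K))" "inverse (real (Suc n)) \<le> inverse (real (Suc K))"
        using that by (auto intro!: le_imp_inverse_le)
      then have "(norm (q m - q n))\<^sup>2 \<le> 4 * inverse (real (Suc K))"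
        by (intro order_trans[OF par[of m n]]) argo
      then have "(norm (q m - q n))\<^sup>2 < e\<^sup>2" using K by argo
      then show ?thesis using e by (simp add: dist_norm power_less_imp_less_base)
    qed
    then show "\<exists>M. \<forall>m\<ge>M. \<forall>n\<ge>M. dist (q m) (q n) < e" by blast
  qed
  then obtain p where p: "q \<longlonglongrightarrow> p" using Cauchy_convergent convergent_def by blast
  then have pS: "p \<in> S" using S(2) q(1) closed_sequentially by blast
  have dp: "(norm (f - p))\<^sup>2 \<le> d"
  proof (rule LIMSEQ_le)
    show "(\<lambda>n. (norm (f - q n))\<^sup>2) \<longlonglongrightarrow> (norm (f - p))\<^sup>2" by (intro tendsto_intros p)
    have "(\<lambda>n. d + inverse (real (Suc n))) \<longlonglongrightarrow> d + 0"
      by (intro tendsto_add tendsto_const LIMSEQ_inverse_real_of_nat)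
    then show "(\<lambda>n. d + inverse (real (Suc n))) \<longlonglongrightarrow> d" by simp
    show "\<exists>N. \<forall>n\<ge>N. (norm (f - q n))\<^sup>2 \<le> d + inverse (real (Suc n))"
      using q(2) less_imp_le by blast
  qed
  have "(f - p) \<bullet> g = 0" if g: "g \<in> S" for g
  proof (cases "g = 0")
    case False
    \<comment> \<open>The step length that minimises the distance to \<open>f\<close> along
      \<open>g\<close>; since \<open>p\<close> is already optimal, the resulting decrease must be
      zero.\<close>
    define t where "t = ((f - p) \<bullet> g) / (g \<bullet> g)"
    have gg: "g \<bullet> g > 0" using False by simp
    have "p + t *\<^sub>R g \<in> S" using S pS g by (simp add: subspace_def)
    then have "(norm (f - p))\<^sup>2 \<le> (norm (f - (p + t *\<^sub>R g)))\<^sup>2" using low dp by (metis order_trans)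
    also have "\<dots> = (norm (f - p))\<^sup>2 - 2 * t * ((f - p) \<bullet> g) + t\<^sup>2 * (g \<bullet> g)"
      unfolding power2_norm_eq_inner
      by (simp add: inner_simps inner_commute algebra_simps power2_eq_square)
    also have "\<dots> = (norm (f - p))\<^sup>2 - ((f - p) \<bullet> g)\<^sup>2 / (g \<bullet> g)"
      using gg by (simp add: t_def power2_eq_square field_simps)
    finally have "((f - p) \<bullet> g)\<^sup>2 / (g \<bullet> g) \<le> 0" by simp
    then have "((f - p) \<bullet> g)\<^sup>2 \<le> 0" using gg by (simp add: divide_le_0_iff)
    then show ?thesis by simp
  qed simp
  with pS show ?thesis by blast
qed

lemma orth_proj_props:
  fixes S :: "'h::{real_inner,complete_space} set"
  assumes S: "subspace S" "closed S"
  shows "orth_proj S f \<in> S" "g \<in> S \<Longrightarrow> (f - orth_proj S f) \<bullet> g = 0"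
proof -
  have "\<exists>!p. p \<in> S \<and> (\<forall>g\<in>S. (f - p) \<bullet> g = 0)"
  proof (rule ex_ex1I)
    show "\<exists>p. p \<in> S \<and> (\<forall>g\<in>S. (f - p) \<bullet> g = 0)" using hilbert_projection[OF S] by blast
    fix p q assume p: "p \<in> S \<and> (\<forall>g\<in>S. (f - p) \<bullet> g = 0)" and q: "q \<in> S \<and> (\<forall>g\<in>S. (f - q) \<bullet> g = 0)"
    have "p - q \<in> S" using p q S by (simp add: subspace_diff)
    then have "(f - q) \<bullet> (p - q) - (f - p) \<bullet> (p - q) = 0" using p q by simp
    then have "(p - q) \<bullet> (p - q) = 0" by (simp add: inner_simps)
    then show "p = q" by simp
  qed
  from theI'[OF this] show "orth_proj S f \<in> S" "g \<in> S \<Longrightarrow> (f - orth_proj S f) \<bullet> g = 0"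
    unfolding orth_proj_def by blast+
qed

lemma riesz_representation:
  fixes L :: "'h::{real_inner,complete_space} \<Rightarrow> real"
  assumes L: "bounded_linear L"
  shows "\<exists>m. \<forall>g. L g = m \<bullet> g"
proof (cases "\<forall>g. L g = 0")
  case True
  then show ?thesis by (intro exI[of _ 0]) simp
next
  case False
  then obtain z where z: "L z \<noteq> 0" by blast
  interpret L: bounded_linear L by fact
  let ?K = "{g. L g = 0}"
  have K: "subspace ?K" by (auto simp: subspace_def L.add L.scaleR L.zero)
  have "closed ?K" by (intro closed_Collect_eq continuous_intros L.continuous_on)
  then obtain p where p: "L p = 0" "\<And>g. L g = 0 \<Longrightarrow> (z - p) \<bullet> g = 0"
    using hilbert_projection[OF K] by blast
  define u where "u = z - p"
  have Lu: "L u \<noteq> 0" using z p by (simp add: u_def L.diff)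
  then have u0: "u \<bullet> u \<noteq> 0" by (auto simp: L.zero)
  have "L g = ((L u / (u \<bullet> u)) *\<^sub>R u) \<bullet> g" for g
  proof -
    have "L (g - (L g / L u) *\<^sub>R u) = 0" using Lu by (simp add: L.diff L.scaleR)
    then have "u \<bullet> (g - (L g / L u) *\<^sub>R u) = 0" using p(2) u_def by blast
    then have "u \<bullet> g = (L g / L u) * (u \<bullet> u)" by (simp add: inner_simps)
    then show ?thesis using Lu u0 by (simp add: field_simps)
  qed
  then show ?thesis by blast
qed

text \<open>The Lax-Milgram argument: coercivity bounds \<open>T\<close> below, so its range is
  closed, and a residual orthogonal to the range is orthogonal to its own image and hence zero. It
  will be used with the covariance operator plus \<open>lam\<close> to obtain the population ridge
  solution.\<close>

lemma coercive_surj: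
  fixes T :: "'h::{real_inner,complete_space} \<Rightarrow> 'h"
  assumes T: "bounded_linear T" and c: "c > 0" "\<And>v. c * (norm v)\<^sup>2 \<le> T v \<bullet> v"
  shows "\<exists>v. T v = f"
proof -
  interpret T: bounded_linear T by fact
  have low: "c * norm v \<le> norm (T v)" for v
  proof (cases "v = 0")
    case False
    have "c * (norm v)\<^sup>2 \<le> norm (T v) * norm v"
      using c(2)[of v] norm_cauchy_schwarz[of "T v" v] by linarith
    then show ?thesis using False by (simp add: power2_eq_square)
  qed simp
  have sub: "subspace (range T)"
    by (rule linear_subspace_image[OF T.linear_axioms subspace_UNIV])
  have "closed (range T)"
  proof (rule closed_sequential_limits[THEN iffD2], intro allI impI, elim conjE)
    fix q y assume q: "\<forall>n. q n \<in> range T" and y: "q \<longlonglongrightarrow> y"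
    from q have "\<forall>n. \<exists>u. q n = T u" by auto
    then obtain w where w: "\<And>n. q n = T (w n)" by (auto dest!: choice)
    have "Cauchy w"
    proof (rule metric_CauchyI)
      fix e :: real assume e: "e > 0"
      have "Cauchy q" using y LIMSEQ_imp_Cauchy by blast
      then obtain K where K: "\<And>m n. m \<ge> K \<Longrightarrow> n \<ge> K \<Longrightarrow> dist (q m) (q n) < c * e"
        using metric_CauchyD[of q "c * e"] c(1) e by auto
      have "dist (w m) (w n) < e" if "m \<ge> K" "n \<ge> K" for m n
      proof -
        have "c * norm (w m - w n) < c * e"
          using low[of "w m - w n"] K[OF that] by (simp add: w dist_norm T.diff)
        then show ?thesis using c(1) by (simp add: dist_norm)
      qed
      then show "\<exists>M. \<forall>m\<ge>M. \<forall>n\<ge>M. dist (w m) (w n) < e" by blast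
    qed
    then obtain v where "w \<longlonglongrightarrow> v" using Cauchy_convergent convergent_def by blast
    then have "q \<longlonglongrightarrow> T v" unfolding w by (rule T.tendsto)
    then have "y = T v" using y LIMSEQ_unique by blast
    then show "y \<in> range T" by blast
  qed
  then obtain v where v: "\<And>g. (f - T v) \<bullet> T g = 0" using hilbert_projection[OF sub, of f] by auto
  define d where "d = f - T v"
  have "c * (norm d)\<^sup>2 \<le> 0" using c(2)[of d] v[of d] by (simp add: d_def inner_commute)
  then have "d = 0" using c(1) by (simp add: mult_le_0_iff)
  then show ?thesis by (auto simp: d_def)
qed

section \<open>The Schur product theorem for Gram matrices\<close>

lemma schur_product_split:
  fixes a :: "'i \<Rightarrow> 'h::real_inner" and b :: "'i \<Rightarrow> 'g::real_inner"
  assumes "u \<bullet> u = 1"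
  defines "b' \<equiv> \<lambda>i. b i - (b i \<bullet> u) *\<^sub>R u"
  shows "(\<Sum>i\<in>I. \<Sum>j\<in>I. (a i \<bullet> a j) * (b i \<bullet> b j)) =
     (\<Sum>i\<in>I. \<Sum>j\<in>I. (a i \<bullet> a j) * (b' i \<bullet> b' j)) + (norm (\<Sum>i\<in>I. (b i \<bullet> u) *\<^sub>R a i))\<^sup>2"
proof -
  have "b i \<bullet> b j = b' i \<bullet> b' j + (b i \<bullet> u) * (b j \<bullet> u)" for i j
    using assms by (simp add: b'_def inner_simps inner_commute algebra_simps)
  then show ?thesis
    by (simp add: power2_norm_eq_inner inner_sum_left inner_sum_right sum.distrib
        distrib_left sum_distrib_left mult_ac inner_commute)
qed

text \<open>Induction on the number of nonzero \<open>b i\<close>: removing from all vectors the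
  component along one nonzero \<open>b m\<close> kills \<open>b m\<close>, creates no new nonzero
  vector, and by the split changes the sum only by a squared norm.\<close>

lemma schur_product_nonneg:
  fixes a :: "'i \<Rightarrow> 'h::real_inner" and b :: "'i \<Rightarrow> 'g::real_inner"
  assumes "finite I"
  shows "0 \<le> (\<Sum>i\<in>I. \<Sum>j\<in>I. (a i \<bullet> a j) * (b i \<bullet> b j))"
proof (induction "card {i\<in>I. b i \<noteq> 0}" arbitrary: b rule: less_induct)
  case less
  show ?case
  proof (cases "\<forall>i\<in>I. b i = 0")
    case False
    then obtain m where m: "m \<in> I" "b m \<noteq> 0" by blast
    define u where "u = (1 / norm (b m)) *\<^sub>R b m"
    have uu: "u \<bullet> u = 1" using m by (simp add: u_def dot_square_norm power2_eq_square)
    define b' where "b' i = b i - (b i \<bullet> u) *\<^sub>R u" for i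
    have "b' m = 0" using m by (simp add: b'_def u_def dot_square_norm power2_eq_square)
    moreover have "b' i = 0" if "b i = 0" for i using that by (simp add: b'_def)
    ultimately have "{i\<in>I. b' i \<noteq> 0} \<subset> {i\<in>I. b i \<noteq> 0}" using m by auto
    then have "0 \<le> (\<Sum>i\<in>I. \<Sum>j\<in>I. (a i \<bullet> a j) * (b' i \<bullet> b' j))"
      using \<open>finite I\<close> by (intro less) (auto intro!: psubset_card_mono)
    then show ?thesis unfolding schur_product_split[OF uu, where I = I and a = a and b = b] by (simp add: b'_def)
  qed (simp add: sum_nonneg)
qed

text \<open>Split along \<open>w / norm w\<close> and discard the nonnegative remainder, so that
  only the rank-one term stays. With \<open>b\<close> the features of the covariates and
  \<open>w\<close> the ridge residual, this takes the sample-dependent \<open>w\<close> out of the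
  weighted sum.\<close>

lemma schur_product_mono:
  fixes a :: "'i \<Rightarrow> 'h::real_inner" and b :: "'i \<Rightarrow> 'g::real_inner"
  assumes "finite I"
  shows "(norm (\<Sum>i\<in>I. (b i \<bullet> w) *\<^sub>R a i))\<^sup>2
    \<le> (norm w)\<^sup>2 * (\<Sum>i\<in>I. \<Sum>j\<in>I. (a i \<bullet> a j) * (b i \<bullet> b j))"
proof (cases "w = 0")
  case False
  define u where "u = (1 / norm w) *\<^sub>R w"
  have uu: "u \<bullet> u = 1" using False by (simp add: u_def dot_square_norm power2_eq_square)
  have 1: "(norm (\<Sum>i\<in>I. (b i \<bullet> u) *\<^sub>R a i))\<^sup>2 \<le> (\<Sum>i\<in>I. \<Sum>j\<in>I. (a i \<bullet> a j) * (b i \<bullet> b j))"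
    unfolding schur_product_split[OF uu, where I = I and a = a and b = b] using schur_product_nonneg[OF assms] by simp
  have w: "w = norm w *\<^sub>R u" using False by (simp add: u_def)
  have "(\<Sum>i\<in>I. (b i \<bullet> w) *\<^sub>R a i) = norm w *\<^sub>R (\<Sum>i\<in>I. (b i \<bullet> u) *\<^sub>R a i)"
    by (subst w) (simp add: scaleR_sum_right)
  then show ?thesis using 1 by (simp add: power_mult_distrib mult_left_mono)
qed simp

section \<open>Semidefinite forms and powers of a positive operator\<close>

lemma semidefinite_cauchy_schwarz:
  fixes C :: "'h::real_inner \<Rightarrow> 'h"
  assumes C: "linear C" and sym: "\<And>f g. C f \<bullet> g = f \<bullet> C g" and pos: "\<And>f. 0 \<le> C f \<bullet> f"
  shows "(C w \<bullet> v)\<^sup>2 \<le> (C w \<bullet> w) * (C v \<bullet> v)"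
proof -
  interpret linear C by fact
  have quad: "0 \<le> C w \<bullet> w + 2 * t * (C w \<bullet> v) + t\<^sup>2 * (C v \<bullet> v)" for t :: real
    using pos[of "w + t *\<^sub>R v"] sym[of v w]
    by (simp add: add scale inner_simps inner_commute algebra_simps power2_eq_square)
  show ?thesis
  proof (cases "C v \<bullet> v = 0")
    case True
    have "C w \<bullet> v = 0"
    proof (rule ccontr)
      assume n: "C w \<bullet> v \<noteq> 0"
      \<comment> \<open>With the quadratic term gone, \<open>quad\<close> is affine in
        \<open>t\<close>; this \<open>t\<close> gives it the value -1.\<close>
      have "0 \<le> C w \<bullet> w + 2 * (- (C w \<bullet> w + 1) / (2 * (C w \<bullet> v))) * (C w \<bullet> v)"
        using quad[of "- (C w \<bullet> w + 1) / (2 * (C w \<bullet> v))"] True by simp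
      then have "0 \<le> C w \<bullet> w - (C w \<bullet> w + 1)" using n by (simp add: field_simps)
      then show False by simp
    qed
    then show ?thesis using True by simp
  next
    case False
    then have p: "C v \<bullet> v > 0" using pos[of v] by simp
    have "C w \<bullet> w + 2 * (- (C w \<bullet> v) / (C v \<bullet> v)) * (C w \<bullet> v) + (- (C w \<bullet> v) / (C v \<bullet> v))\<^sup>2 * (C v \<bullet> v)
      = C w \<bullet> w - (C w \<bullet> v)\<^sup>2 / (C v \<bullet> v)"
      using p by (simp add: power2_eq_square field_simps)
    then have "0 \<le> C w \<bullet> w - (C w \<bullet> v)\<^sup>2 / (C v \<bullet> v)"
      using quad[of "- (C w \<bullet> v) / (C v \<bullet> v)"] by simp
    then show ?thesis using p by (simp add: field_simps)
  qed
qed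

lemma sqrt_form_triangle:
  fixes C :: "'h::real_inner \<Rightarrow> 'h"
  assumes C: "linear C" and sym: "\<And>f g. C f \<bullet> g = f \<bullet> C g" and pos: "\<And>f. 0 \<le> C f \<bullet> f"
  shows "sqrt (C (u + d) \<bullet> (u + d)) \<le> sqrt (C u \<bullet> u) + sqrt (C d \<bullet> d)"
proof -
  interpret linear C by fact
  have "C u \<bullet> d \<le> sqrt (C u \<bullet> u) * sqrt (C d \<bullet> d)"
    using semidefinite_cauchy_schwarz[OF C sym pos, of u d] real_le_rsqrt by (fastforce simp: real_sqrt_mult)
  moreover have "C (u + d) \<bullet> (u + d) = C u \<bullet> u + 2 * (C u \<bullet> d) + C d \<bullet> d"
    using sym[of d u] by (simp add: add inner_add_left inner_add_right inner_commute)
  ultimately have "C (u + d) \<bullet> (u + d) \<le> (sqrt (C u \<bullet> u) + sqrt (C d \<bullet> d))\<^sup>2"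
    using pos by (simp add: power2_sum)
  then show ?thesis using pos by (intro real_le_lsqrt) auto
qed

text \<open>A finite partial sum of \<open>op_power C \<gamma> h\<close> equals \<open>C w\<close>,
  and Cauchy-Schwarz for the form of \<open>C\<close> leaves \<open>C w \<bullet> w\<close>, the sum
  of \<open>s powr (2 * \<gamma> - 1)\<close> times the squared norms of the spectral components of
  \<open>h\<close>. As \<open>2 * \<gamma> - 1\<close> is nonnegative and \<open>s \<le> K\<close>,
  Bessel's inequality bounds it; this is where \<open>\<gamma> \<ge> 1/2\<close> enters.\<close>

lemma op_power_form_bound:
  fixes C :: "'h::{real_inner,complete_space} \<Rightarrow> 'h"
  assumes C: "bounded_linear C" and sym: "\<And>f g. C f \<bullet> g = f \<bullet> C g"
    and pos: "\<And>f. 0 \<le> C f \<bullet> f" and K: "0 < K" "\<And>f. C f \<bullet> f \<le> K * (norm f)\<^sup>2"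
    and \<gamma>: "1/2 \<le> \<gamma>"
  shows "\<exists>M\<ge>0. \<forall>v. (op_power C \<gamma> h \<bullet> v)\<^sup>2 \<le> M * (C v \<bullet> v)"
proof -
  interpret C: bounded_linear C by fact
  define S where "S = {s. 0 < s \<and> eigenspace C s \<noteq> {0}}"
  define p where "p s = orth_proj (eigenspace C s) h" for s
  have subs: "subspace (eigenspace C s)" for s
    by (auto simp: subspace_def eigenspace_def C.add C.scaleR C.zero scaleR_right_distrib)
  have clos: "closed (eigenspace C s)" for s
    unfolding eigenspace_def by (intro closed_Collect_eq continuous_intros C.continuous_on)
  have p: "C (p s) = s *\<^sub>R p s" for s
    using orth_proj_props(1)[OF subs clos] by (auto simp: p_def eigenspace_def)
  have hp: "h \<bullet> p s = p s \<bullet> p s" for s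
    using orth_proj_props(2)[OF subs clos, where f = h and g = "p s"]
      orth_proj_props(1)[OF subs clos, where f = h]
    by (simp add: p_def inner_diff_left)
  have orth: "p s \<bullet> p t = 0" if "s \<noteq> t" for s t
    using sym[of "p s" "p t"] that by (simp add: p)
  have bessel: "(\<Sum>s\<in>F. p s \<bullet> p s) \<le> (norm h)\<^sup>2" if "finite F" for F
  proof -
    have 1: "(\<Sum>s\<in>F. p s) \<bullet> (\<Sum>s\<in>F. p s) = (\<Sum>s\<in>F. p s \<bullet> p s)"
    proof -
      have "(\<Sum>t\<in>F. p s \<bullet> p t) = p s \<bullet> p s" if "s \<in> F" for s
      proof -
        have "(\<Sum>t\<in>F. p s \<bullet> p t) = (\<Sum>t\<in>F. if t = s then p s \<bullet> p s else 0)"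
          by (rule sum.cong) (auto simp: orth)
        then show ?thesis using that \<open>finite F\<close> by simp
      qed
      then show ?thesis by (subst inner_sum_left) (simp add: inner_sum_right)
    qed
    have "0 \<le> (h - (\<Sum>s\<in>F. p s)) \<bullet> (h - (\<Sum>s\<in>F. p s))" by simp
    also have "\<dots> = (norm h)\<^sup>2 - 2 * (h \<bullet> (\<Sum>s\<in>F. p s)) + (\<Sum>s\<in>F. p s) \<bullet> (\<Sum>s\<in>F. p s)"
      by (simp add: inner_diff_left inner_diff_right inner_commute power2_norm_eq_inner)
    also have "\<dots> = (norm h)\<^sup>2 - (\<Sum>s\<in>F. p s \<bullet> p s)"
      unfolding 1 by (simp add: inner_sum_right hp)
    finally show ?thesis by simp
  qed
  have sK: "s \<le> K" if "s \<in> S" for s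
  proof -
    have "0 \<in> eigenspace C s" using subs subspace_0 by blast
    then obtain f where f: "f \<in> eigenspace C s" "f \<noteq> 0" using \<open>s \<in> S\<close> by (auto simp: S_def)
    have "s * (norm f)\<^sup>2 \<le> K * (norm f)\<^sup>2"
      using K(2)[of f] f by (simp add: eigenspace_def power2_norm_eq_inner)
    then show ?thesis using f by simp
  qed
  define M where "M = K powr (2 * \<gamma> - 1) * (norm h)\<^sup>2"
  have M0: "M \<ge> 0" by (simp add: M_def)
  have fin: "((\<Sum>s\<in>F. (s powr \<gamma>) *\<^sub>R p s) \<bullet> v)\<^sup>2 \<le> M * (C v \<bullet> v)" if F: "finite F" "F \<subseteq> S" for F v
  proof -
    \<comment> \<open>The power \<open>\<gamma> - 1\<close> of \<open>C\<close> applied to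
      \<open>h\<close>, truncated to the eigenvalues in \<open>F\<close>, so that one application of
      \<open>C\<close> restores the exponent \<open>\<gamma>\<close>.\<close>
    define w where "w = (\<Sum>s\<in>F. (s powr (\<gamma> - 1)) *\<^sub>R p s)"
    have s0: "s > 0" if "s \<in> F" for s using that F by (auto simp: S_def)
    have Cw: "C w = (\<Sum>s\<in>F. (s powr \<gamma>) *\<^sub>R p s)"
      unfolding w_def C.sum C.scaleR p
      by (rule sum.cong) (auto dest!: s0 simp: powr_diff)
    have "C w \<bullet> w = (\<Sum>s\<in>F. s powr (2 * \<gamma> - 1) * (p s \<bullet> p s))"
    proof -
      have "(\<Sum>t\<in>F. t powr (\<gamma> - 1) * (s powr \<gamma> * (p s \<bullet> p t))) = s powr (2 * \<gamma> - 1) * (p s \<bullet> p s)"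
        if "s \<in> F" for s
      proof -
        have "(\<Sum>t\<in>F. t powr (\<gamma> - 1) * (s powr \<gamma> * (p s \<bullet> p t))) =
          (\<Sum>t\<in>F. if t = s then s powr \<gamma> * s powr (\<gamma> - 1) * (p s \<bullet> p s) else 0)"
          by (rule sum.cong) (auto simp: orth)
        also have "\<dots> = s powr \<gamma> * s powr (\<gamma> - 1) * (p s \<bullet> p s)" using that F by simp
        also have "s powr \<gamma> * s powr (\<gamma> - 1) = s powr (2 * \<gamma> - 1)"
          by (simp add: powr_add[symmetric])
        finally show ?thesis .
      qed
      then show ?thesis unfolding Cw
        by (subst inner_sum_left) (simp add: w_def inner_sum_right mult.assoc sum_distrib_left)
    qed
    also have "\<dots> \<le> (\<Sum>s\<in>F. K powr (2 * \<gamma> - 1) * (p s \<bullet> p s))"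
      using \<gamma> F sK s0 by (intro sum_mono mult_right_mono powr_mono2) (auto intro: less_imp_le)
    also have "\<dots> \<le> M"
      using bessel[OF F(1)] by (simp add: M_def sum_distrib_left[symmetric] mult_left_mono)
    finally have "C w \<bullet> w \<le> M" .
    then have "(C w \<bullet> w) * (C v \<bullet> v) \<le> M * (C v \<bullet> v)" using pos by (intro mult_right_mono)
    then show ?thesis
      using semidefinite_cauchy_schwarz[OF C.linear_axioms sym pos, of w v] Cw by simp
  qed
  have "(op_power C \<gamma> h \<bullet> v)\<^sup>2 \<le> M * (C v \<bullet> v)" for v
  proof -
    have op: "op_power C \<gamma> h = (\<Sum>\<^sub>\<infinity>s\<in>S. (s powr \<gamma>) *\<^sub>R p s)"
      by (simp add: op_power_def S_def p_def)
    show ?thesis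
    proof (cases "(\<lambda>s. (s powr \<gamma>) *\<^sub>R p s) summable_on S")
      case True
      then have "((\<lambda>F. \<Sum>s\<in>F. (s powr \<gamma>) *\<^sub>R p s) \<longlongrightarrow> op_power C \<gamma> h) (finite_subsets_at_top S)"
        unfolding op using has_sum_infsum has_sum_def by blast
      then have "((\<lambda>F. ((\<Sum>s\<in>F. (s powr \<gamma>) *\<^sub>R p s) \<bullet> v)\<^sup>2) \<longlongrightarrow> (op_power C \<gamma> h \<bullet> v)\<^sup>2)
          (finite_subsets_at_top S)" by (intro tendsto_intros)
      then show ?thesis
        by (rule tendsto_upperbound) (auto intro!: eventually_finite_subsets_at_top_weakI fin)
    next
      \<comment> \<open>If the family is not summable, \<open>infsum\<close> has the value 0 and the
        bound is trivial.\<close>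
      case False
      then show ?thesis using op infsum_not_exists[OF False] M0 pos by simp
    qed
  qed
  then show ?thesis using M0 by blast
qed

subsection \<open>Ridge weights\<close>

lemma sum_of_bool_mult:
  fixes y :: "nat \<Rightarrow> real"
  assumes "i < n"
  shows "(\<Sum>j<n. of_bool (i = j) * y j) = y i" "(\<Sum>j<n. y j * of_bool (j = i)) = y i"
proof -
  have "(\<Sum>j<n. of_bool (i = j) * y j) = (\<Sum>j<n. if j = i then y i else 0)"
    "(\<Sum>j<n. y j * of_bool (j = i)) = (\<Sum>j<n. if j = i then y i else 0)"
    by (auto intro!: sum.cong)
  then show "(\<Sum>j<n. of_bool (i = j) * y j) = y i" "(\<Sum>j<n. y j * of_bool (j = i)) = y i"
    using assms by simp_all
qed

section \<open>Positive definite linear systems\<close>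

definition pos_def_on :: "nat \<Rightarrow> (nat \<Rightarrow> nat \<Rightarrow> real) \<Rightarrow> bool" where
  "pos_def_on n A \<longleftrightarrow> (\<forall>i<n. \<forall>j<n. A i j = A j i) \<and>
     (\<forall>x. (\<exists>i<n. x i \<noteq> 0) \<longrightarrow> 0 < (\<Sum>i<n. \<Sum>j<n. x i * x j * A i j))"

text \<open>Gaussian elimination of the last unknown: the Schur complement \<open>A'\<close> of the
  pivot \<open>a\<close> is again positive definite, so the induction hypothesis solves the reduced
  system, and the last equation gives the remaining unknown.\<close>

lemma pos_def_solve:
  assumes "pos_def_on n A"
  shows "\<exists>x. \<forall>i<n. (\<Sum>j<n. A i j * x j) = b i"
  using assms
proof (induction n arbitrary: A b)
  case (Suc n)
  define a where "a = A n n"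
  have sym: "A i j = A j i" if "i \<le> n" "j \<le> n" for i j
    using Suc.prems that by (auto simp: pos_def_on_def less_Suc_eq_le)
  have pos: "0 < (\<Sum>i\<le>n. \<Sum>j\<le>n. x i * x j * A i j)" if "i \<le> n" "x i \<noteq> 0" for x i
    using Suc.prems that by (auto simp: pos_def_on_def lessThan_Suc_atMost less_Suc_eq_le)
  have a: "a > 0"
    using pos[of n "\<lambda>i. of_bool (i = n)"] by (simp add: a_def lessThan_Suc_atMost[symmetric])
  define A' where "A' i j = A i j - A i n * A n j / a" for i j
  have "pos_def_on n A'"
    unfolding pos_def_on_def
  proof (intro conjI allI impI)
    show "A' i j = A' j i" if "i < n" "j < n" for i j
      using that sym[of i j] sym[of i n] sym[of j n] by (simp add: A'_def)
    fix x :: "nat \<Rightarrow> real" assume "\<exists>i<n. x i \<noteq> 0"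
    then obtain i where i: "i < n" "x i \<noteq> 0" by blast
    define s where "s = (\<Sum>j<n. A n j * x j)"
    have s': "(\<Sum>i<n. A i n * x i) = s"
      unfolding s_def by (intro sum.cong) (auto simp: sym)
    \<comment> \<open>The last coordinate \<open>- s / a\<close> minimises the form over all
      extensions of \<open>x\<close>; the minimum is the form of \<open>A'\<close> at
      \<open>x\<close>.\<close>
    define y where "y = x(n := - s / a)"
    have "0 < (\<Sum>i\<le>n. \<Sum>j\<le>n. y i * y j * A i j)" using i by (intro pos[of i]) (auto simp: y_def)
    also have "\<dots> = (\<Sum>i<n. (\<Sum>j<n. y i * y j * A i j) + y i * y n * A i n)
        + ((\<Sum>j<n. y n * y j * A n j) + y n * y n * a)"
      by (simp add: lessThan_Suc_atMost[symmetric] a_def)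
    also have "\<dots> = (\<Sum>i<n. \<Sum>j<n. x i * x j * A i j) + (\<Sum>i<n. x i * y n * A i n)
        + ((\<Sum>j<n. y n * x j * A n j) + y n * y n * a)"
      by (simp add: y_def sum.distrib sum_negf sum_subtractf)
    also have "(\<Sum>i<n. x i * y n * A i n) = y n * s"
      by (simp add: s'[symmetric] sum_distrib_left mult_ac)
    also have "(\<Sum>j<n. y n * x j * A n j) = y n * s"
      by (simp add: s_def sum_distrib_left mult_ac)
    also have "(\<Sum>i<n. \<Sum>j<n. x i * x j * A i j) + y n * s + (y n * s + y n * y n * a)
       = (\<Sum>i<n. \<Sum>j<n. x i * x j * A i j) - s * s / a"
      using a by (simp add: y_def field_simps)
    also have "s * s / a = (\<Sum>i<n. \<Sum>j<n. x i * x j * (A i n * A n j / a))"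
      by (subst s'[symmetric]) (simp add: s_def sum_product sum_divide_distrib mult_ac)
    also have "(\<Sum>i<n. \<Sum>j<n. x i * x j * A i j) - \<dots> = (\<Sum>i<n. \<Sum>j<n. x i * x j * A' i j)"
      by (simp add: A'_def right_diff_distrib sum_subtractf)
    finally show "0 < (\<Sum>i<n. \<Sum>j<n. x i * x j * A' i j)" .
  qed
  from Suc.IH[OF this, of "\<lambda>i. b i - A i n * b n / a"]
  obtain x where x: "\<forall>i<n. (\<Sum>j<n. A' i j * x j) = b i - A i n * b n / a" ..
  define t where "t = (b n - (\<Sum>j<n. A n j * x j)) / a"
  have "(\<Sum>j<Suc n. A i j * (x(n := t)) j) = b i" if "i < Suc n" for i
  proof (cases "i = n")
    case True
    then show ?thesis using a by (simp add: t_def a_def)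
  next
    case False
    then have "(\<Sum>j<n. A' i j * x j) = b i - A i n * b n / a" using x that by simp
    moreover have "(\<Sum>j<n. A' i j * x j) = (\<Sum>j<n. A i j * x j) - A i n / a * (\<Sum>j<n. A n j * x j)"
      by (simp add: A'_def left_diff_distrib right_diff_distrib sum_subtractf sum_distrib_left sum_divide_distrib mult_ac)
    ultimately show ?thesis using a by (simp add: t_def field_simps)
  qed
  then show ?case by blast
qed simp

lemma pos_def_kernel_trivial:
  assumes "pos_def_on n A" "\<And>i. i < n \<Longrightarrow> (\<Sum>j<n. A i j * x j) = 0" "i < n"
  shows "x i = 0"
proof (rule ccontr)
  assume "x i \<noteq> 0"
  then have "0 < (\<Sum>i<n. \<Sum>j<n. x i * x j * A i j)" using assms by (auto simp: pos_def_on_def)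
  also have "\<dots> = (\<Sum>i<n. x i * (\<Sum>j<n. A i j * x j))" by (simp add: sum_distrib_left mult_ac)
  also have "\<dots> = 0" using assms(2) by simp
  finally show False by simp
qed

text \<open>\<open>mat_inverse\<close> is a definite description, so existence and uniqueness of a
  two-sided inverse come first. The columns of a right inverse \<open>B\<close> solve linear
  systems; \<open>A\<close> annihilates the columns of \<open>B A - I\<close>, and injectivity of
  \<open>A\<close> makes \<open>B\<close> a left inverse too.\<close>

lemma mat_inverse_right:
  assumes pd: "pos_def_on n A" and "i < n" "j < n"
  shows "(\<Sum>m<n. A i m * mat_inverse n A m j) = of_bool (i = j)"
proof -
  let ?P = "\<lambda>B. (\<forall>i j. \<not> (i < n \<and> j < n) \<longrightarrow> B i j = 0) \<and>
             (\<forall>i<n. \<forall>j<n. (\<Sum>m<n. A i m * B m j) = of_bool (i = j)) \<and>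
             (\<forall>i<n. \<forall>j<n. (\<Sum>m<n. B i m * A m j) = (of_bool (i = j) :: real))"
  have "\<exists>!B. ?P B"
  proof (rule ex_ex1I)
    have "\<forall>j. \<exists>x. \<forall>i<n. (\<Sum>m<n. A i m * x m) = of_bool (i = j)"
      by (intro allI pos_def_solve[OF pd])
    from choice[OF this] obtain S
      where S: "\<And>j i. i < n \<Longrightarrow> (\<Sum>m<n. A i m * S j m) = of_bool (i = j)" by blast
    define B where "B i j = (if i < n \<and> j < n then S j i else 0)" for i j
    have r: "(\<Sum>m<n. A i m * B m j) = of_bool (i = j)" if "i < n" "j < n" for i j
      using S[OF that(1), of j] that by (simp add: B_def)
    have l: "(\<Sum>m<n. B i m * A m j) = of_bool (i = j)" if i: "i < n" and j: "j < n" for i j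
    proof -
      have "(\<Sum>m<n. A p m * ((\<Sum>q<n. B m q * A q j) - of_bool (m = j))) = 0" if p: "p < n" for p
      proof -
        have "(\<Sum>m<n. A p m * (\<Sum>q<n. B m q * A q j)) = (\<Sum>m<n. \<Sum>q<n. A p m * B m q * A q j)"
          by (simp add: sum_distrib_left mult.assoc)
        also have "\<dots> = (\<Sum>q<n. \<Sum>m<n. A p m * B m q * A q j)" by (rule sum.swap)
        also have "\<dots> = (\<Sum>q<n. (\<Sum>m<n. A p m * B m q) * A q j)"
          by (simp add: sum_distrib_right)
        also have "\<dots> = (\<Sum>q<n. if q = p then A q j else 0)"
          using r[OF p] by (intro sum.cong) auto
        also have "\<dots> = A p j" using p by simp
        finally have "(\<Sum>m<n. A p m * (\<Sum>q<n. B m q * A q j)) = A p j" .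
        moreover have "(\<Sum>m<n. A p m * of_bool (m = j)) = A p j"
          by (rule sum_of_bool_mult[OF j])
        ultimately show ?thesis by (simp add: right_diff_distrib sum_subtractf)
      qed
      from pos_def_kernel_trivial[OF pd this i] show ?thesis by simp
    qed
    show "\<exists>B. ?P B" using r l by (intro exI[of _ B]) (auto simp: B_def)
  next
    fix B B' assume B: "?P B" and B': "?P B'"
    have "B i j = B' i j" for i j
    proof (cases "i < n \<and> j < n")
      case True
      have "(\<Sum>m<n. A p m * (B m j - B' m j)) = 0" if "p < n" for p
        using B B' that True by (simp add: right_diff_distrib sum_subtractf)
      from pos_def_kernel_trivial[OF pd this, of i] show ?thesis using True by simp
    next
      case False
      then show ?thesis using B B' by metis
    qed
    then show "B = B'" by blast
  qed
  from theI'[OF this] show ?thesis using assms unfolding mat_inverse_def by blast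
qed

text \<open>This is row \<open>i\<close> of the normal equations, read in feature space. The matrix
  is invertible as a Gram matrix plus a positive multiple of the identity. All later arguments about
  the weights use this identity in place of the matrix inverse.\<close>

lemma ridge_weights_residual:
  fixes \<phi> :: "'x \<Rightarrow> 'h::real_inner"
  assumes k: "\<And>a b. k a b = \<phi> a \<bullet> \<phi> b" and "0 < lam" "i < n"
  shows "lam * real n * ridge_weights k lam n xs x i
    = \<phi> (xs i) \<bullet> (\<phi> x - (\<Sum>j<n. ridge_weights k lam n xs x j *\<^sub>R \<phi> (xs j)))"
proof -
  define A where "A = (\<lambda>i j. k (xs i) (xs j) + lam * real n * of_bool (i = j))"
  define \<beta> where "\<beta> = ridge_weights k lam n xs x"
  have c: "0 < lam * real n" using assms by simp
  have Asum: "(\<Sum>j<n. A i j * y j) = \<phi> (xs i) \<bullet> (\<Sum>j<n. y j *\<^sub>R \<phi> (xs j)) + lam * real n * y i"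
    if "i < n" for i y
  proof -
    have "(\<Sum>j<n. of_bool (i = j) * y j) = y i"
      by (rule sum_of_bool_mult[OF that])
    then have "(\<Sum>j<n. lam * real n * of_bool (i = j) * y j) = lam * real n * y i"
      by (simp only: mult.assoc sum_distrib_left[symmetric])
    moreover have "(\<Sum>j<n. A i j * y j) = (\<Sum>j<n. (\<phi> (xs i) \<bullet> \<phi> (xs j)) * y j)
        + (\<Sum>j<n. lam * real n * of_bool (i = j) * y j)"
      unfolding A_def k distrib_right sum.distrib ..
    ultimately show ?thesis by (simp add: inner_sum_right mult.commute)
  qed
  have "pos_def_on n A"
    unfolding pos_def_on_def
  proof (intro conjI allI impI)
    show "A i j = A j i" if "i < n" "j < n" for i j by (auto simp: A_def k inner_commute)
    fix y :: "nat \<Rightarrow> real" assume "\<exists>i<n. y i \<noteq> 0"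
    then obtain i where i: "i < n" "y i \<noteq> 0" by blast
    have "(\<Sum>i<n. \<Sum>j<n. y i * y j * A i j) = (\<Sum>i<n. y i * (\<Sum>j<n. A i j * y j))"
      by (simp add: sum_distrib_left mult_ac)
    also have "\<dots> = (\<Sum>i<n. y i * (\<phi> (xs i) \<bullet> (\<Sum>j<n. y j *\<^sub>R \<phi> (xs j)))) + lam * real n * (\<Sum>i<n. (y i)\<^sup>2)"
      unfolding sum_distrib_left sum.distrib[symmetric]
      by (intro sum.cong refl)
        (simp add: Asum sum_distrib_left[symmetric], simp add: algebra_simps power2_eq_square)
    also have "(\<Sum>i<n. y i * (\<phi> (xs i) \<bullet> (\<Sum>j<n. y j *\<^sub>R \<phi> (xs j)))) = (norm (\<Sum>j<n. y j *\<^sub>R \<phi> (xs j)))\<^sup>2"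
      by (simp add: power2_norm_eq_inner inner_sum_left[of "\<lambda>j. y j *\<^sub>R \<phi> (xs j)"])
    finally have "(\<Sum>i<n. \<Sum>j<n. y i * y j * A i j)
      = (norm (\<Sum>j<n. y j *\<^sub>R \<phi> (xs j)))\<^sup>2 + lam * real n * (\<Sum>i<n. (y i)\<^sup>2)" .
    moreover have "0 < (\<Sum>i<n. (y i)\<^sup>2)" using i by (intro sum_pos2[of _ i]) auto
    ultimately show "0 < (\<Sum>i<n. \<Sum>j<n. y i * y j * A i j)"
      using c by (simp add: add_nonneg_pos)
  qed
  note inv = mat_inverse_right[OF this]
  have "(\<Sum>m<n. A i m * \<beta> m) = (\<Sum>j<n. (\<Sum>m<n. A i m * mat_inverse n A m j) * k (xs j) x)"
    unfolding \<beta>_def ridge_weights_def A_def[symmetric]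
    by (simp add: sum_distrib_left sum_distrib_right mult.assoc) (rule sum.swap)
  also have "\<dots> = (\<Sum>j<n. of_bool (i = j) * k (xs j) x)"
    using inv[OF assms(3)] by (intro sum.cong) auto
  also have "\<dots> = k (xs i) x"
    by (rule sum_of_bool_mult[OF assms(3)])
  finally show ?thesis
    using Asum[OF assms(3), of \<beta>] by (simp add: \<beta>_def k inner_diff_right)
qed

text \<open>Pairing \<open>v\<close> with \<open>\<phi> x\<close> gives
  \<open>(norm v)\<^sup>2\<close> plus a nonnegative multiple of the squared weights. For the second
  claim, \<open>v\<close> solves the equation of \<open>u\<close> with the empirical covariance
  \<open>Ch\<close> in place of \<open>C\<close>. Subtracting and pairing with \<open>v - u\<close>
  lets the positive term of \<open>Ch\<close> drop out, so the error only involves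
  \<open>Ch u - C u\<close> at the given vector \<open>u\<close>.\<close>

lemma ridge_residual_bounds:
  fixes \<phi> :: "'x \<Rightarrow> 'h::real_inner"
  assumes "0 < lam" "0 < n"
    and \<beta>: "\<And>i. i < n \<Longrightarrow> lam * real n * \<beta> i = \<phi> (xs i) \<bullet> v"
    and v: "v = \<phi> x - (\<Sum>j<n. \<beta> j *\<^sub>R \<phi> (xs j))"
  shows "norm v \<le> norm (\<phi> x)"
    and "linear C \<Longrightarrow> C u + lam *\<^sub>R u = lam *\<^sub>R \<phi> x \<Longrightarrow>
      lam * norm (v - u) \<le> norm ((1 / real n) *\<^sub>R (\<Sum>i<n. (\<phi> (xs i) \<bullet> u) *\<^sub>R \<phi> (xs i) - C u))"
proof -
  have "v \<bullet> \<phi> x = v \<bullet> (v + (\<Sum>j<n. \<beta> j *\<^sub>R \<phi> (xs j)))" by (simp add: v)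
  also have "\<dots> = (norm v)\<^sup>2 + (\<Sum>j<n. \<beta> j * (lam * real n * \<beta> j))"
    by (simp add: inner_add_right power2_norm_eq_inner inner_sum_right \<beta> inner_commute)
  finally have 1: "v \<bullet> \<phi> x = (norm v)\<^sup>2 + (\<Sum>j<n. \<beta> j * (lam * real n * \<beta> j))" .
  have 2: "(\<Sum>j<n. \<beta> j * (lam * real n * \<beta> j)) \<ge> 0"
    using assms(1) by (intro sum_nonneg)
      (simp add: mult.left_commute[of "\<beta> _"])
  from 1 2 have "(norm v)\<^sup>2 \<le> norm v * norm (\<phi> x)"
    using norm_cauchy_schwarz[of v "\<phi> x"] by linarith
  then show "norm v \<le> norm (\<phi> x)"
    by (cases "v = 0") (simp_all add: power2_eq_square)
  assume C: "linear C" and u: "C u + lam *\<^sub>R u = lam *\<^sub>R \<phi> x"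
  define Ch where "Ch f = (1 / real n) *\<^sub>R (\<Sum>i<n. (\<phi> (xs i) \<bullet> f) *\<^sub>R \<phi> (xs i))" for f
  have "Ch v = (1 / real n) *\<^sub>R (\<Sum>i<n. (lam * real n * \<beta> i) *\<^sub>R \<phi> (xs i))"
    unfolding Ch_def by (intro arg_cong2[where f = "(*\<^sub>R)"] sum.cong) (simp_all add: \<beta>)
  also have "\<dots> = (1 / real n) *\<^sub>R (lam * real n) *\<^sub>R (\<Sum>i<n. \<beta> i *\<^sub>R \<phi> (xs i))"
    by (simp add: scaleR_sum_right)
  also have "\<dots> = lam *\<^sub>R (\<phi> x - v)" using assms(2) by (simp add: v)
  finally have Chv: "Ch v + lam *\<^sub>R v = lam *\<^sub>R \<phi> x" by (simp add: scaleR_diff_right)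
  define d where "d = v - u"
  have Chd: "Ch d = Ch v - Ch u"
    by (simp add: Ch_def d_def inner_diff_right scaleR_diff_left sum_subtractf scaleR_diff_right)
  have eq: "lam *\<^sub>R d = C u - Ch u - Ch d"
    using Chv u unfolding Chd by (simp add: d_def algebra_simps)
  have "Ch d \<bullet> d = (1 / real n) * (\<Sum>i<n. (\<phi> (xs i) \<bullet> d)\<^sup>2)"
    by (simp add: Ch_def inner_sum_left power2_eq_square)
  then have pos: "0 \<le> Ch d \<bullet> d" by (simp add: sum_nonneg)
  have "lam * (norm d)\<^sup>2 = (C u - Ch u) \<bullet> d - Ch d \<bullet> d"
    using arg_cong[OF eq, of "\<lambda>z. z \<bullet> d"] by (simp add: power2_norm_eq_inner inner_diff_left)
  also have "\<dots> \<le> norm (C u - Ch u) * norm d"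
    using pos norm_cauchy_schwarz[of "C u - Ch u" d] by linarith
  finally have "lam * norm d \<le> norm (C u - Ch u)"
    by (cases "d = 0") (simp_all add: power2_eq_square)
  moreover have "(1 / real n) *\<^sub>R (\<Sum>i<n. (\<phi> (xs i) \<bullet> u) *\<^sub>R \<phi> (xs i) - C u) = Ch u - C u"
    using assms(2) by (simp add: Ch_def sum_subtractf scaleR_diff_right sum_constant_scaleR)
  ultimately show "lam * norm (v - u)
      \<le> norm ((1 / real n) *\<^sub>R (\<Sum>i<n. (\<phi> (xs i) \<bullet> u) *\<^sub>R \<phi> (xs i) - C u))"
    by (simp only: d_def norm_minus_commute)
qed

text \<open>Both bounds come from pairing the equation with \<open>u\<close>. The second is the
  source of the rate \<open>sqrt lam\<close> in the bias.\<close>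

lemma ridge_population_bounds:
  fixes C :: "'h::real_inner \<Rightarrow> 'h"
  assumes pos: "0 \<le> C u \<bullet> u" and lam: "0 < lam" and u: "C u + lam *\<^sub>R u = lam *\<^sub>R f"
  shows "norm u \<le> norm f" "C u \<bullet> u \<le> lam * (norm f)\<^sup>2"
proof -
  have eq: "C u \<bullet> u + lam * (norm u)\<^sup>2 = lam * (f \<bullet> u)"
    using arg_cong[OF u, of "\<lambda>z. z \<bullet> u"] by (simp add: inner_add_left power2_norm_eq_inner)
  have cs: "f \<bullet> u \<le> norm f * norm u" by (rule norm_cauchy_schwarz)
  have "lam * (norm u)\<^sup>2 \<le> lam * (f \<bullet> u)" using eq pos by linarith
  then have "(norm u)\<^sup>2 \<le> norm f * norm u" using lam cs by simp
  then show le: "norm u \<le> norm f" by (cases "u = 0") (simp_all add: power2_eq_square)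
  have "C u \<bullet> u \<le> lam * (f \<bullet> u)" using eq lam by (smt (verit) mult_nonneg_nonneg zero_le_power2)
  also have "\<dots> \<le> lam * (norm f * norm f)"
    using lam cs le by (intro mult_left_mono order_trans[OF cs] mult_left_mono) auto
  finally show "C u \<bullet> u \<le> lam * (norm f)\<^sup>2" by (simp add: power2_eq_square)
qed

subsection \<open>Joint measurability of inner products\<close>

text \<open>The measures of disjoint sets have bounded finite sums, hence are summable, and a
  summable family has countably many nonzero terms.\<close>

lemma (in finite_measure) countable_of_disjoint_positive:
  assumes U: "\<And>x. x \<in> E \<Longrightarrow> U x \<in> sets M" "disjoint_family_on U E"
    and pos: "\<And>x. x \<in> E \<Longrightarrow> 0 < measure M (U x)"
  shows "countable E"
proof -
  have "(\<lambda>x. measure M (U x)) summable_on E"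
  proof (rule nonneg_bdd_above_summable_on)
    show "bdd_above (sum (\<lambda>x. measure M (U x)) ` {F. F \<subseteq> E \<and> finite F})"
    proof (rule bdd_aboveI2)
      fix F assume F: "F \<in> {F. F \<subseteq> E \<and> finite F}"
      have "(\<Sum>x\<in>F. measure M (U x)) = measure M (\<Union>x\<in>F. U x)"
        using F U by (intro finite_measure_finite_Union[symmetric])
          (auto intro: disjoint_family_on_mono)
      also have "\<dots> \<le> measure M (space M)" by (rule bounded_measure)
      finally show "(\<Sum>x\<in>F. measure M (U x)) \<le> measure M (space M)" .
    qed
  qed simp
  then have "countable {x\<in>E. measure M (U x) \<noteq> 0}" by (rule summable_countable_real)
  moreover have "{x\<in>E. measure M (U x) \<noteq> 0} = E" using pos by force
  ultimately show ?thesis by simp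
qed

text \<open>A measure of full support rules out uncountable families of disjoint open sets, so that a
  continuous image of the space in a metric space is separable.\<close>

lemma full_support_countable_net:
  fixes \<phi> :: "'x::topological_space \<Rightarrow> 'h::metric_space"
    and M :: "'x measure"
  assumes M: "prob_space M" "sets M = sets borel" "full_support M"
    and \<phi>: "continuous_on UNIV \<phi>" and e: "0 < e"
  shows "\<exists>E. countable E \<and> (\<forall>x. \<exists>y\<in>E. dist (\<phi> x) (\<phi> y) < e)"
proof -
  interpret prob_space M by fact
  let ?A = "{E. \<forall>x\<in>E. \<forall>y\<in>E. x \<noteq> y \<longrightarrow> e \<le> dist (\<phi> x) (\<phi> y)}"
  \<comment> \<open>Zorn's lemma gives a maximal \<open>e\<close>-separated set of points;
    maximality makes it an \<open>e\<close>-net.\<close>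
  have "\<exists>E\<in>?A. \<forall>X\<in>?A. E \<subseteq> X \<longrightarrow> X = E"
  proof (rule subset_Zorn')
    fix C assume C: "subset.chain ?A C"
    then have CA: "C \<subseteq> ?A" and ch: "\<And>X Y. X \<in> C \<Longrightarrow> Y \<in> C \<Longrightarrow> X \<subseteq> Y \<or> Y \<subseteq> X"
      by (auto simp: subset_chain_def)
    have "e \<le> dist (\<phi> x) (\<phi> y)" if xy: "x \<in> X" "X \<in> C" "y \<in> Y" "Y \<in> C" "x \<noteq> y" for x y X Y
      using ch[OF xy(2,4)] xy CA by blast
    then show "\<Union>C \<in> ?A" by blast
  qed
  then obtain E where EA: "E \<in> ?A" and max: "\<forall>X\<in>?A. E \<subseteq> X \<longrightarrow> X = E" ..
  have E: "e \<le> dist (\<phi> x) (\<phi> y)" if "x \<in> E" "y \<in> E" "x \<noteq> y" for x y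
    using EA that by simp
  have "\<exists>y\<in>E. dist (\<phi> x) (\<phi> y) < e" for x
  proof (rule ccontr)
    assume "\<not> ?thesis"
    then have n: "\<And>y. y \<in> E \<Longrightarrow> e \<le> dist (\<phi> x) (\<phi> y)" by force
    then have "insert x E \<in> ?A" using E by (auto simp: dist_commute)
    then have "insert x E = E" by (rule max[rule_format]) auto
    then show False using n[of x] e by auto
  qed
  moreover have "countable E"
  proof -
    \<comment> \<open>Half the separation as radius makes these open sets disjoint; each contains
      its centre, so full support gives it positive measure.\<close>
    define U where "U x = \<phi> -` ball (\<phi> x) (e/2)" for x
    have op: "open (U x)" for x unfolding U_def by (intro open_vimage open_ball \<phi>)
    have 1: "U x \<in> sets M" for x using op by (simp add: M(2))
    have 2: "disjoint_family_on U E"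
      unfolding disjoint_family_on_def
    proof (intro ballI impI)
      fix x y assume xy: "x \<in> E" "y \<in> E" "x \<noteq> y"
      have "False" if "z \<in> U x" "z \<in> U y" for z
      proof -
        have "dist (\<phi> x) (\<phi> y) \<le> dist (\<phi> x) (\<phi> z) + dist (\<phi> y) (\<phi> z)" by (rule dist_triangle2)
        then show False using that E[OF xy] by (simp add: U_def)
      qed
      then show "U x \<inter> U y = {}" by blast
    qed
    have 3: "0 < measure M (U x)" for x
    proof -
      have "x \<in> U x" using e by (simp add: U_def)
      then have "0 < emeasure M (U x)" using op M(3) unfolding full_support_def by blast
      then show ?thesis by (simp add: emeasure_eq_measure)
    qed
    show ?thesis by (rule countable_of_disjoint_positive[OF 1 2 3])
  qed
  ultimately show ?thesis by blast
qed

text \<open>A pointwise limit of functions with countably many values. Measurability is asked of the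
  index \<open>i n\<close> only, so no sigma-algebra on the target is involved. Strongly measurable
  maps and the continuous feature map both fit.\<close>

definition countably_approximable :: "'a measure \<Rightarrow> ('a \<Rightarrow> 'h::topological_space) \<Rightarrow> bool" where
  "countably_approximable M f \<longleftrightarrow> (\<exists>(i::nat \<Rightarrow> 'a \<Rightarrow> nat) c.
     (\<forall>n. i n \<in> measurable M (count_space UNIV)) \<and>
     (\<forall>x\<in>space M. (\<lambda>n. c n (i n x)) \<longlonglongrightarrow> f x))"

lemma strongly_measurable_approximable:
  assumes "strongly_measurable M f"
  shows "countably_approximable M f"
proof -
  obtain s where s: "\<And>n::nat. simple_function M (s n)" "\<And>x. x \<in> space M \<Longrightarrow> (\<lambda>n. s n x) \<longlonglongrightarrow> f x"
    using assms unfolding strongly_measurable_def by blast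
  have fin: "finite (s n ` space M)" for n using s(1) by (simp add: simple_function_def)
  define i where "i n x = to_nat_on (s n ` space M) (s n x)" for n x
  define c where "c n = from_nat_into (s n ` space M)" for n
  have "i n \<in> measurable M (count_space UNIV)" for n
    unfolding i_def
    by (rule measurable_compose[OF measurable_simple_function[OF s(1)]]) simp
  moreover have "c n (i n x) = s n x" if "x \<in> space M" for n x
    using that fin by (simp add: c_def i_def countable_finite)
  ultimately show ?thesis unfolding countably_approximable_def using s(2) by (intro exI[of _ i] exI[of _ c]) simp
qed

text \<open>\<open>x\<close> is sent to the first point of a countable net whose feature is closer
  than \<open>1 / (n + 1)\<close>. The least such index is measurable because each of the distance
  conditions is open.\<close>

lemma continuous_approximable:
  fixes \<phi> :: "'x::topological_space \<Rightarrow> 'h::metric_space"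
    and M :: "'x measure"
  assumes M: "prob_space M" "sets M = sets borel" "full_support M"
    and \<phi>: "continuous_on UNIV \<phi>"
  shows "countably_approximable borel \<phi>"
proof -
  have "\<exists>E. countable E \<and> (\<forall>x. \<exists>y\<in>E. dist (\<phi> x) (\<phi> y) < inverse (real (Suc n)))" for n
    by (rule full_support_countable_net[OF M \<phi>]) simp
  then obtain E where E: "\<And>n. countable (E n)"
    "\<And>n x. \<exists>y\<in>E n. dist (\<phi> x) (\<phi> y) < inverse (real (Suc n))" by metis
  define d where "d n = from_nat_into (E n)" for n
  have ex: "\<exists>j. dist (\<phi> x) (\<phi> (d n j)) < inverse (real (Suc n))" for n x
    using E(2)[of n x] from_nat_into_surj[OF E(1)] unfolding d_def by metis
  define i where "i n x = (LEAST j. dist (\<phi> x) (\<phi> (d n j)) < inverse (real (Suc n)))" for n x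
  have close: "dist (\<phi> x) (\<phi> (d n (i n x))) < inverse (real (Suc n))" for n x
    unfolding i_def by (rule LeastI_ex[OF ex])
  have "i n \<in> measurable borel (count_space UNIV)" for n
    unfolding i_def
  proof (rule measurable_Least)
    fix j
    have "open {x. dist (\<phi> x) (\<phi> (d n j)) < inverse (real (Suc n))}"
      by (intro open_Collect_less continuous_intros \<phi>)
    then show "Measurable.pred borel (\<lambda>x. dist (\<phi> x) (\<phi> (d n j)) < inverse (real (Suc n)))"
      by (simp add: pred_def)
  qed
  moreover have "(\<lambda>n. \<phi> (d n (i n x))) \<longlonglongrightarrow> \<phi> x" for x
  proof (rule metric_LIMSEQ_I)
    fix r :: real assume "r > 0"
    then obtain K where K: "inverse (real (Suc K)) < r" using reals_Archimedean by blast
    have "dist (\<phi> (d n (i n x))) (\<phi> x) < r" if "n \<ge> K" for n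
    proof -
      have "inverse (real (Suc n)) \<le> inverse (real (Suc K))"
        using that by (intro le_imp_inverse_le) auto
      then show ?thesis
        by (subst dist_commute) (rule less_trans[OF less_le_trans[OF close] K])
    qed
    then show "\<exists>no. \<forall>n\<ge>no. dist (\<phi> (d n (i n x))) (\<phi> x) < r" by blast
  qed
  ultimately show ?thesis unfolding countably_approximable_def
    by (intro exI[of _ i] exI[of _ "\<lambda>n j. \<phi> (d n j)"]) auto
qed

text \<open>Weak measurability of \<open>f\<close> and of \<open>g\<close> does not give this in a
  nonseparable space, yet Fubini and the measurability of norms rely on it. As a relation between
  two maps it can be derived for each pair of features separately and then extended by linearity in
  each argument.\<close>

definition cross_measurable ::
  "'a measure \<Rightarrow> 'b measure \<Rightarrow> ('a \<Rightarrow> 'h::real_inner) \<Rightarrow> ('b \<Rightarrow> 'h) \<Rightarrow> bool" where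
  "cross_measurable M N f g \<longleftrightarrow> (\<lambda>(x, y). f x \<bullet> g y) \<in> borel_measurable (M \<Otimes>\<^sub>M N)"

lemma cross_measurable_commute:
  assumes "cross_measurable M N f g"
  shows "cross_measurable N M g f"
proof -
  have "(\<lambda>z. (\<lambda>(x, y). f x \<bullet> g y) (snd z, fst z)) \<in> borel_measurable (N \<Otimes>\<^sub>M M)"
    using assms unfolding cross_measurable_def
    by (intro measurable_compose[OF measurable_Pair[OF measurable_snd measurable_fst]])
  then show ?thesis by (simp add: cross_measurable_def split_beta' inner_commute)
qed

lemma cross_measurable_add:
  assumes "cross_measurable M N f h" "cross_measurable M N g h"
  shows "cross_measurable M N (\<lambda>x. f x + g x) h"
  using borel_measurable_add[OF assms[unfolded cross_measurable_def]]
  by (simp add: cross_measurable_def split_beta' inner_add_left)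

lemma cross_measurable_scaleR:
  assumes "cross_measurable M N f h" "a \<in> borel_measurable M"
  shows "cross_measurable M N (\<lambda>x. a x *\<^sub>R f x) h"
  using borel_measurable_times[OF measurable_compose[OF measurable_fst assms(2)]
      assms(1)[unfolded cross_measurable_def]]
  by (simp add: cross_measurable_def split_beta')

lemma cross_measurable_compose:
  assumes "cross_measurable M N f g" "p \<in> measurable M' M" "q \<in> measurable N' N"
  shows "cross_measurable M' N' (\<lambda>x. f (p x)) (\<lambda>y. g (q y))"
proof -
  have "(\<lambda>z. (p (fst z), q (snd z))) \<in> measurable (M' \<Otimes>\<^sub>M N') (M \<Otimes>\<^sub>M N)"
    using assms(2,3) by measurable
  from measurable_compose[OF this assms(1)[unfolded cross_measurable_def]]
  show ?thesis by (simp add: cross_measurable_def split_beta')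
qed

lemma cross_measurable_diag:
  assumes "cross_measurable M N f g" "p \<in> measurable L M" "q \<in> measurable L N"
  shows "(\<lambda>z. f (p z) \<bullet> g (q z)) \<in> borel_measurable L"
proof -
  have "(\<lambda>z. (p z, q z)) \<in> measurable L (M \<Otimes>\<^sub>M N)"
    using assms(2,3) by measurable
  from measurable_compose[OF this assms(1)[unfolded cross_measurable_def]]
  show ?thesis by simp
qed

text \<open>One approximable side is enough: for fixed \<open>n\<close>, the inner product is glued
  along the countable index \<open>i n\<close> from the weakly measurable pieces
  \<open>c n j \<bullet> g y\<close>.\<close>

lemma cross_measurable_approximable:
  assumes f: "countably_approximable M f" and g: "\<And>h. (\<lambda>y. h \<bullet> g y) \<in> borel_measurable N"
  shows "cross_measurable M N f g"
proof -
  obtain i c where i [measurable]: "\<And>n::nat. i n \<in> measurable M (count_space (UNIV::nat set))"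
    and lim: "\<And>x. x \<in> space M \<Longrightarrow> (\<lambda>n. c n (i n x)) \<longlonglongrightarrow> f x"
    using f unfolding countably_approximable_def by blast
  show ?thesis unfolding cross_measurable_def
  proof (rule borel_measurable_LIMSEQ_real)
    fix z assume "z \<in> space (M \<Otimes>\<^sub>M N)"
    then show "(\<lambda>n. c n (i n (fst z)) \<bullet> g (snd z)) \<longlonglongrightarrow> (case z of (x, y) \<Rightarrow> f x \<bullet> g y)"
      by (auto simp: split_beta' space_pair_measure intro!: tendsto_intros lim)
  next
    fix n
    show "(\<lambda>z. c n (i n (fst z)) \<bullet> g (snd z)) \<in> borel_measurable (M \<Otimes>\<^sub>M N)"
    proof (rule measurable_compose_countable[where g = "\<lambda>z. i n (fst z)"])
      show "(\<lambda>z. c n j \<bullet> g (snd z)) \<in> borel_measurable (M \<Otimes>\<^sub>M N)" for j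
        by (rule measurable_compose[OF measurable_snd g])
    qed measurable
  qed
qed

lemma approximable_inner_measurable:
  assumes f: "countably_approximable M f"
  shows "(\<lambda>x. h \<bullet> f x) \<in> borel_measurable M"
proof -
  obtain i c where i [measurable]: "\<And>n::nat. i n \<in> measurable M (count_space (UNIV::nat set))"
    and lim: "\<And>x. x \<in> space M \<Longrightarrow> (\<lambda>n. c n (i n x)) \<longlonglongrightarrow> f x"
    using f unfolding countably_approximable_def by blast
  show ?thesis
  proof (rule borel_measurable_LIMSEQ_real)
    show "(\<lambda>n. h \<bullet> c n (i n x)) \<longlonglongrightarrow> h \<bullet> f x" if "x \<in> space M" for x
      by (intro tendsto_intros lim that)
    show "(\<lambda>x. h \<bullet> c n (i n x)) \<in> borel_measurable M" for n
      by (rule measurable_compose[OF i]) simp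
  qed
qed

text \<open>Pushing \<open>L x\<close> forward to the law of the pair \<open>(x, y)\<close> makes
  the integrand independent of the parameter, and integrals of a fixed function against a measurable
  kernel are measurable.\<close>

lemma integral_measurable_kernel:
  fixes f :: "'a \<Rightarrow> 'b \<Rightarrow> real"
  assumes f [measurable]: "(\<lambda>(x, y). f x y) \<in> borel_measurable (M \<Otimes>\<^sub>M N)"
    and L [measurable]: "L \<in> measurable M (prob_algebra N)"
  shows "(\<lambda>x. \<integral>y. f x y \<partial>L x) \<in> borel_measurable M"
proof -
  have L' [measurable]: "L \<in> measurable M (subprob_algebra N)"
    by (rule measurable_prob_algebraD) fact
  note measurable_distr2[measurable]
  have "(\<lambda>x. \<integral>z. (case z of (x, y) \<Rightarrow> f x y) \<partial>distr (L x) (M \<Otimes>\<^sub>M N) (\<lambda>y. (x, y)))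
      \<in> borel_measurable M"
    by measurable
  then show ?thesis
    by (rule measurable_cong[THEN iffD1, rotated]) (simp add: integral_distr)
qed

text \<open>The inner product of \<open>mu x\<close> with \<open>h w\<close> is a parameter integral
  over \<open>\<kappa> x\<close>. Applying this first with \<open>h = \<phi>\<close> and then with
  \<open>h = mu\<close> makes \<open>mu\<close> cross-measurable with itself without approximating
  \<open>mu\<close>.\<close>

lemma cross_measurable_weak_integral:
  assumes \<kappa>: "\<kappa> \<in> measurable M (prob_algebra MY)"
    and mu: "\<And>x. x \<in> space M \<Longrightarrow> has_weak_integral (\<kappa> x) \<phi> (mu x)"
    and h: "cross_measurable MY N \<phi> h"
  shows "cross_measurable M N mu h"
proof -
  have "(\<lambda>z. (snd z, snd (fst z))) \<in> measurable ((M \<Otimes>\<^sub>M N) \<Otimes>\<^sub>M MY) (MY \<Otimes>\<^sub>M N)"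
    by measurable
  from measurable_compose[OF this h[unfolded cross_measurable_def]]
  have "(\<lambda>(z, y). \<phi> y \<bullet> h (snd z)) \<in> borel_measurable ((M \<Otimes>\<^sub>M N) \<Otimes>\<^sub>M MY)"
    by (simp add: split_beta')
  from integral_measurable_kernel[OF this measurable_compose[OF measurable_fst \<kappa>]]
  have "(\<lambda>z. \<integral>y. \<phi> y \<bullet> h (snd z) \<partial>\<kappa> (fst z)) \<in> borel_measurable (M \<Otimes>\<^sub>M N)" .
  then show ?thesis unfolding cross_measurable_def
    by (rule measurable_cong[THEN iffD1, rotated])
      (use mu in \<open>auto simp: space_pair_measure has_weak_integral_def\<close>)
qed

lemma cross_measurable_strongly:
  assumes "strongly_measurable M f" "\<And>h. (\<lambda>y. h \<bullet> g y) \<in> borel_measurable N"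
  shows "cross_measurable M N f g"
  by (rule cross_measurable_approximable[OF strongly_measurable_approximable assms(2)]) fact

lemma continuous_feature_map:
  fixes \<phi> :: "'x::topological_space \<Rightarrow> 'h::real_inner"
  assumes k: "\<And>a b. k a b = \<phi> a \<bullet> \<phi> b" and c: "continuous_on UNIV (\<lambda>(x, x'). k x x')"
  shows "continuous_on UNIV \<phi>"
proof -
  have c2: "continuous_on UNIV (\<lambda>x. k (f x) (g x))"
    if "continuous_on UNIV f" "continuous_on UNIV g" for f g :: "'x \<Rightarrow> 'x"
    using continuous_on_compose2[OF c continuous_on_Pair[OF that]] by simp
  have d: "dist (\<phi> y) (\<phi> x) = sqrt (k y y - 2 * k y x + k x x)" for x y
    by (simp add: dist_norm norm_eq_sqrt_inner k inner_diff_left inner_diff_right inner_commute)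
  have "(\<phi> \<longlongrightarrow> \<phi> x) (at x)" for x
  proof -
    have "continuous_on UNIV (\<lambda>y. sqrt (k y y - 2 * k y x + k x x))"
      by (intro continuous_intros c2)
    from this[unfolded continuous_on_def, rule_format, of x]
    have "((\<lambda>y. sqrt (k y y - 2 * k y x + k x x)) \<longlongrightarrow> 0) (at x)" by simp
    then have "((\<lambda>y. dist (\<phi> y) (\<phi> x)) \<longlongrightarrow> 0) (at x)" by (simp add: d)
    then show ?thesis by (rule tendsto_dist_iff[THEN iffD2])
  qed
  then show ?thesis by (simp add: continuous_on_def)
qed

subsection \<open>V-statistics\<close>

lemma (in prob_space) distr_pair_of_indep_vars:
  assumes ind: "indep_vars (\<lambda>_. L) D I" and ij: "i \<in> I" "j \<in> I" "i \<noteq> j"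
  shows "distr M (L \<Otimes>\<^sub>M L) (\<lambda>\<omega>. (D i \<omega>, D j \<omega>)) = distr M L (D i) \<Otimes>\<^sub>M distr M L (D j)"
proof -
  have "indep_var (PiM {i} (\<lambda>_. L)) (\<lambda>\<omega>. restrict (\<lambda>i. D i \<omega>) {i})
      (PiM {j} (\<lambda>_. L)) (\<lambda>\<omega>. restrict (\<lambda>i. D i \<omega>) {j})"
    using ij by (intro indep_var_restrict[OF ind]) auto
  from indep_var_compose[OF this, of "\<lambda>f. f i" L "\<lambda>f. f j" L]
  have "indep_var L (D i) L (D j)" by (simp add: comp_def)
  then show ?thesis unfolding indep_var_distribution_eq by simp
qed

text \<open>Two distinct sample points have a product law, a point paired with itself does not, so
  diagonal and off-diagonal terms get separate bounds. The \<open>n (n - 1)\<close> off-diagonal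
  terms are rounded up to \<open>n\<^sup>2\<close>, which uses \<open>0 \<le> b\<close>.\<close>

lemma (in prob_space) v_statistic_expectation:
  fixes g :: "'b \<Rightarrow> 'b \<Rightarrow> real"
  assumes ind: "indep_vars (\<lambda>_. L) D {..<n}" and law: "\<And>i. i < n \<Longrightarrow> distr M L (D i) = L"
    and diag: "integrable L (\<lambda>z. g z z)" "(\<integral>z. g z z \<partial>L) \<le> a"
    and off: "integrable (L \<Otimes>\<^sub>M L) (\<lambda>(z, w). g z w)" "(\<integral>z. (case z of (z, w) \<Rightarrow> g z w) \<partial>(L \<Otimes>\<^sub>M L)) \<le> b"
    and b: "0 \<le> b"
  shows "integrable M (\<lambda>\<omega>. \<Sum>i<n. \<Sum>j<n. g (D i \<omega>) (D j \<omega>))"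
    and "(\<integral>\<omega>. (\<Sum>i<n. \<Sum>j<n. g (D i \<omega>) (D j \<omega>)) \<partial>M) \<le> real n * a + (real n)\<^sup>2 * b"
proof -
  have D [measurable]: "D i \<in> measurable M L" if "i < n" for i
    using ind that by (simp add: indep_vars_def)
  have pairs: "integrable M (\<lambda>\<omega>. g (D i \<omega>) (D j \<omega>)) \<and>
      (\<integral>\<omega>. g (D i \<omega>) (D j \<omega>) \<partial>M) \<le> b + (if i = j then a - b else 0)" if ij: "i < n" "j < n" for i j
  proof (cases "i = j")
    case True
    have "integrable (distr M L (D i)) (\<lambda>z. g z z)" "(\<integral>z. g z z \<partial>distr M L (D i)) \<le> a"
      using diag law[OF ij(1)] by simp_all
    then show ?thesis using True D[OF ij(1)] diag(1)
      by (simp add: integrable_distr_eq integral_distr borel_measurable_integrable)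
  next
    case False
    have eq: "distr M (L \<Otimes>\<^sub>M L) (\<lambda>\<omega>. (D i \<omega>, D j \<omega>)) = L \<Otimes>\<^sub>M L"
      using distr_pair_of_indep_vars[OF ind _ _ False] ij by (simp add: law)
    have m: "(\<lambda>\<omega>. (D i \<omega>, D j \<omega>)) \<in> measurable M (L \<Otimes>\<^sub>M L)"
      using D[OF ij(1)] D[OF ij(2)] by measurable
    have bm: "(\<lambda>(z, w). g z w) \<in> borel_measurable (L \<Otimes>\<^sub>M L)"
      using off(1) by (rule borel_measurable_integrable)
    show ?thesis
      using off integrable_distr_eq[OF m bm] integral_distr[OF m bm] False by (simp add: eq)
  qed
  show "integrable M (\<lambda>\<omega>. \<Sum>i<n. \<Sum>j<n. g (D i \<omega>) (D j \<omega>))"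
    by (intro Bochner_Integration.integrable_sum) (use pairs in auto)
  have "(\<integral>\<omega>. (\<Sum>i<n. \<Sum>j<n. g (D i \<omega>) (D j \<omega>)) \<partial>M) = (\<Sum>i<n. \<Sum>j<n. \<integral>\<omega>. g (D i \<omega>) (D j \<omega>) \<partial>M)"
    by (subst Bochner_Integration.integral_sum, (intro Bochner_Integration.integrable_sum, use pairs in simp),
      intro sum.cong refl Bochner_Integration.integral_sum, use pairs in simp)
  also have "\<dots> \<le> (\<Sum>i<n. \<Sum>j<n. b + (if i = j then a - b else 0))"
    using pairs by (intro sum_mono) simp
  also have "\<dots> = (real n)\<^sup>2 * b + real n * (a - b)"
    by (simp add: sum.distrib power2_eq_square distrib_left)
  also have "\<dots> \<le> real n * a + (real n)\<^sup>2 * b" using b by (simp add: right_diff_distrib)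
  finally show "(\<integral>\<omega>. (\<Sum>i<n. \<Sum>j<n. g (D i \<omega>) (D j \<omega>)) \<partial>M) \<le> real n * a + (real n)\<^sup>2 * b" .
qed

text \<open>Independence makes the joint law of \<open>S\<close> and \<open>Z\<close> a product, so
  \<open>S\<close> can be frozen at \<open>s\<close>, Markov's inequality applied under the law of
  \<open>Z\<close>, and the result integrated over \<open>s\<close>. The set \<open>G\<close> will
  hold the training outcomes with small model errors; moment bounds are available only
  there.\<close>

lemma (in prob_space) markov_given_independent:
  fixes V :: "'s \<Rightarrow> 'd \<Rightarrow> real"
  assumes S: "S \<in> measurable M N" and Z: "Z \<in> measurable M L"
    and ind: "indep_set (sets (vimage_algebra (space M) S N)) (sets (vimage_algebra (space M) Z L))"
    and G: "G \<in> sets N" and V [measurable]: "(\<lambda>(s, d). V s d) \<in> borel_measurable (N \<Otimes>\<^sub>M L)"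
    and int: "\<And>s. s \<in> G \<Longrightarrow> integrable M (\<lambda>\<omega>. V s (Z \<omega>))"
    and nn: "\<And>s d. s \<in> G \<Longrightarrow> 0 \<le> V s d"
    and le: "\<And>s. s \<in> G \<Longrightarrow> (\<integral>\<omega>. V s (Z \<omega>) \<partial>M) \<le> c" and c: "0 < c" and t: "0 < t"
  shows "\<exists>A\<in>events. {\<omega>\<in>space M. S \<omega> \<in> G \<and> t * c < V (S \<omega>) (Z \<omega>)} \<subseteq> A \<and> prob A \<le> 1 / t"
proof -
  note [measurable] = S Z G
  interpret SN: prob_space "distr M N S" by (rule prob_space_distr) fact
  interpret ZL: prob_space "distr M L Z" by (rule prob_space_distr) fact
  have joint: "distr M (N \<Otimes>\<^sub>M L) (\<lambda>\<omega>. (S \<omega>, Z \<omega>)) = distr M N S \<Otimes>\<^sub>M distr M L Z"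
  proof (rule pair_measure_eqI[symmetric])
    fix A B assume "A \<in> sets (distr M N S)" "B \<in> sets (distr M L Z)"
    then have A [measurable]: "A \<in> sets N" and B [measurable]: "B \<in> sets L" by simp_all
    have "S -` A \<inter> space M \<in> sets (vimage_algebra (space M) S N)"
      "Z -` B \<inter> space M \<in> sets (vimage_algebra (space M) Z L)"
      using A B by (auto intro: in_vimage_algebra)
    then have "prob ((S -` A \<inter> space M) \<inter> (Z -` B \<inter> space M))
        = prob (S -` A \<inter> space M) * prob (Z -` B \<inter> space M)"
      using ind by (simp add: indep_sets2_eq)
    moreover have "(\<lambda>\<omega>. (S \<omega>, Z \<omega>)) -` (A \<times> B) \<inter> space M = (S -` A \<inter> space M) \<inter> (Z -` B \<inter> space M)"
      by auto
    ultimately show "emeasure (distr M N S) A * emeasure (distr M L Z) B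
        = emeasure (distr M (N \<Otimes>\<^sub>M L) (\<lambda>\<omega>. (S \<omega>, Z \<omega>))) (A \<times> B)"
      by (simp add: emeasure_distr emeasure_eq_measure ennreal_mult)
  qed (unfold_locales, simp)
  define B where "B = {p \<in> space (N \<Otimes>\<^sub>M L). fst p \<in> G \<and> t * c < V (fst p) (snd p)}"
  have V' [measurable]: "(\<lambda>p. V (fst p) (snd p)) \<in> borel_measurable (N \<Otimes>\<^sub>M L)"
    using V by (simp add: split_beta')
  have B [measurable]: "B \<in> sets (N \<Otimes>\<^sub>M L)" unfolding B_def by measurable
  define A where "A = (\<lambda>\<omega>. (S \<omega>, Z \<omega>)) -` B \<inter> space M"
  have A: "A \<in> events" unfolding A_def by measurable
  have "emeasure M A = emeasure (distr M N S \<Otimes>\<^sub>M distr M L Z) B"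
    unfolding joint[symmetric] A_def by (subst emeasure_distr) auto
  also have "\<dots> = (\<integral>\<^sup>+s. emeasure (distr M L Z) (Pair s -` B) \<partial>distr M N S)"
    by (rule ZL.emeasure_pair_measure_alt) simp
  also have "\<dots> \<le> (\<integral>\<^sup>+s. ennreal (1 / t) \<partial>distr M N S)"
  proof (intro nn_integral_mono)
    fix s assume "s \<in> space (distr M N S)"
    show "emeasure (distr M L Z) (Pair s -` B) \<le> ennreal (1 / t)"
    proof (cases "s \<in> G")
      case True
      have "emeasure (distr M L Z) (Pair s -` B) = emeasure M (Z -` (Pair s -` B) \<inter> space M)"
        using sets_Pair1[OF B, of s] by (subst emeasure_distr) auto
      also have "\<dots> \<le> emeasure M {\<omega>\<in>space M. t * c \<le> V s (Z \<omega>)}"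
        using int[OF True] by (intro emeasure_mono) (auto simp: B_def)
      also have "\<dots> \<le> ennreal (1 / (t * c)) * ennreal (\<integral>\<omega>. V s (Z \<omega>) \<partial>M)"
        using integral_Markov_inequality[OF int[OF True], of "t * c"] nn[OF True] c t
        by (simp add: ennreal_mult'[symmetric] integral_nonneg)
      also have "\<dots> = ennreal (1 / (t * c) * (\<integral>\<omega>. V s (Z \<omega>) \<partial>M))"
        using c t by (simp add: ennreal_mult'[symmetric])
      also have "\<dots> \<le> ennreal (1 / (t * c) * c)"
        using le[OF True] c t by (intro ennreal_leI mult_left_mono) auto
      also have "1 / (t * c) * c = 1 / t" using c by simp
      finally show ?thesis .
    next
      case False
      then have "Pair s -` B = {}" by (auto simp: B_def)
      then show ?thesis by simp
    qed
  qed
  also have "\<dots> = ennreal (1 / t)" using SN.emeasure_space_1 by simp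
  finally have "prob A \<le> 1 / t" using t by (simp add: emeasure_eq_measure)
  moreover have "{\<omega>\<in>space M. S \<omega> \<in> G \<and> t * c < V (S \<omega>) (Z \<omega>)} \<subseteq> A"
    using measurable_space[OF S] measurable_space[OF Z] by (auto simp: A_def B_def space_pair_measure)
  ultimately show ?thesis using A by blast
qed

text \<open>Cauchy-Schwarz from the weighted inequality \<open>amgm\<close> at
  \<open>t = b / a\<close>, which balances the two terms to \<open>a * b / 2\<close> each. If
  \<open>a\<close> or \<open>b\<close> is zero, the corresponding factor vanishes almost
  everywhere.\<close>

lemma integral_mult_le_of_squares:
  fixes f g :: "'a \<Rightarrow> real"
  assumes [measurable]: "f \<in> borel_measurable M" "g \<in> borel_measurable M"
    and f: "integrable M (\<lambda>x. (f x)\<^sup>2)" "(\<integral>x. (f x)\<^sup>2 \<partial>M) \<le> a\<^sup>2" "0 \<le> a"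
    and g: "integrable M (\<lambda>x. (g x)\<^sup>2)" "(\<integral>x. (g x)\<^sup>2 \<partial>M) \<le> b\<^sup>2" "0 \<le> b"
  shows "integrable M (\<lambda>x. \<bar>f x\<bar> * \<bar>g x\<bar>)" "(\<integral>x. \<bar>f x\<bar> * \<bar>g x\<bar> \<partial>M) \<le> a * b"
proof -
  have amgm: "\<bar>f x\<bar> * \<bar>g x\<bar> \<le> t / 2 * (f x)\<^sup>2 + 1 / (2 * t) * (g x)\<^sup>2" if "0 < t" for x and t :: real
  proof -
    have "0 \<le> (t * \<bar>f x\<bar> - \<bar>g x\<bar>)\<^sup>2 / (2 * t)" using that by simp
    also have "\<dots> = t / 2 * (f x)\<^sup>2 + 1 / (2 * t) * (g x)\<^sup>2 - \<bar>f x\<bar> * \<bar>g x\<bar>"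
      using that by (simp add: power2_diff power_mult_distrib field_simps) (simp add: power2_eq_square algebra_simps)
    finally show ?thesis by simp
  qed
  show int: "integrable M (\<lambda>x. \<bar>f x\<bar> * \<bar>g x\<bar>)"
  proof (rule Bochner_Integration.integrable_bound)
    show "integrable M (\<lambda>x. 1 / 2 * (f x)\<^sup>2 + 1 / 2 * (g x)\<^sup>2)" using f(1) g(1) by simp
    show "AE x in M. norm (\<bar>f x\<bar> * \<bar>g x\<bar>) \<le> norm (1 / 2 * (f x)\<^sup>2 + 1 / 2 * (g x)\<^sup>2)"
      using amgm[of 1] by (intro AE_I2) (simp add: abs_mult)
  qed measurable
  have zero: "(\<integral>x. \<bar>f x\<bar> * \<bar>g x\<bar> \<partial>M) = 0"
    if "integrable M (\<lambda>x. (u x)\<^sup>2)" "(\<integral>x. (u x)\<^sup>2 \<partial>M) \<le> 0" "u = f \<or> u = g" for u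
  proof -
    have "(\<integral>x. (u x)\<^sup>2 \<partial>M) = 0" using that(2) by (simp add: order_antisym)
    then have "AE x in M. (u x)\<^sup>2 = 0" using integral_nonneg_eq_0_iff_AE[OF that(1)] by simp
    then have "AE x in M. \<bar>f x\<bar> * \<bar>g x\<bar> = 0" using that(3) by (auto elim!: eventually_mono)
    then show ?thesis by (rule integral_eq_zero_AE)
  qed
  show "(\<integral>x. \<bar>f x\<bar> * \<bar>g x\<bar> \<partial>M) \<le> a * b"
  proof (cases "a = 0 \<or> b = 0")
    case True
    then show ?thesis using zero[OF f(1)] zero[OF g(1)] f(2,3) g(2,3) by auto
  next
    case False
    then have ab: "0 < a" "0 < b" using f g by auto
    have "(\<integral>x. \<bar>f x\<bar> * \<bar>g x\<bar> \<partial>M) \<le> (\<integral>x. (b / a) / 2 * (f x)\<^sup>2 + 1 / (2 * (b / a)) * (g x)\<^sup>2 \<partial>M)"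
      using int f(1) g(1) ab by (intro integral_mono amgm) auto
    also have "\<dots> = (b / a) / 2 * (\<integral>x. (f x)\<^sup>2 \<partial>M) + 1 / (2 * (b / a)) * (\<integral>x. (g x)\<^sup>2 \<partial>M)"
      using f(1) g(1) by simp
    also have "\<dots> \<le> (b / a) / 2 * a\<^sup>2 + 1 / (2 * (b / a)) * b\<^sup>2"
      using f g ab by (intro add_mono mult_left_mono) auto
    also have "\<dots> = a * b" using ab by (simp add: power2_eq_square field_simps)
    finally show ?thesis .
  qed
qed

lemma (in pair_sigma_finite) integrable_tensor:
  fixes f :: "'a \<Rightarrow> real" and g :: "'b \<Rightarrow> real"
  assumes f: "integrable M1 f" and g: "integrable M2 g"
  shows "integrable (M1 \<Otimes>\<^sub>M M2) (\<lambda>(x, y). f x * g y)"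
proof (rule Fubini_integrable)
  note borel_measurable_integrable[OF f, measurable] borel_measurable_integrable[OF g, measurable]
  show "(\<lambda>(x, y). f x * g y) \<in> borel_measurable (M1 \<Otimes>\<^sub>M M2)" by measurable
  show "integrable M1 (\<lambda>x. \<integral>y. norm (case (x, y) of (x, y) \<Rightarrow> f x * g y) \<partial>M2)"
    using f by (simp add: abs_mult)
  show "AE x in M1. integrable M2 (\<lambda>y. case (x, y) of (x, y) \<Rightarrow> f x * g y)"
    using g by simp
qed

text \<open>\<open>m\<close> plays the role of the conditional mean of \<open>\<epsilon>\<close>
  given the covariate, but only through the weak identity \<open>key\<close>, so no Hilbert-space
  valued conditional expectation is formed. Under the product measure each \<open>\<epsilon>\<close>
  can be replaced by \<open>m\<close>; the pointwise bound by \<open>B * H z * H w\<close> then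
  factorises.\<close>

lemma (in prob_space) off_diagonal_bound:
  fixes \<epsilon> m :: "'a \<Rightarrow> 'h::real_inner" and K :: "'a \<Rightarrow> 'a \<Rightarrow> real"
  assumes cm: "cross_measurable M M \<epsilon> \<epsilon>" "cross_measurable M M \<epsilon> m" "cross_measurable M M m m"
    and Km [measurable]: "(\<lambda>(z, w). K z w) \<in> borel_measurable (M \<Otimes>\<^sub>M M)"
    and KB: "\<And>z w. \<bar>K z w\<bar> \<le> B" and Ksym: "\<And>z w. K z w = K w z"
    and F: "integrable M F" "\<And>z. z \<in> space M \<Longrightarrow> norm (\<epsilon> z) \<le> F z"
    and H: "integrable M H" "\<And>z. z \<in> space M \<Longrightarrow> norm (m z) \<le> H z"
    and key: "\<And>h w. w \<in> space M \<Longrightarrow> (\<integral>z. (\<epsilon> z \<bullet> h) * K z w \<partial>M) = (\<integral>z. (m z \<bullet> h) * K z w \<partial>M)"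
  shows "integrable (M \<Otimes>\<^sub>M M) (\<lambda>(z, w). (\<epsilon> z \<bullet> \<epsilon> w) * K z w)"
    and "(\<integral>z. (case z of (z, w) \<Rightarrow> (\<epsilon> z \<bullet> \<epsilon> w) * K z w) \<partial>(M \<Otimes>\<^sub>M M)) \<le> B * (\<integral>z. H z \<partial>M)\<^sup>2"
proof -
  interpret MM: pair_sigma_finite M M by unfold_locales
  have pw: "\<bar>(u \<bullet> v) * K z w\<bar> \<le> B * (c * d)" if "norm u \<le> c" "norm v \<le> d"
    for u v :: 'h and c d z w
  proof -
    have "0 \<le> c" "0 \<le> d" using that norm_ge_zero[of u] norm_ge_zero[of v] by linarith+
    have "\<bar>u \<bullet> v\<bar> \<le> norm u * norm v" by (rule Cauchy_Schwarz_ineq2)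
    also have "\<dots> \<le> c * d" using that \<open>0 \<le> c\<close> by (intro mult_mono) auto
    finally have "\<bar>u \<bullet> v\<bar> * \<bar>K z w\<bar> \<le> (c * d) * B"
      using KB[of z w] \<open>0 \<le> c\<close> \<open>0 \<le> d\<close> by (intro mult_mono) auto
    then show ?thesis by (simp add: abs_mult mult.commute)
  qed
  have int: "integrable (M \<Otimes>\<^sub>M M) (\<lambda>(z, w). (u z \<bullet> v w) * K z w)"
    if c: "cross_measurable M M u v" and U: "integrable M U" "\<And>z. z \<in> space M \<Longrightarrow> norm (u z) \<le> U z"
      and V: "integrable M V" "\<And>z. z \<in> space M \<Longrightarrow> norm (v z) \<le> V z" for u v :: "'a \<Rightarrow> 'h" and U V
  proof (rule Bochner_Integration.integrable_bound)
    show "integrable (M \<Otimes>\<^sub>M M) (\<lambda>z. B * (case z of (z, w) \<Rightarrow> U z * V w))"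
      by (intro integrable_mult_right MM.integrable_tensor U V)
    show "(\<lambda>(z, w). (u z \<bullet> v w) * K z w) \<in> borel_measurable (M \<Otimes>\<^sub>M M)"
      using borel_measurable_times[OF c[unfolded cross_measurable_def] Km] by (simp add: split_beta')
    show "AE z in M \<Otimes>\<^sub>M M. norm (case z of (z, w) \<Rightarrow> (u z \<bullet> v w) * K z w)
        \<le> norm (B * (case z of (z, w) \<Rightarrow> U z * V w))"
      using order_trans[OF pw[OF U(2) V(2)] abs_ge_self] by (intro AE_I2) (auto simp: space_pair_measure)
  qed
  note ee = int[OF cm(1) F F] and em = int[OF cm(2) F H] and mm = int[OF cm(3) H H]
  show "integrable (M \<Otimes>\<^sub>M M) (\<lambda>(z, w). (\<epsilon> z \<bullet> \<epsilon> w) * K z w)" by (rule ee)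
  have "(\<integral>z. (case z of (z, w) \<Rightarrow> (\<epsilon> z \<bullet> \<epsilon> w) * K z w) \<partial>(M \<Otimes>\<^sub>M M))
      = (\<integral>z. \<integral>w. (\<epsilon> z \<bullet> \<epsilon> w) * K z w \<partial>M \<partial>M)"
    by (simp only: MM.integral_fst'[OF ee, symmetric] prod.case)
  \<comment> \<open>\<open>key\<close> speaks of the first argument; symmetry of the inner product
    and of \<open>K\<close> transfers it to the second. After Fubini it applies again, now with
    \<open>h = m w\<close>.\<close>
  also have "\<dots> = (\<integral>z. \<integral>w. (\<epsilon> z \<bullet> m w) * K z w \<partial>M \<partial>M)"
  proof (rule Bochner_Integration.integral_cong[OF refl])
    fix z assume "z \<in> space M"
    then show "(\<integral>w. (\<epsilon> z \<bullet> \<epsilon> w) * K z w \<partial>M) = (\<integral>w. (\<epsilon> z \<bullet> m w) * K z w \<partial>M)"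
      unfolding inner_commute[of "\<epsilon> z"] Ksym[of z] by (rule key)
  qed
  also have "\<dots> = (\<integral>w. \<integral>z. (\<epsilon> z \<bullet> m w) * K z w \<partial>M \<partial>M)"
    by (rule MM.Fubini_integral[OF em, symmetric])
  also have "\<dots> = (\<integral>w. \<integral>z. (m z \<bullet> m w) * K z w \<partial>M \<partial>M)"
    by (rule Bochner_Integration.integral_cong[OF refl key])
  also have "\<dots> = (\<integral>z. (case z of (z, w) \<Rightarrow> (m z \<bullet> m w) * K z w) \<partial>(M \<Otimes>\<^sub>M M))"
    by (rule MM.integral_snd[OF mm])
  also have "\<dots> \<le> (\<integral>z. B * (case z of (z, w) \<Rightarrow> H z * H w) \<partial>(M \<Otimes>\<^sub>M M))"
  proof (rule integral_mono[OF mm])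
    show "integrable (M \<Otimes>\<^sub>M M) (\<lambda>z. B * (case z of (z, w) \<Rightarrow> H z * H w))"
      by (intro integrable_mult_right MM.integrable_tensor H)
    show "(case p of (z, w) \<Rightarrow> (m z \<bullet> m w) * K z w) \<le> B * (case p of (z, w) \<Rightarrow> H z * H w)"
      if "p \<in> space (M \<Otimes>\<^sub>M M)" for p
      using that order_trans[OF abs_ge_self pw[OF H(2) H(2)]] by (auto simp: space_pair_measure)
  qed
  also have "\<dots> = B * (\<integral>z. H z \<partial>M)\<^sup>2"
    using MM.integral_fst'[OF MM.integrable_tensor[OF H(1) H(1)]]
    by (simp add: power2_eq_square)
  finally show "(\<integral>z. (case z of (z, w) \<Rightarrow> (\<epsilon> z \<bullet> \<epsilon> w) * K z w) \<partial>(M \<Otimes>\<^sub>M M)) \<le> B * (\<integral>z. H z \<partial>M)\<^sup>2" .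
qed

subsection \<open>The law of treatment, covariate and outcome\<close>

lemma sets_treatment_law:
  "sets (treatment_law \<alpha> M1 M0) = sets (count_space UNIV \<Otimes>\<^sub>M M1)"
  by (simp add: treatment_law_def)

lemma emeasure_treatment_law:
  assumes s: "sets M0 = sets M1" and A: "A \<in> sets (count_space UNIV \<Otimes>\<^sub>M M1)"
  shows "emeasure (treatment_law \<alpha> M1 M0) A
    = ennreal \<alpha> * emeasure M1 (Pair True -` A) + ennreal (1 - \<alpha>) * emeasure M0 (Pair False -` A)"
proof -
  have s': "sets (count_space UNIV \<Otimes>\<^sub>M M0) = sets (count_space UNIV \<Otimes>\<^sub>M M1)"
    by (rule sets_pair_measure_cong) (simp_all add: s)
  have sp: "space M0 = space M1" using s by (rule sets_eq_imp_space_eq)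
  have sub: "Pair b -` A \<subseteq> space M1" for b
    using sets.sets_into_space[OF A] by (auto simp: space_pair_measure)
  have "emeasure (distr M1 (count_space UNIV \<Otimes>\<^sub>M M1) (Pair True)) A = emeasure M1 (Pair True -` A)"
    using A sub[of True] by (subst emeasure_distr) (auto intro!: arg_cong[where f = "emeasure M1"])
  moreover have "emeasure (distr M0 (count_space UNIV \<Otimes>\<^sub>M M0) (Pair False)) A = emeasure M0 (Pair False -` A)"
    using A sub[of False] sp s' by (subst emeasure_distr) (auto intro!: arg_cong[where f = "emeasure M0"])
  ultimately show ?thesis
    unfolding treatment_law_def using s' A by (subst emeasure_mixture) simp_all
qed

lemma prob_space_mixture:
  assumes "prob_space M" "prob_space N" "sets N = sets M" "0 \<le> \<alpha>" "\<alpha> \<le> 1"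
  shows "prob_space (mixture \<alpha> M N)"
proof
  have "emeasure N (space M) = 1"
    using prob_space.emeasure_space_1[OF assms(2)] sets_eq_imp_space_eq[OF assms(3)] by simp
  then show "emeasure (mixture \<alpha> M N) (space (mixture \<alpha> M N)) = 1"
    using assms prob_space.emeasure_space_1[OF assms(1)]
    by (simp add: emeasure_mixture ennreal_plus[symmetric] del: ennreal_plus)
qed

lemma prob_space_treatment_law:
  assumes "prob_space M1" "prob_space M0" "sets M0 = sets M1" "0 \<le> \<alpha>" "\<alpha> \<le> 1"
  shows "prob_space (treatment_law \<alpha> M1 M0)"
  unfolding treatment_law_def
proof (rule prob_space_mixture)
  show "sets (distr M0 (count_space UNIV \<Otimes>\<^sub>M M0) (Pair False)) = sets (distr M1 (count_space UNIV \<Otimes>\<^sub>M M1) (Pair True))"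
    using sets_pair_measure_cong[OF refl assms(3)] by simp
qed (use assms in \<open>auto intro!: prob_space.prob_space_distr\<close>)

text \<open>Weighting by the treatment removes the untreated component and leaves \<alpha> times the
  treated one. As an identity of measures it turns expectations of \<open>T_of z * f z\<close> into
  integrals over the treated population.\<close>

lemma density_treated:
  assumes s: "sets M0 = sets M1" and \<alpha>: "0 \<le> \<alpha>"
  shows "density (treatment_law \<alpha> M1 M0) (\<lambda>z. ennreal (T_of z))
    = density (distr M1 (count_space UNIV \<Otimes>\<^sub>M M1) (Pair True)) (\<lambda>_. ennreal \<alpha>)"
proof (rule measure_eqI)
  let ?C = "count_space UNIV \<Otimes>\<^sub>M M1"
  let ?T = "treatment_law \<alpha> M1 M0"
  have sp: "space M0 = space M1" using s by (rule sets_eq_imp_space_eq)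
  show "sets (density ?T (\<lambda>z. ennreal (T_of z)))
    = sets (density (distr M1 ?C (Pair True)) (\<lambda>_. ennreal \<alpha>))"
    by (simp add: sets_treatment_law)
  fix A assume "A \<in> sets (density ?T (\<lambda>z. ennreal (T_of z)))"
  then have A: "A \<in> sets ?C" by (simp add: sets_treatment_law)
  have "Measurable.pred ?C (\<lambda>z. fst z)" by measurable
  then have Tset: "{z \<in> space ?C. fst z} \<in> sets ?C"
    by (simp add: pred_def)
  define B where "B = A \<inter> {z \<in> space ?C. fst z}"
  have B: "B \<in> sets ?C" unfolding B_def using A Tset by blast
  have sub: "A \<subseteq> space ?C" using A by (rule sets.sets_into_space)
  have Tm: "(\<lambda>z. ennreal (T_of z)) \<in> borel_measurable ?T"
    unfolding T_of_def measurable_cong_sets[OF sets_treatment_law refl] by measurable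
  have "emeasure (density ?T (\<lambda>z. ennreal (T_of z))) A
      = (\<integral>\<^sup>+z. ennreal (T_of z) * indicator A z \<partial>?T)"
    using A Tm by (intro emeasure_density) (simp_all add: sets_treatment_law)
  also have "\<dots> = (\<integral>\<^sup>+z. indicator B z \<partial>?T)"
    using sub by (intro nn_integral_cong) (auto simp: B_def T_of_def split: split_indicator)
  also have "\<dots> = emeasure ?T B"
    using B by (intro nn_integral_indicator) (simp add: sets_treatment_law)
  also have "\<dots> = ennreal \<alpha> * emeasure M1 (Pair True -` A)"
  proof -
    have "Pair True -` B = Pair True -` A" "Pair False -` B = {}" using sub by (auto simp: B_def)
    then show ?thesis by (simp add: emeasure_treatment_law[OF s B])
  qed
  also have "\<dots> = emeasure (density (distr M1 ?C (Pair True)) (\<lambda>_. ennreal \<alpha>)) A"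
  proof -
    have "Pair True -` A \<inter> space M1 = Pair True -` A" using sub by (auto simp: space_pair_measure)
    then show ?thesis using A by (simp add: emeasure_density_const emeasure_distr)
  qed
  finally show "emeasure (density ?T (\<lambda>z. ennreal (T_of z))) A
    = emeasure (density (distr M1 ?C (Pair True)) (\<lambda>_. ennreal \<alpha>)) A" .
qed

lemma integral_treated:
  fixes f :: "bool \<times> 'x \<times> 'y \<Rightarrow> real"
  assumes s: "sets M0 = sets M1" and \<alpha>: "0 \<le> \<alpha>"
    and f: "f \<in> borel_measurable (count_space UNIV \<Otimes>\<^sub>M M1)"
  shows "(\<integral>z. T_of z * f z \<partial>treatment_law \<alpha> M1 M0) = \<alpha> * (\<integral>p. f (True, p) \<partial>M1)"
proof -
  have f': "f \<in> borel_measurable (treatment_law \<alpha> M1 M0)"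
    using f by (simp add: measurable_cong_sets[OF sets_treatment_law refl])
  have Tm: "T_of \<in> borel_measurable (treatment_law \<alpha> M1 M0)"
    unfolding T_of_def measurable_cong_sets[OF sets_treatment_law refl] by measurable
  have "(\<integral>z. T_of z * f z \<partial>treatment_law \<alpha> M1 M0) = (\<integral>z. f z \<partial>density (treatment_law \<alpha> M1 M0) (\<lambda>z. ennreal (T_of z)))"
    using f' Tm by (subst integral_density) (auto simp: T_of_def)
  also have "\<dots> = (\<integral>z. f z \<partial>density (distr M1 (count_space UNIV \<Otimes>\<^sub>M M1) (Pair True)) (\<lambda>_. ennreal \<alpha>))"
    by (simp only: density_treated[OF s \<alpha>])
  also have "\<dots> = \<alpha> * (\<integral>z. f z \<partial>distr M1 (count_space UNIV \<Otimes>\<^sub>M M1) (Pair True))"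
    using f \<alpha> by (subst integral_density) auto
  also have "(\<integral>z. f z \<partial>distr M1 (count_space UNIV \<Otimes>\<^sub>M M1) (Pair True)) = (\<integral>p. f (True, p) \<partial>M1)"
    using f by (intro integral_distr) auto
  finally show ?thesis .
qed

lemma treatment_law_measurable:
  assumes s: "sets M1 = sets (MX \<Otimes>\<^sub>M MY)"
  shows "X_of \<in> measurable (treatment_law \<alpha> M1 M0) MX"
    and "W_of \<in> measurable (treatment_law \<alpha> M1 M0) MY"
    and "T_of \<in> borel_measurable (treatment_law \<alpha> M1 M0)"
proof -
  have "sets (treatment_law \<alpha> M1 M0) = sets (count_space UNIV \<Otimes>\<^sub>M (MX \<Otimes>\<^sub>M MY))"
    using sets_pair_measure_cong[OF refl s] by (simp add: sets_treatment_law)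
  note c = measurable_cong_sets[OF this refl]
  show "X_of \<in> measurable (treatment_law \<alpha> M1 M0) MX" "W_of \<in> measurable (treatment_law \<alpha> M1 M0) MY"
    "T_of \<in> borel_measurable (treatment_law \<alpha> M1 M0)"
    unfolding c X_of_def[abs_def] W_of_def[abs_def] T_of_def[abs_def] by measurable
qed

lemma distr_X_of:
  assumes s: "sets M1 = sets (MX \<Otimes>\<^sub>M MY)" "sets M0 = sets M1"
  shows "distr (treatment_law \<alpha> M1 M0) MX X_of = mixture \<alpha> (distr M1 MX fst) (distr M0 MX fst)"
proof (rule measure_eqI)
  note m = treatment_law_measurable[OF s(1)]
  fix A assume "A \<in> sets (distr (treatment_law \<alpha> M1 M0) MX X_of)"
  then have A: "A \<in> sets MX" by simp
  have f1: "fst \<in> measurable M1 MX" and f0: "fst \<in> measurable M0 MX"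
    unfolding measurable_cong_sets[OF s(1) refl] measurable_cong_sets[OF s(2) refl] by measurable
  define B where "B = X_of -` A \<inter> space (treatment_law \<alpha> M1 M0)"
  have B: "B \<in> sets (count_space UNIV \<Otimes>\<^sub>M M1)"
    using measurable_sets[OF m(1) A, of \<alpha> M0] by (simp add: B_def sets_treatment_law)
  have sp: "space (treatment_law \<alpha> M1 M0) = UNIV \<times> space M1"
    using sets_eq_imp_space_eq[OF sets_treatment_law] by (simp add: space_pair_measure)
  have "Pair b -` B = fst -` A \<inter> space M1" for b by (auto simp: B_def X_of_def sp)
  then show "emeasure (distr (treatment_law \<alpha> M1 M0) MX X_of) A
      = emeasure (mixture \<alpha> (distr M1 MX fst) (distr M0 MX fst)) A"
    using A f1 f0 emeasure_treatment_law[OF s(2) B, of \<alpha>] sets_eq_imp_space_eq[OF s(2)]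
    by (simp add: emeasure_mixture emeasure_distr m B_def)
qed simp

text \<open>The defining identity of \<open>regular_cond_distr\<close> covers rectangles only. These
  form a generator stable under intersection, so it determines the joint law as the law of
  \<open>X\<close> bound with a kernel, and integrals against a bind are iterated.\<close>

lemma regular_cond_distr_integral:
  fixes c :: "'x \<Rightarrow> real" and g :: "'y \<Rightarrow> real"
  assumes P: "prob_space P" and X: "X \<in> measurable P MX" and Y: "Y \<in> measurable P MY"
    and r: "regular_cond_distr P MX X MY Y \<kappa>"
    and c: "c \<in> borel_measurable MX" "\<And>x. \<bar>c x\<bar> \<le> Bc"
    and g: "g \<in> borel_measurable MY" "\<And>y. y \<in> space MY \<Longrightarrow> \<bar>g y\<bar> \<le> Bg"
  shows "(\<integral>p. c (fst p) * g (snd p) \<partial>distr P (MX \<Otimes>\<^sub>M MY) (\<lambda>\<omega>. (X \<omega>, Y \<omega>)))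
    = (\<integral>x. c x * (\<integral>y. g y \<partial>\<kappa> x) \<partial>distr P MX X)"
proof -
  let ?E = "{a \<times> b |a b. a \<in> sets MX \<and> b \<in> sets MY}"
  let ?J = "distr P (MX \<Otimes>\<^sub>M MY) (\<lambda>\<omega>. (X \<omega>, Y \<omega>))"
  let ?X = "distr P MX X"
  interpret prob_space P by fact
  have XY [measurable]: "(\<lambda>\<omega>. (X \<omega>, Y \<omega>)) \<in> measurable P (MX \<Otimes>\<^sub>M MY)" using X Y by measurable
  interpret PX: prob_space "?X" using X by (rule prob_space_distr)
  have \<kappa>: "\<kappa> \<in> measurable MX (prob_algebra MY)"
    and rect: "\<And>A B. A \<in> sets MX \<Longrightarrow> B \<in> sets MY \<Longrightarrow>
        emeasure P {\<omega>\<in>space P. X \<omega> \<in> A \<and> Y \<omega> \<in> B} =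
        (\<integral>\<^sup>+x. emeasure (\<kappa> x) B * indicator A x \<partial>?X)"
    using r by (auto simp: regular_cond_distr_def)
  have \<kappa>' [measurable]: "\<kappa> \<in> measurable MX (subprob_algebra MY)"
    using \<kappa> by (rule measurable_prob_algebraD)
  have \<kappa>p: "prob_space (\<kappa> x)" "sets (\<kappa> x) = sets MY" "space (\<kappa> x) = space MY" if "x \<in> space MX" for x
    using measurable_space[OF \<kappa> that] by (auto simp: space_prob_algebra dest: sets_eq_imp_space_eq)
  \<comment> \<open>The conditional law of the pair given that the first component is
    \<open>x\<close>.\<close>
  define K where "K x = distr (\<kappa> x) (MX \<Otimes>\<^sub>M MY) (Pair x)" for x
  note measurable_distr2[measurable]
  have K [measurable]: "K \<in> measurable MX (subprob_algebra (MX \<Otimes>\<^sub>M MY))"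
    unfolding K_def by measurable
  have K' : "K \<in> measurable ?X (subprob_algebra (MX \<Otimes>\<^sub>M MY))" by simp
  have ne: "space ?X \<noteq> {}" by (rule PX.not_empty)
  have joint: "?J = ?X \<bind> K"
  proof (rule measure_eqI_generator_eq[OF Int_stable_pair_measure_generator[of MX MY],
        where \<Omega> = "space MX \<times> space MY" and A = "\<lambda>_. space MX \<times> space MY"])
    show "?E \<subseteq> Pow (space MX \<times> space MY)"
      by (auto dest: sets.sets_into_space)
    show "sets ?J =
      sigma_sets (space MX \<times> space MY) ?E"
      by (simp add: sets_pair_measure)
    show "sets (?X \<bind> K) =
      sigma_sets (space MX \<times> space MY) ?E"
      using sets_bind[OF sets_kernel[OF K'] ne] by (simp add: sets_pair_measure)
    show "range (\<lambda>_::nat. space MX \<times> space MY) \<subseteq> ?E" by auto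
    show "(\<Union>i::nat. space MX \<times> space MY) = space MX \<times> space MY" by simp
    show "emeasure ?J (space MX \<times> space MY) \<noteq> \<infinity>"
      by (subst emeasure_distr) auto
    fix C assume "C \<in> ?E"
    then obtain A B where C: "C = A \<times> B" and A [measurable]: "A \<in> sets MX" and B [measurable]: "B \<in> sets MY"
      by blast
    have "emeasure (?X \<bind> K) C = (\<integral>\<^sup>+x. emeasure (K x) C \<partial>?X)"
      using A B C by (intro emeasure_bind[OF ne K']) auto
    also have "\<dots> = (\<integral>\<^sup>+x. emeasure (\<kappa> x) B * indicator A x \<partial>?X)"
    proof (intro nn_integral_cong)
      fix x assume "x \<in> space ?X"
      then have x: "x \<in> space MX" by simp
      have Px: "Pair x \<in> measurable (\<kappa> x) (MX \<Otimes>\<^sub>M MY)"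
        unfolding measurable_cong_sets[OF \<kappa>p(2)[OF x] refl] using x by (rule measurable_Pair1')
      have "Pair x -` (A \<times> B) \<inter> space (\<kappa> x) = (if x \<in> A then B else {})"
        using \<kappa>p(3)[OF x] sets.sets_into_space[OF B] by auto
      then show "emeasure (K x) C = emeasure (\<kappa> x) B * indicator A x"
        using Px A B by (simp add: K_def C emeasure_distr)
    qed
    also have "\<dots> = emeasure P {\<omega>\<in>space P. X \<omega> \<in> A \<and> Y \<omega> \<in> B}" by (rule rect[symmetric]) fact+
    also have "\<dots> = emeasure ?J C"
      by (subst emeasure_distr) (auto simp: C intro!: arg_cong[where f = "emeasure P"])
    finally show "emeasure ?J C = emeasure (?X \<bind> K) C" ..
  qed
  note c(1)[measurable] g(1)[measurable]
  have cg: "(\<lambda>p. c (fst p) * g (snd p)) \<in> borel_measurable (MX \<Otimes>\<^sub>M MY)" by measurable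
  have "(\<integral>p. c (fst p) * g (snd p) \<partial>(?X \<bind> K))
      = (\<integral>x. \<integral>p. c (fst p) * g (snd p) \<partial>K x \<partial>?X)"
  proof (rule integral_bind[where K = "MX \<Otimes>\<^sub>M MY" and B = "Bc * Bg" and B' = 1])
    show "\<bar>c (fst p) * g (snd p)\<bar> \<le> Bc * Bg" if "p \<in> space (MX \<Otimes>\<^sub>M MY)" for p
    proof -
      have "0 \<le> Bc" using order_trans[OF abs_ge_zero c(2)] .
      then show ?thesis unfolding abs_mult
        using that by (intro mult_mono c(2) g(2)) (auto simp: space_pair_measure)
    qed
    show "AE x in ?X. emeasure (K x) (space (K x)) \<le> ennreal 1"
    proof (intro AE_I2)
      fix x assume "x \<in> space ?X"
      then have "K x \<in> space (subprob_algebra (MX \<Otimes>\<^sub>M MY))" by (intro measurable_space[OF K]) simp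
      then show "emeasure (K x) (space (K x)) \<le> ennreal 1"
        by (simp add: space_subprob_algebra subprob_space.emeasure_space_le_1)
    qed
    show "finite_measure ?X" by unfold_locales
    show "(\<lambda>p. c (fst p) * g (snd p)) \<in> borel_measurable (MX \<Otimes>\<^sub>M MY)" by (rule cg)
    show "K \<in> measurable ?X (subprob_algebra (MX \<Otimes>\<^sub>M MY))" by (rule K')
  qed
  also have "\<dots> = (\<integral>x. c x * (\<integral>y. g y \<partial>\<kappa> x) \<partial>?X)"
  proof (intro Bochner_Integration.integral_cong refl)
    fix x assume "x \<in> space ?X"
    then have x: "x \<in> space MX" by simp
    have Px: "Pair x \<in> measurable (\<kappa> x) (MX \<Otimes>\<^sub>M MY)"
      unfolding measurable_cong_sets[OF \<kappa>p(2)[OF x] refl] using x by (rule measurable_Pair1')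
    show "(\<integral>p. c (fst p) * g (snd p) \<partial>K x) = c x * (\<integral>y. g y \<partial>\<kappa> x)"
      unfolding K_def by (subst integral_distr[OF Px cg]) simp
  qed
  finally show ?thesis by (simp add: joint)
qed

text \<open>Pull-out property of conditional expectation. Integrability of \<open>f (X_of z)\<close>
  is enough because the treatment takes values 0 and 1; this matters since \<open>f\<close> will
  contain the outcome model error, which is not bounded.\<close>

lemma propensity_integral:
  fixes f e :: "'x::topological_space \<Rightarrow> real"
  assumes M: "prob_space M" and X: "X_of \<in> measurable M borel" and T: "T_of \<in> borel_measurable M"
    and e: "is_propensity M e"
    and f: "f \<in> borel_measurable borel" "integrable M (\<lambda>z. f (X_of z))"
  shows "integrable M (\<lambda>z. f (X_of z) * e (X_of z))"
    and "(\<integral>z. f (X_of z) * T_of z \<partial>M) = (\<integral>z. f (X_of z) * e (X_of z) \<partial>M)"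
proof -
  interpret prob_space M by fact
  let ?F = "vimage_algebra (space M) X_of borel"
  have "subalgebra M ?F"
    using X by (simp add: subalgebra_def sets_image_in_sets)
  then interpret finite_measure_subalgebra M ?F by unfold_locales
  have eb: "e \<in> borel_measurable borel" and ce: "AE z in M. e (X_of z) = real_cond_exp M ?F T_of z"
    using e by (auto simp: is_propensity_def)
  have XF: "X_of \<in> measurable ?F borel" by (rule measurable_vimage_algebra1) simp
  have fF: "(\<lambda>z. f (X_of z)) \<in> borel_measurable ?F" by (rule measurable_compose[OF XF f(1)])
  have fM: "(\<lambda>z. f (X_of z)) \<in> borel_measurable M" by (rule measurable_compose[OF X f(1)])
  have eM: "(\<lambda>z. e (X_of z)) \<in> borel_measurable M" by (rule measurable_compose[OF X eb])
  have "integrable M (\<lambda>z. f (X_of z) * T_of z)"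
  proof (rule Bochner_Integration.integrable_bound[OF f(2)])
    show "(\<lambda>z. f (X_of z) * T_of z) \<in> borel_measurable M" using fM T by measurable
  qed (auto simp: T_of_def)
  note r = real_cond_exp_intg[OF this fF T]
  have ae: "AE z in M. f (X_of z) * real_cond_exp M ?F T_of z = f (X_of z) * e (X_of z)"
    using ce by eventually_elim simp
  show "integrable M (\<lambda>z. f (X_of z) * e (X_of z))"
    using r(1) ae fM eM by (subst integrable_cong_AE[symmetric]) auto
  show "(\<integral>z. f (X_of z) * T_of z \<partial>M) = (\<integral>z. f (X_of z) * e (X_of z) \<partial>M)"
    using r(2) integral_cong_AE[OF _ _ ae] fM eM by simp
qed

subsection \<open>Weak integrals, covariance operators and characteristic kernels\<close>

lemma weak_integral_eq:
  assumes "has_weak_integral M f m"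
  shows "weak_integral M f = m"
  unfolding weak_integral_def
proof (rule the_equality)
  fix m' assume "has_weak_integral M f m'"
  then have "m' \<bullet> g = m \<bullet> g" for g using assms by (simp add: has_weak_integral_def)
  then have "(m' - m) \<bullet> (m' - m) = 0" by (simp add: inner_diff_left)
  then show "m' = m" by simp
qed fact

text \<open>The integral of \<open>f x \<bullet> g\<close> is a bounded linear functional of
  \<open>g\<close>; its Riesz representer is the weak integral.\<close>

lemma (in prob_space) bounded_has_weak_integral:
  fixes f :: "'a \<Rightarrow> 'h::{real_inner,complete_space}"
  assumes meas: "\<And>g. (\<lambda>x. f x \<bullet> g) \<in> borel_measurable M"
    and bd: "\<And>x. x \<in> space M \<Longrightarrow> norm (f x) \<le> B"
  shows "\<exists>m. has_weak_integral M f m"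
proof -
  have le: "\<bar>f x \<bullet> g\<bar> \<le> B * norm g" if "x \<in> space M" for x g
    using Cauchy_Schwarz_ineq2[of "f x" g] bd[OF that] by (meson mult_right_mono norm_ge_zero order_trans)
  have int: "integrable M (\<lambda>x. f x \<bullet> g)" for g
    by (rule integrable_const_bound[where B = "B * norm g"]) (use le meas in auto)
  have "bounded_linear (\<lambda>g. \<integral>x. f x \<bullet> g \<partial>M)"
  proof (rule bounded_linear_intro)
    show "(\<integral>x. f x \<bullet> (g + h) \<partial>M) = (\<integral>x. f x \<bullet> g \<partial>M) + (\<integral>x. f x \<bullet> h \<partial>M)" for g h
      using int by (simp add: inner_add_right)
    show "(\<integral>x. f x \<bullet> (r *\<^sub>R g) \<partial>M) = r *\<^sub>R (\<integral>x. f x \<bullet> g \<partial>M)" for r g by simp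
    show "norm (\<integral>x. f x \<bullet> g \<partial>M) \<le> norm g * B" for g
    proof -
      have "norm (\<integral>x. f x \<bullet> g \<partial>M) \<le> (\<integral>x. \<bar>f x \<bullet> g\<bar> \<partial>M)"
        using integral_norm_bound[of M "\<lambda>x. f x \<bullet> g"] by simp
      also have "\<dots> \<le> (\<integral>x. B * norm g \<partial>M)" using int le by (intro integral_mono) auto
      finally show ?thesis by (simp add: prob_space mult.commute)
    qed
  qed
  from riesz_representation[OF this] int show ?thesis
    unfolding has_weak_integral_def by metis
qed

text \<open>The integrand defining the covariance operator is bounded, so its weak integral exists,
  and the first claim determines the operator through its bilinear form. Symmetry, positivity and
  the bounds with \<open>B\<^sup>2\<close> are read off from that form.\<close>

lemma cov_op_props:
  fixes \<phi> :: "'x \<Rightarrow> 'h::{real_inner,complete_space}"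
  assumes R: "prob_space R" and meas: "\<And>g. (\<lambda>x. g \<bullet> \<phi> x) \<in> borel_measurable R"
    and bd: "\<And>x. norm (\<phi> x) \<le> B" and fn: "\<And>f x. fn f x = f \<bullet> \<phi> x"
  shows "cov_op R fn \<phi> f \<bullet> g = (\<integral>x. (f \<bullet> \<phi> x) * (g \<bullet> \<phi> x) \<partial>R)"
    and "integrable R (\<lambda>x. (f \<bullet> \<phi> x) * (g \<bullet> \<phi> x))"
    and "bounded_linear (cov_op R fn \<phi>)"
    and "cov_op R fn \<phi> f \<bullet> g = f \<bullet> cov_op R fn \<phi> g"
    and "0 \<le> cov_op R fn \<phi> f \<bullet> f"
    and "cov_op R fn \<phi> f \<bullet> f \<le> B\<^sup>2 * (norm f)\<^sup>2"
    and "norm (cov_op R fn \<phi> f) \<le> B\<^sup>2 * norm f"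
proof -
  interpret prob_space R by fact
  have B0: "0 \<le> B" using order_trans[OF norm_ge_zero bd] .
  have le: "\<bar>f \<bullet> \<phi> x\<bar> \<le> norm f * B" for f x
    using Cauchy_Schwarz_ineq2[of f "\<phi> x"] bd[of x] by (meson mult_left_mono norm_ge_zero order_trans)
  have le2: "\<bar>(f \<bullet> \<phi> x) * (g \<bullet> \<phi> x)\<bar> \<le> B\<^sup>2 * norm f * norm g" for f g x
  proof -
    have "\<bar>(f \<bullet> \<phi> x) * (g \<bullet> \<phi> x)\<bar> \<le> (norm f * B) * (norm g * B)"
      unfolding abs_mult using le B0 by (intro mult_mono) auto
    then show ?thesis by (simp add: power2_eq_square mult_ac)
  qed
  have int: "integrable R (\<lambda>x. (f \<bullet> \<phi> x) * (g \<bullet> \<phi> x))" for f g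
    by (rule integrable_const_bound[where B = "B\<^sup>2 * norm f * norm g"])
      (use le2 meas in \<open>auto intro: borel_measurable_times\<close>)
  then show "integrable R (\<lambda>x. (f \<bullet> \<phi> x) * (g \<bullet> \<phi> x))" .
  have ex: "\<exists>m. has_weak_integral R (\<lambda>x. fn f x *\<^sub>R \<phi> x) m" for f
  proof (rule bounded_has_weak_integral)
    show "(\<lambda>x. (fn f x *\<^sub>R \<phi> x) \<bullet> g) \<in> borel_measurable R" for g
      using borel_measurable_times[OF meas[of f] meas[of g]] by (simp add: fn inner_commute)
    show "norm (fn f x *\<^sub>R \<phi> x) \<le> (norm f * B) * B" for x
      unfolding norm_scaleR fn using le bd B0 by (intro mult_mono) auto
  qed
  have form: "cov_op R fn \<phi> f \<bullet> g = (\<integral>x. (f \<bullet> \<phi> x) * (g \<bullet> \<phi> x) \<partial>R)" for f g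
  proof -
    obtain m where m: "has_weak_integral R (\<lambda>x. fn f x *\<^sub>R \<phi> x) m" using ex by blast
    then have "cov_op R fn \<phi> f = m" unfolding cov_op_def by (rule weak_integral_eq)
    then show ?thesis using m by (simp add: has_weak_integral_def fn inner_commute)
  qed
  then show "cov_op R fn \<phi> f \<bullet> g = (\<integral>x. (f \<bullet> \<phi> x) * (g \<bullet> \<phi> x) \<partial>R)" .
  have bnd: "\<bar>cov_op R fn \<phi> f \<bullet> g\<bar> \<le> B\<^sup>2 * norm f * norm g" for f g
  proof -
    have "\<bar>cov_op R fn \<phi> f \<bullet> g\<bar> \<le> (\<integral>x. \<bar>(f \<bullet> \<phi> x) * (g \<bullet> \<phi> x)\<bar> \<partial>R)"
      using integral_norm_bound[of R "\<lambda>x. (f \<bullet> \<phi> x) * (g \<bullet> \<phi> x)"] by (simp add: form)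
    also have "\<dots> \<le> (\<integral>x. B\<^sup>2 * norm f * norm g \<partial>R)" using int le2 by (intro integral_mono) auto
    finally show ?thesis by (simp add: prob_space)
  qed
  have nb: "norm (cov_op R fn \<phi> f) \<le> B\<^sup>2 * norm f" for f
  proof (cases "cov_op R fn \<phi> f = 0")
    case False
    then show ?thesis
      using bnd[of f "cov_op R fn \<phi> f"] by (simp add: dot_square_norm power2_eq_square)
  qed (simp add: B0)
  then show "norm (cov_op R fn \<phi> f) \<le> B\<^sup>2 * norm f" .
  have eqI: "a = b" if "\<And>g. a \<bullet> g = b \<bullet> g" for a b :: 'h
    using that[of "a - b"] by (metis inner_diff_left inner_eq_zero_iff right_minus_eq)
  show "bounded_linear (cov_op R fn \<phi>)"
  proof (rule bounded_linear_intro)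
    show "cov_op R fn \<phi> (f + h) = cov_op R fn \<phi> f + cov_op R fn \<phi> h" for f h
      by (rule eqI) (simp add: inner_add_left form distrib_right int)
    show "cov_op R fn \<phi> (r *\<^sub>R f) = r *\<^sub>R cov_op R fn \<phi> f" for r f
      by (rule eqI) (simp add: form mult.assoc)
    show "norm (cov_op R fn \<phi> f) \<le> norm f * B\<^sup>2" for f using nb[of f] by (simp add: mult.commute)
  qed
  show "cov_op R fn \<phi> f \<bullet> g = f \<bullet> cov_op R fn \<phi> g"
    by (simp add: inner_commute[of f] form mult.commute)
  show "0 \<le> cov_op R fn \<phi> f \<bullet> f" by (simp add: form)
  show "cov_op R fn \<phi> f \<bullet> f \<le> B\<^sup>2 * (norm f)\<^sup>2"
    using bnd[of f f] by (simp add: power2_eq_square mult_ac)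
qed

text \<open>A mean embedding of a point mass exists, and integrability against a point mass already
  includes measurability on \<open>MY\<close>.\<close>

lemma characteristic_measurable:
  assumes "characteristic MY \<phi>" "y0 \<in> space MY"
  shows "(\<lambda>y. \<phi> y \<bullet> g) \<in> borel_measurable MY"
proof -
  have "prob_space (return MY y0)" using assms(2) by (rule prob_space_return)
  then obtain m where "has_weak_integral (return MY y0) \<phi> m"
    using assms(1) unfolding characteristic_def by force
  then have "integrable (return MY y0) (\<lambda>y. \<phi> y \<bullet> g)" by (simp add: has_weak_integral_def)
  then show ?thesis using borel_measurable_integrable by fastforce
qed

text \<open>If some function in the space were unbounded, a geometric mixture of point masses at points
  where it is large would not have a mean embedding; the uniform bound is Banach-Steinhaus.\<close>

lemma characteristic_bounded:
  fixes \<phi> :: "'y \<Rightarrow> 'h::{real_inner,complete_space}"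
  assumes ch: "characteristic MY \<phi>"
  shows "\<exists>B. \<forall>y\<in>space MY. norm (\<phi> y) \<le> B"
proof -
  have "\<exists>B. \<forall>y\<in>space MY. \<bar>\<phi> y \<bullet> g\<bar> \<le> B" for g
  proof (rule ccontr)
    assume "\<not> ?thesis"
    \<comment> \<open>The factor \<open>2 ^ Suc n\<close> cancels the geometric weight at
      \<open>n\<close>, so the atom at \<open>n\<close> alone will contribute at least
      \<open>n\<close> to the integral.\<close>
    then have "\<forall>n. \<exists>y\<in>space MY. real n * 2 ^ Suc n < \<bar>\<phi> y \<bullet> g\<bar>" by (meson not_le)
    then obtain y where y: "\<And>n::nat. y n \<in> space MY" "\<And>n. real n * 2 ^ Suc n < \<bar>\<phi> (y n) \<bullet> g\<bar>"
      by metis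
    define p where "p = geometric_pmf (1/2)"
    define N where "N = distr (measure_pmf p) MY y"
    have ym: "y \<in> measurable (measure_pmf p) MY" using y(1) by simp
    have "prob_space N" unfolding N_def using ym by (rule prob_space.prob_space_distr[OF prob_space_measure_pmf])
    then obtain m where m: "has_weak_integral N \<phi> m"
      using ch unfolding characteristic_def by (force simp: N_def)
    then have i: "integrable N (\<lambda>y. \<phi> y \<bullet> g)" by (simp add: has_weak_integral_def)
    have "(\<lambda>y. \<phi> y \<bullet> g) \<in> borel_measurable MY"
      using characteristic_measurable[OF ch y(1)] .
    then have "integrable p (\<lambda>n. \<phi> (y n) \<bullet> g)"
      using i unfolding N_def by (subst (asm) integrable_distr_eq[OF ym])
    then have i': "integrable p (\<lambda>n. \<bar>\<phi> (y n) \<bullet> g\<bar>)" by (rule integrable_abs)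
    \<comment> \<open>For \<open>K\<close> beyond the value of the integral, the contribution of the
      single atom at \<open>K\<close> is a contradiction.\<close>
    obtain K where K: "(\<integral>n. \<bar>\<phi> (y n) \<bullet> g\<bar> \<partial>p) < real K" using reals_Archimedean2 by blast
    have "real K \<le> pmf p K * \<bar>\<phi> (y K) \<bullet> g\<bar>"
    proof -
      have "pmf p K * (real K * 2 ^ Suc K) \<le> pmf p K * \<bar>\<phi> (y K) \<bullet> g\<bar>"
        using y(2)[of K] by (intro mult_left_mono) auto
      moreover have "pmf p K * (real K * 2 ^ Suc K) = real K"
        by (simp add: p_def power_divide)
      ultimately show ?thesis by linarith
    qed
    also have "\<dots> = (\<integral>n. indicator {K} n * \<bar>\<phi> (y K) \<bullet> g\<bar> \<partial>p)"
      by (simp add: pmf.rep_eq measure_pmf.emeasure_eq_measure)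
    also have "\<dots> \<le> (\<integral>n. \<bar>\<phi> (y n) \<bullet> g\<bar> \<partial>p)"
      using i' by (intro integral_mono) (auto split: split_indicator simp: measure_pmf.emeasure_eq_measure)
    finally show False using K by simp
  qed
  then have "\<exists>B. \<forall>s\<in>\<phi> ` space MY. norm s \<le> B" by (intro banach_steinhaus_inner) simp
  then show ?thesis by blast
qed

text \<open>Banach-Steinhaus for the vectors \<open>m\<close> divided by \<open>sqrt (q v)\<close>:
  for each \<open>g\<close> their inner products with \<open>g\<close> are bounded by a constant
  that may depend on \<open>g\<close>, hence their norms are bounded. \<open>Rel\<close> is an
  arbitrary relation so that one constant covers all pairs of interest.\<close>

lemma uniform_form_bound:
  fixes Rel :: "('h::{real_inner,complete_space} \<times> 'k) set" and q :: "'k \<Rightarrow> real"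
  assumes b: "\<And>g. \<exists>M. \<forall>(m, v)\<in>Rel. (m \<bullet> g)\<^sup>2 \<le> M * q v" and q: "\<And>v. 0 \<le> q v"
  shows "\<exists>M\<ge>0. \<forall>(m, v)\<in>Rel. norm m \<le> M * sqrt (q v)"
proof -
  define S where "S = {(1 / sqrt (q v)) *\<^sub>R m |m v. (m, v) \<in> Rel \<and> 0 < q v}"
  have "\<exists>M. \<forall>s\<in>S. \<bar>s \<bullet> g\<bar> \<le> M" for g
  proof -
    obtain M where M: "\<And>m v. (m, v) \<in> Rel \<Longrightarrow> (m \<bullet> g)\<^sup>2 \<le> M * q v" using b by blast
    have "\<bar>((1 / sqrt (q v)) *\<^sub>R m) \<bullet> g\<bar> \<le> sqrt M" if "(m, v) \<in> Rel" "0 < q v" for m v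
    proof -
      have "\<bar>m \<bullet> g\<bar> \<le> sqrt (M * q v)" using M[OF that(1)] real_le_rsqrt by fastforce
      then show ?thesis using that by (simp add: real_sqrt_mult abs_mult field_simps)
    qed
    then show ?thesis unfolding S_def by blast
  qed
  then obtain M where M: "\<forall>s\<in>S. norm s \<le> M" using banach_steinhaus_inner by blast
  have "norm m \<le> max M 0 * sqrt (q v)" if mv: "(m, v) \<in> Rel" for m v
  proof (cases "q v = 0")
    case True
    \<comment> \<open>Testing \<open>m\<close> against itself shows that \<open>m = 0\<close> when
      \<open>q v = 0\<close>.\<close>
    obtain M' where "(m \<bullet> m)\<^sup>2 \<le> M' * q v" using b[of m] mv by blast
    then show ?thesis using True by simp
  next
    case False
    then have p: "0 < q v" using q[of v] by simp
    then have "norm ((1 / sqrt (q v)) *\<^sub>R m) \<le> M" using M mv unfolding S_def by blast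
    then have "norm m \<le> M * sqrt (q v)" using p by (simp add: field_simps)
    also have "\<dots> \<le> max M 0 * sqrt (q v)" using p by (intro mult_right_mono) auto
    finally show ?thesis .
  qed
  then show ?thesis by (intro exI[of _ "max M 0"]) auto
qed

subsection \<open>The doubly robust residual\<close>

text \<open>Double robustness: conditionally on \<open>X\<close>, the residual of the doubly robust pseudo-outcome has
  mean \<open>(1 - e / eh) r\<close>, a product of the two model errors.\<close>

lemma dr_residual_conditional_mean:
  fixes \<phi> :: "'y \<Rightarrow> 'h::real_inner" and X :: "'o \<Rightarrow> 'x::topological_space" and c eh :: "'x \<Rightarrow> real"
  assumes P: "prob_space P" and X: "X \<in> measurable P borel" and Y: "Y \<in> measurable P MY"
    and reg: "regular_cond_distr P borel X MY Y \<kappa>"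
    and M1: "M1 = distr P (borel \<Otimes>\<^sub>M MY) (\<lambda>\<omega>. (X \<omega>, Y \<omega>))"
    and M0: "sets M0 = sets M1" "prob_space M0" and \<alpha>: "0 \<le> \<alpha>" "\<alpha> \<le> 1"
    and M: "M = treatment_law \<alpha> M1 M0" and e: "is_propensity M e"
    and \<phi>: "(\<lambda>y. \<phi> y \<bullet> h) \<in> borel_measurable MY" "\<And>y. y \<in> space MY \<Longrightarrow> \<bar>\<phi> y \<bullet> h\<bar> \<le> L"
    and mu: "\<And>x. (\<integral>y. \<phi> y \<bullet> h \<partial>\<kappa> x) = mu x \<bullet> h" "(\<lambda>x. mu x \<bullet> h) \<in> borel_measurable borel"
      "\<And>x. \<bar>mu x \<bullet> h\<bar> \<le> L"
    and r: "(\<lambda>x. r x \<bullet> h) \<in> borel_measurable borel" "integrable M (\<lambda>z. r (X_of z) \<bullet> h)"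
    and eh: "eh \<in> borel_measurable borel" "\<And>x. \<delta> < eh x" "0 < \<delta>"
    and c: "c \<in> borel_measurable borel" "\<And>x. \<bar>c x\<bar> \<le> Bc"
  shows "(\<integral>z. (((T_of z / eh (X_of z)) *\<^sub>R (\<phi> (W_of z) - mu (X_of z))
          + (1 - T_of z / eh (X_of z)) *\<^sub>R r (X_of z)) \<bullet> h) * c (X_of z) \<partial>M)
    = (\<integral>z. (((1 - e (X_of z) / eh (X_of z)) *\<^sub>R r (X_of z)) \<bullet> h) * c (X_of z) \<partial>M)"
proof -
  have sM1: "sets M1 = sets (borel \<Otimes>\<^sub>M MY)" by (simp add: M1)
  have pM1: "prob_space M1" unfolding M1
    using X Y by (intro prob_space.prob_space_distr[OF P]) measurable
  then interpret M1: prob_space M1 .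
  have pM: "prob_space M" unfolding M by (rule prob_space_treatment_law[OF pM1 M0(2,1) \<alpha>])
  then interpret prob_space M .
  note tm = treatment_law_measurable[OF sM1, of \<alpha> M0, folded M]
  note [measurable] = tm \<phi>(1) mu(2) r(1) eh(1) c(1)
  have eb: "e \<in> borel_measurable borel" using e by (simp add: is_propensity_def)
  have sM: "sets M = sets (count_space UNIV \<Otimes>\<^sub>M (borel \<Otimes>\<^sub>M MY))"
    using sets_pair_measure_cong[OF refl sM1] by (simp add: M sets_treatment_law)
  have Bc0: "0 \<le> Bc" using order_trans[OF abs_ge_zero c(2)] .
  define c' where "c' x = c x / eh x" for x
  have c'm [measurable]: "c' \<in> borel_measurable borel" unfolding c'_def by measurable
  have c'B: "\<bar>c' x\<bar> \<le> Bc / \<delta>" for x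
    unfolding c'_def abs_divide using c(2)[of x] eh(2)[of x] eh(3) Bc0 by (intro frac_le) auto
  have c'y: "\<bar>c' x * y\<bar> \<le> Bc / \<delta> * L" if "\<bar>y\<bar> \<le> L" for x y
    unfolding abs_mult using c'B that Bc0 eh(3) by (intro mult_mono) auto
  \<comment> \<open>The outcome noise part: \<open>T_of z * f z\<close> involves treated units only,
    and its expectation will vanish.\<close>
  define f where "f z = c' (X_of z) * (\<phi> (W_of z) \<bullet> h - mu (X_of z) \<bullet> h)" for z
  have Wsp: "W_of z \<in> space MY" if "z \<in> space M" for z using measurable_space[OF tm(2) that] .
  have fB: "\<bar>f z\<bar> \<le> Bc / \<delta> * (2 * L)" if "z \<in> space M" for z
    unfolding f_def abs_mult
  proof (intro mult_mono c'B)
    show "\<bar>\<phi> (W_of z) \<bullet> h - mu (X_of z) \<bullet> h\<bar> \<le> 2 * L"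
      using \<phi>(2)[OF Wsp[OF that]] mu(3)[of "X_of z"] by linarith
  qed (use Bc0 eh(3) in auto)
  have fm: "f \<in> borel_measurable M" unfolding f_def by measurable
  have fm': "f \<in> borel_measurable (count_space UNIV \<Otimes>\<^sub>M M1)"
    using fm by (simp add: M measurable_cong_sets[OF sets_treatment_law refl])
  have Tf: "integrable M (\<lambda>z. T_of z * f z)"
  proof (rule integrable_const_bound)
    show "AE z in M. norm (T_of z * f z) \<le> Bc / \<delta> * (2 * L)"
    proof (intro AE_I2)
      fix z assume z: "z \<in> space M"
      have "norm (T_of z * f z) \<le> \<bar>f z\<bar>" by (simp add: T_of_def)
      then show "norm (T_of z * f z) \<le> Bc / \<delta> * (2 * L)" using fB[OF z] by linarith
    qed
    show "(\<lambda>z. T_of z * f z) \<in> borel_measurable M" using fm by measurable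
  qed
  \<comment> \<open>Given the covariate, a treated outcome has law \<open>\<kappa>\<close>, whose
    mean is \<open>mu\<close>. Both integrals over \<open>M1\<close> therefore reduce to the same
    integral over the law of \<open>X\<close>.\<close>
  have zero: "(\<integral>z. T_of z * f z \<partial>M) = 0"
  proof -
    have "(\<integral>z. T_of z * f z \<partial>M) = \<alpha> * (\<integral>p. f (True, p) \<partial>M1)"
      unfolding M by (rule integral_treated[OF M0(1) \<alpha>(1) fm'])
    also have "(\<integral>p. f (True, p) \<partial>M1)
        = (\<integral>p. c' (fst p) * (\<phi> (snd p) \<bullet> h) - c' (fst p) * (mu (fst p) \<bullet> h) * 1 \<partial>M1)"
      by (simp add: f_def X_of_def W_of_def right_diff_distrib)
    also have "\<dots> = (\<integral>p. c' (fst p) * (\<phi> (snd p) \<bullet> h) \<partial>M1) - (\<integral>p. c' (fst p) * (mu (fst p) \<bullet> h) * 1 \<partial>M1)"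
    proof (rule Bochner_Integration.integral_diff)
      have f1: "fst \<in> measurable M1 borel" and s1: "snd \<in> measurable M1 MY"
        unfolding measurable_cong_sets[OF sM1 refl] by measurable
      note [measurable] = f1 s1
      have sp: "snd p \<in> space MY" if "p \<in> space M1" for p using measurable_space[OF s1 that] .
      show "integrable M1 (\<lambda>p. c' (fst p) * (\<phi> (snd p) \<bullet> h))"
        by (rule M1.integrable_const_bound[where B = "Bc / \<delta> * L"])
          (use c'y[OF \<phi>(2)[OF sp]] in \<open>simp_all add: AE_I2\<close>)
      show "integrable M1 (\<lambda>p. c' (fst p) * (mu (fst p) \<bullet> h) * 1)"
        by (rule M1.integrable_const_bound[where B = "Bc / \<delta> * L"])
          (use c'y[OF mu(3)] in \<open>simp_all add: AE_I2\<close>)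
    qed
    also have "(\<integral>p. c' (fst p) * (\<phi> (snd p) \<bullet> h) \<partial>M1) = (\<integral>x. c' x * (mu x \<bullet> h) \<partial>distr P borel X)"
      unfolding M1 mu(1)[symmetric]
      by (rule regular_cond_distr_integral[OF P X Y reg c'm c'B \<phi>])
    also have "(\<integral>p. c' (fst p) * (mu (fst p) \<bullet> h) * 1 \<partial>M1) = (\<integral>x. c' x * (mu x \<bullet> h) \<partial>distr P borel X)"
    proof -
      have XY: "(\<lambda>\<omega>. (X \<omega>, Y \<omega>)) \<in> measurable P (borel \<Otimes>\<^sub>M MY)" using X Y by measurable
      show ?thesis unfolding M1 using X
        by (subst integral_distr[OF XY], measurable, subst integral_distr[OF X], measurable)
    qed
    finally show ?thesis by simp
  qed
  \<comment> \<open>The model error enters with the factor \<open>1 - T_of z / eh (X_of z)\<close>.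
    The propensity identity applied to \<open>u\<close> replaces \<open>T_of z\<close> by
    \<open>e (X_of z)\<close>, which turns this factor into the propensity error.\<close>
  define u where "u x = c' x * (r x \<bullet> h)" for x
  have um [measurable]: "u \<in> borel_measurable borel" unfolding u_def by measurable
  have ui: "integrable M (\<lambda>z. u (X_of z))"
  proof (rule Bochner_Integration.integrable_bound)
    show "integrable M (\<lambda>z. Bc / \<delta> * (r (X_of z) \<bullet> h))" using r(2) by simp
    show "AE z in M. norm (u (X_of z)) \<le> norm (Bc / \<delta> * (r (X_of z) \<bullet> h))"
    proof (intro AE_I2)
      fix z
      have "\<bar>c' (X_of z)\<bar> * \<bar>r (X_of z) \<bullet> h\<bar> \<le> Bc / \<delta> * \<bar>r (X_of z) \<bullet> h\<bar>"
        by (intro mult_right_mono c'B) simp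
      then show "norm (u (X_of z)) \<le> norm (Bc / \<delta> * (r (X_of z) \<bullet> h))"
        using Bc0 eh(3) by (simp add: u_def abs_mult)
    qed
  qed measurable
  note pr = propensity_integral[OF pM tm(1) tm(3) e um ui]
  have uT: "integrable M (\<lambda>z. u (X_of z) * T_of z)"
    by (rule Bochner_Integration.integrable_bound[OF ui]) (measurable, simp add: T_of_def)
  have ci: "integrable M (\<lambda>z. c (X_of z) * (r (X_of z) \<bullet> h))"
  proof (rule Bochner_Integration.integrable_bound)
    show "integrable M (\<lambda>z. Bc * (r (X_of z) \<bullet> h))" using r(2) by simp
    show "AE z in M. norm (c (X_of z) * (r (X_of z) \<bullet> h)) \<le> norm (Bc * (r (X_of z) \<bullet> h))"
      using c(2) Bc0 by (auto simp: abs_mult intro!: AE_I2 mult_right_mono)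
  qed measurable
  have "(\<integral>z. (((T_of z / eh (X_of z)) *\<^sub>R (\<phi> (W_of z) - mu (X_of z))
          + (1 - T_of z / eh (X_of z)) *\<^sub>R r (X_of z)) \<bullet> h) * c (X_of z) \<partial>M)
     = (\<integral>z. T_of z * f z + (c (X_of z) * (r (X_of z) \<bullet> h) - u (X_of z) * T_of z) \<partial>M)"
    by (intro Bochner_Integration.integral_cong refl)
      (simp add: f_def u_def c'_def inner_add_left inner_diff_left algebra_simps diff_divide_distrib add_divide_distrib)
  also have "\<dots> = (\<integral>z. c (X_of z) * (r (X_of z) \<bullet> h) \<partial>M) - (\<integral>z. u (X_of z) * e (X_of z) \<partial>M)"
    using Tf ci uT zero pr(2) by simp
  also have "\<dots> = (\<integral>z. c (X_of z) * (r (X_of z) \<bullet> h) - u (X_of z) * e (X_of z) \<partial>M)"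
    using ci pr(1) by simp
  also have "\<dots> = (\<integral>z. (((1 - e (X_of z) / eh (X_of z)) *\<^sub>R r (X_of z)) \<bullet> h) * c (X_of z) \<partial>M)"
    by (intro Bochner_Integration.integral_cong refl) (simp add: u_def c'_def algebra_simps)
  finally show ?thesis .
qed

text \<open>The doubly robust residual and its conditional mean are both scalar combinations of
  three features: of the outcome, of the fitted mean and of the true mean. Six cross-measurability
  facts about these features serve all pairings.\<close>

lemma cross_measurable_lincomb3:
  assumes p: "p \<in> borel_measurable M" "q \<in> borel_measurable M" "w \<in> borel_measurable M"
    and p': "p' \<in> borel_measurable M" "q' \<in> borel_measurable M" "w' \<in> borel_measurable M"
    and c: "cross_measurable M M a a" "cross_measurable M M a b" "cross_measurable M M a c"
      "cross_measurable M M b b" "cross_measurable M M b c" "cross_measurable M M c c"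
  shows "cross_measurable M M (\<lambda>z. p z *\<^sub>R a z + q z *\<^sub>R b z + w z *\<^sub>R c z)
      (\<lambda>z. p' z *\<^sub>R a z + q' z *\<^sub>R b z + w' z *\<^sub>R c z)"
proof -
  note c' = c c(2,3,5)[THEN cross_measurable_commute]
  have l: "cross_measurable M M (\<lambda>z. p z *\<^sub>R a z + q z *\<^sub>R b z + w z *\<^sub>R c z) h"
    if "cross_measurable M M a h" "cross_measurable M M b h" "cross_measurable M M c h" for h
    by (intro cross_measurable_add cross_measurable_scaleR p that)
  note l' = l[OF c'(1,7,8)] l[OF c'(2,4,9)] l[OF c'(3,5,6)]
  show ?thesis
    by (rule cross_measurable_commute)
      (intro cross_measurable_add cross_measurable_scaleR p' l'[THEN cross_measurable_commute])
qed

lemma integrable_square_of_nn_integral: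
  fixes f :: "'a \<Rightarrow> real"
  assumes f [measurable]: "f \<in> borel_measurable M" and le: "(\<integral>\<^sup>+x. ennreal ((f x)\<^sup>2) \<partial>M) \<le> ennreal (b\<^sup>2)"
  shows "integrable M (\<lambda>x. (f x)\<^sup>2)" "(\<integral>x. (f x)\<^sup>2 \<partial>M) \<le> b\<^sup>2"
proof -
  have "(\<integral>\<^sup>+x. ennreal ((f x)\<^sup>2) \<partial>M) < \<infinity>"
    using le by (rule order_le_less_trans) simp
  then show i: "integrable M (\<lambda>x. (f x)\<^sup>2)"
    by (intro integrableI_nonneg) auto
  have "ennreal (\<integral>x. (f x)\<^sup>2 \<partial>M) \<le> ennreal (b\<^sup>2)"
    using le nn_integral_eq_integral[OF i] by simp
  then show "(\<integral>x. (f x)\<^sup>2 \<partial>M) \<le> b\<^sup>2" by (simp add: ennreal_le_iff)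
qed

text \<open>Collects what the moment and tail bounds use of the law of \<open>(T, X, W)\<close>,
  without reference to the two populations. \<open>residual_mean\<close> is double robustness in
  weak form; it is quantified over \<open>eh\<close> and \<open>r\<close> so that it applies to
  every frozen training outcome.\<close>

locale dr_model = prob_space M
  for M :: "(bool \<times> 'x::topological_space \<times> 'y) measure" +
  fixes MY :: "'y measure" and R :: "'x measure" and e :: "'x \<Rightarrow> real"
    and \<phi>k :: "'x \<Rightarrow> 'hk::real_inner" and B :: real
    and \<phi>l :: "'y \<Rightarrow> 'hl::real_inner" and mu :: "'x \<Rightarrow> 'hl" and L :: real
  assumes X_meas: "X_of \<in> measurable M borel" and W_meas: "W_of \<in> measurable M MY"
    and T_meas: "T_of \<in> borel_measurable M" and e_meas: "e \<in> borel_measurable borel"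
    and R_law: "R = distr M borel X_of"
    and k_cross: "cross_measurable borel borel \<phi>k \<phi>k" and k_bound: "\<And>x. norm (\<phi>k x) \<le> B"
    and k_weak: "\<And>g. (\<lambda>x. g \<bullet> \<phi>k x) \<in> borel_measurable borel"
    and l_cross: "cross_measurable MY MY \<phi>l \<phi>l" and l_bound: "\<And>y. y \<in> space MY \<Longrightarrow> norm (\<phi>l y) \<le> L"
    and mu_cross: "cross_measurable borel borel mu mu" "cross_measurable MY borel \<phi>l mu"
    and mu_bound: "\<And>x. norm (mu x) \<le> L"
    and residual_mean: "\<And>h r eh c \<delta> Bc.
      (\<lambda>x. r x \<bullet> h) \<in> borel_measurable borel \<Longrightarrow> integrable M (\<lambda>z. r (X_of z) \<bullet> h) \<Longrightarrow>
      eh \<in> borel_measurable borel \<Longrightarrow> (\<And>x. \<delta> < eh x) \<Longrightarrow> 0 < \<delta> \<Longrightarrow>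
      c \<in> borel_measurable borel \<Longrightarrow> (\<And>x. \<bar>c x\<bar> \<le> Bc) \<Longrightarrow>
      (\<integral>z. (((T_of z / eh (X_of z)) *\<^sub>R (\<phi>l (W_of z) - mu (X_of z))
          + (1 - T_of z / eh (X_of z)) *\<^sub>R r (X_of z)) \<bullet> h) * c (X_of z) \<partial>M)
      = (\<integral>z. (((1 - e (X_of z) / eh (X_of z)) *\<^sub>R r (X_of z)) \<bullet> h) * c (X_of z) \<partial>M)"
begin

definition residual :: "('x \<Rightarrow> real) \<Rightarrow> ('x \<Rightarrow> 'hl) \<Rightarrow> bool \<times> 'x \<times> 'y \<Rightarrow> 'hl" where
  "residual eh mh z = (T_of z / eh (X_of z)) *\<^sub>R (\<phi>l (W_of z) - mh (X_of z)) + mh (X_of z) - mu (X_of z)"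

text \<open>Separates the outcome noise, which is conditionally centred on the treated, from the
  outcome model error.\<close>

lemma residual_eq:
  "residual eh mh z = (T_of z / eh (X_of z)) *\<^sub>R (\<phi>l (W_of z) - mu (X_of z))
      + (1 - T_of z / eh (X_of z)) *\<^sub>R (mh (X_of z) - mu (X_of z))"
  by (simp add: residual_def algebra_simps)

lemma residual_lincomb:
  "residual eh mh z = (T_of z / eh (X_of z)) *\<^sub>R \<phi>l (W_of z)
      + (1 - T_of z / eh (X_of z)) *\<^sub>R mh (X_of z) + (- 1) *\<^sub>R mu (X_of z)"
  by (simp add: residual_def algebra_simps)

lemma kernel_bound: "\<bar>\<phi>k x \<bullet> \<phi>k y\<bar> \<le> B\<^sup>2"
proof -
  have "\<bar>\<phi>k x \<bullet> \<phi>k y\<bar> \<le> norm (\<phi>k x) * norm (\<phi>k y)" by (rule Cauchy_Schwarz_ineq2)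
  also have "\<dots> \<le> B * B" using k_bound order_trans[OF norm_ge_zero k_bound] by (intro mult_mono) auto
  finally show ?thesis by (simp add: power2_eq_square)
qed

text \<open>With \<open>\<rho>\<close> the outcome model error, the residual is at most
  \<open>2 * L / \<delta> + (1 + 1 / \<delta>) * \<rho>\<close> in norm. Squaring this via
  \<open>(p + q)\<^sup>2 \<le> 2 * (p\<^sup>2 + q\<^sup>2)\<close> gives the diagonal constant. The
  conditional mean is at most the propensity error times \<open>\<rho> / \<delta>\<close>, and
  Cauchy-Schwarz gives the product \<open>a * b / \<delta>\<close> off the diagonal.\<close>

lemma residual_moments:
  assumes eh [measurable]: "eh \<in> borel_measurable borel" and \<delta>: "\<And>x. \<delta> < eh x" "0 < \<delta>"
    and mh: "cross_measurable borel borel mh mh" "cross_measurable MY borel \<phi>l mh"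
      "cross_measurable borel borel mu mh" "\<And>h. (\<lambda>x. mh x \<bullet> h) \<in> borel_measurable borel"
      "\<And>h. (\<lambda>x. mu x \<bullet> h) \<in> borel_measurable borel"
    and a: "0 \<le> a" "(\<integral>\<^sup>+x. ennreal ((e x - eh x)\<^sup>2) \<partial>R) \<le> ennreal (a\<^sup>2)"
    and b: "0 \<le> b" "(\<integral>\<^sup>+x. ennreal ((norm (mu x - mh x))\<^sup>2) \<partial>R) \<le> ennreal (b\<^sup>2)"
  defines "g \<equiv> \<lambda>z w. (residual eh mh z \<bullet> residual eh mh w) * (\<phi>k (X_of z) \<bullet> \<phi>k (X_of w))"
  shows "integrable M (\<lambda>z. g z z)"
    and "(\<integral>z. g z z \<partial>M) \<le> B\<^sup>2 * (2 * ((2 * L / \<delta>)\<^sup>2 + (1 + 1 / \<delta>)\<^sup>2 * b\<^sup>2))"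
    and "integrable (M \<Otimes>\<^sub>M M) (\<lambda>(z, w). g z w)"
    and "(\<integral>z. (case z of (z, w) \<Rightarrow> g z w) \<partial>(M \<Otimes>\<^sub>M M)) \<le> B\<^sup>2 * (a * b / \<delta>)\<^sup>2"
proof -
  note [measurable] = X_meas W_meas T_meas e_meas
  define \<rho> where "\<rho> x = norm (mu x - mh x)" for x
  \<comment> \<open>Measurability of the norm is obtained by expanding its square into inner
    products that are jointly measurable.\<close>
  have \<rho>m [measurable]: "\<rho> \<in> borel_measurable borel"
  proof -
    have "(\<lambda>x. mu x \<bullet> mu x - 2 * (mu x \<bullet> mh x) + mh x \<bullet> mh x) \<in> borel_measurable borel"
      using cross_measurable_diag[OF mu_cross(1) measurable_ident measurable_ident]
        cross_measurable_diag[OF mh(3) measurable_ident measurable_ident]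
        cross_measurable_diag[OF mh(1) measurable_ident measurable_ident]
      by simp
    then have "(\<lambda>x. sqrt (mu x \<bullet> mu x - 2 * (mu x \<bullet> mh x) + mh x \<bullet> mh x)) \<in> borel_measurable borel"
      by measurable
    moreover have "\<rho> = (\<lambda>x. sqrt (mu x \<bullet> mu x - 2 * (mu x \<bullet> mh x) + mh x \<bullet> mh x))"
      by (rule ext) (simp add: \<rho>_def norm_eq_sqrt_inner inner_diff_left inner_diff_right inner_commute)
    ultimately show ?thesis by (simp only:)
  qed
  have \<rho>0: "0 \<le> \<rho> x" for x by (simp add: \<rho>_def)
  have B0: "0 \<le> B" using order_trans[OF norm_ge_zero k_bound] .
  have L0: "0 \<le> L" using order_trans[OF norm_ge_zero mu_bound] .
  have transfer: "integrable M (\<lambda>z. (f (X_of z))\<^sup>2) \<and> (\<integral>z. (f (X_of z))\<^sup>2 \<partial>M) \<le> c\<^sup>2"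
    if f [measurable]: "f \<in> borel_measurable borel" and le: "(\<integral>\<^sup>+x. ennreal ((f x)\<^sup>2) \<partial>R) \<le> ennreal (c\<^sup>2)"
    for f :: "'x \<Rightarrow> real" and c
  proof -
    have "(\<integral>\<^sup>+z. ennreal ((f (X_of z))\<^sup>2) \<partial>M) \<le> ennreal (c\<^sup>2)"
      using le unfolding R_law by (subst (asm) nn_integral_distr) auto
    then show ?thesis using integrable_square_of_nn_integral[of "\<lambda>z. f (X_of z)" M c] by simp
  qed
  have \<rho>2: "integrable M (\<lambda>z. (\<rho> (X_of z))\<^sup>2)" "(\<integral>z. (\<rho> (X_of z))\<^sup>2 \<partial>M) \<le> b\<^sup>2"
    using transfer[OF \<rho>m, of b] b(2) by (simp_all add: \<rho>_def)
  have e2: "integrable M (\<lambda>z. (e (X_of z) - eh (X_of z))\<^sup>2)" "(\<integral>z. (e (X_of z) - eh (X_of z))\<^sup>2 \<partial>M) \<le> a\<^sup>2"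
    using transfer[of "\<lambda>x. e x - eh x" a] a(2) by simp_all
  have \<rho>1: "integrable M (\<lambda>z. \<rho> (X_of z))"
  proof (rule Bochner_Integration.integrable_bound)
    show "integrable M (\<lambda>z. 1 + (\<rho> (X_of z))\<^sup>2)" using \<rho>2 by simp
    show "AE z in M. norm (\<rho> (X_of z)) \<le> norm (1 + (\<rho> (X_of z))\<^sup>2)"
    proof (intro AE_I2)
      fix z
      have "0 \<le> (\<rho> (X_of z) - 1)\<^sup>2" by simp
      then have "2 * \<rho> (X_of z) \<le> 1 + (\<rho> (X_of z))\<^sup>2" by (simp add: power2_diff)
      then show "norm (\<rho> (X_of z)) \<le> norm (1 + (\<rho> (X_of z))\<^sup>2)" using \<rho>0[of "X_of z"] by simp
    qed
  qed measurable
  define c1 where "c1 = 2 * L / \<delta>"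
  define c2 where "c2 = 1 + 1 / \<delta>"
  have c12: "0 \<le> c1" "0 \<le> c2" using L0 \<delta>(2) by (auto simp: c1_def c2_def)
  define F where "F z = c1 + c2 * \<rho> (X_of z)" for z :: "bool \<times> 'x \<times> 'y"
  have FI: "integrable M F" unfolding F_def using \<rho>1 by simp
  have Te: "\<bar>T_of z / eh (X_of z)\<bar> \<le> 1 / \<delta>" for z
  proof -
    have "0 < eh (X_of z)" using \<delta>(1)[of "X_of z"] \<delta>(2) by linarith
    moreover have "\<bar>T_of z\<bar> \<le> 1" by (simp add: T_of_def)
    ultimately show ?thesis using \<delta>(1)[of "X_of z"] \<delta>(2)
      unfolding abs_divide by (intro frac_le) auto
  qed
  have Fb: "norm (residual eh mh z) \<le> F z" if z: "z \<in> space M" for z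
  proof -
    have "norm (\<phi>l (W_of z) - mu (X_of z)) \<le> L + L"
      using norm_triangle_ineq4[of "\<phi>l (W_of z)" "mu (X_of z)"] mu_bound[of "X_of z"]
        l_bound[OF measurable_space[OF W_meas z]] by linarith
    then have 1: "\<bar>T_of z / eh (X_of z)\<bar> * norm (\<phi>l (W_of z) - mu (X_of z)) \<le> 1 / \<delta> * (L + L)"
      using Te[of z] \<delta>(2) by (intro mult_mono) auto
    have "\<bar>1 - T_of z / eh (X_of z)\<bar> \<le> c2" using Te[of z] unfolding c2_def by linarith
    then have 2: "\<bar>1 - T_of z / eh (X_of z)\<bar> * norm (mh (X_of z) - mu (X_of z)) \<le> c2 * \<rho> (X_of z)"
      unfolding \<rho>_def norm_minus_commute[of "mh _"] by (intro mult_right_mono) auto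
    have "norm (residual eh mh z) \<le> \<bar>T_of z / eh (X_of z)\<bar> * norm (\<phi>l (W_of z) - mu (X_of z))
        + \<bar>1 - T_of z / eh (X_of z)\<bar> * norm (mh (X_of z) - mu (X_of z))"
      unfolding residual_eq by (rule order_trans[OF norm_triangle_ineq]) simp
    then show ?thesis using 1 2 by (simp add: F_def c1_def)
  qed
  have F2: "(F z)\<^sup>2 \<le> 2 * (c1\<^sup>2 + c2\<^sup>2 * (\<rho> (X_of z))\<^sup>2)" for z
  proof -
    have "0 \<le> (c1 - c2 * \<rho> (X_of z))\<^sup>2" by simp
    then show ?thesis by (simp add: F_def power2_sum power2_diff power_mult_distrib)
  qed
  have F2I: "integrable M (\<lambda>z. 2 * (c1\<^sup>2 + c2\<^sup>2 * (\<rho> (X_of z))\<^sup>2))" using \<rho>2 by simp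
  define m where "m z = (1 - e (X_of z) / eh (X_of z)) *\<^sub>R (mh (X_of z) - mu (X_of z))"
    for z :: "bool \<times> 'x \<times> 'y"
  define H where "H z = 1 / \<delta> * (\<bar>e (X_of z) - eh (X_of z)\<bar> * \<bar>\<rho> (X_of z)\<bar>)"
    for z :: "bool \<times> 'x \<times> 'y"
  have prod: "integrable M (\<lambda>z. \<bar>e (X_of z) - eh (X_of z)\<bar> * \<bar>\<rho> (X_of z)\<bar>)"
    "(\<integral>z. \<bar>e (X_of z) - eh (X_of z)\<bar> * \<bar>\<rho> (X_of z)\<bar> \<partial>M) \<le> a * b"
    by (rule integral_mult_le_of_squares[OF _ _ e2 a(1) \<rho>2 b(1)]; measurable)+
  have HI: "integrable M H" unfolding H_def using prod by simp
  have Hle: "(\<integral>z. H z \<partial>M) \<le> a * b / \<delta>"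
    unfolding H_def using prod(2) \<delta>(2) by (simp add: divide_right_mono)
  have Hpos: "0 \<le> (\<integral>z. H z \<partial>M)" using \<delta>(2) by (intro Bochner_Integration.integral_nonneg) (auto simp: H_def)
  have Hb: "norm (m z) \<le> H z" for z
  proof -
    have p: "0 < eh (X_of z)" using \<delta>(1)[of "X_of z"] \<delta>(2) by linarith
    have "1 - e (X_of z) / eh (X_of z) = (eh (X_of z) - e (X_of z)) / eh (X_of z)"
      using p by (simp add: field_simps)
    then have "\<bar>1 - e (X_of z) / eh (X_of z)\<bar> = \<bar>e (X_of z) - eh (X_of z)\<bar> / eh (X_of z)"
      using p by (simp add: abs_minus_commute)
    also have "\<dots> \<le> \<bar>e (X_of z) - eh (X_of z)\<bar> / \<delta>"
      using \<delta>(1)[of "X_of z"] \<delta>(2) p by (intro divide_left_mono) auto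
    finally have "\<bar>1 - e (X_of z) / eh (X_of z)\<bar> * \<rho> (X_of z) \<le> \<bar>e (X_of z) - eh (X_of z)\<bar> / \<delta> * \<rho> (X_of z)"
      using \<rho>0 by (intro mult_right_mono)
    then show ?thesis using \<rho>0[of "X_of z"]
      by (simp add: m_def H_def \<rho>_def norm_minus_commute[of "mh _"])
  qed
  note XX = cross_measurable_compose[OF _ X_meas X_meas]
  have feat: "cross_measurable M M (\<lambda>z. \<phi>l (W_of z)) (\<lambda>z. \<phi>l (W_of z))"
    "cross_measurable M M (\<lambda>z. \<phi>l (W_of z)) (\<lambda>z. mh (X_of z))"
    "cross_measurable M M (\<lambda>z. \<phi>l (W_of z)) (\<lambda>z. mu (X_of z))"
    "cross_measurable M M (\<lambda>z. mh (X_of z)) (\<lambda>z. mh (X_of z))"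
    "cross_measurable M M (\<lambda>z. mh (X_of z)) (\<lambda>z. mu (X_of z))"
    "cross_measurable M M (\<lambda>z. mu (X_of z)) (\<lambda>z. mu (X_of z))"
    using cross_measurable_compose[OF l_cross W_meas W_meas] cross_measurable_compose[OF mh(2) W_meas X_meas]
      cross_measurable_compose[OF mu_cross(2) W_meas X_meas] XX[OF mh(1)]
      XX[OF cross_measurable_commute[OF mh(3)]] XX[OF mu_cross(1)] by blast+
  have sm: "(\<lambda>z. T_of z / eh (X_of z)) \<in> borel_measurable M" "(\<lambda>z. 1 - T_of z / eh (X_of z)) \<in> borel_measurable M"
    "(\<lambda>z. - 1 :: real) \<in> borel_measurable M" "(\<lambda>z. 0 :: real) \<in> borel_measurable M"
    "(\<lambda>z. 1 - e (X_of z) / eh (X_of z)) \<in> borel_measurable M"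
    "(\<lambda>z. - (1 - e (X_of z) / eh (X_of z))) \<in> borel_measurable M"
    by measurable
  have res: "residual eh mh = (\<lambda>z. (T_of z / eh (X_of z)) *\<^sub>R \<phi>l (W_of z)
      + (1 - T_of z / eh (X_of z)) *\<^sub>R mh (X_of z) + (- 1) *\<^sub>R mu (X_of z))"
    using residual_lincomb by blast
  \<comment> \<open>The zero coefficient brings \<open>m\<close> into the same three-feature form as
    the residual.\<close>
  have mres: "m = (\<lambda>z. 0 *\<^sub>R \<phi>l (W_of z) + (1 - e (X_of z) / eh (X_of z)) *\<^sub>R mh (X_of z)
      + (- (1 - e (X_of z) / eh (X_of z))) *\<^sub>R mu (X_of z))"
    by (rule ext) (simp only: m_def scaleR_diff_right scaleR_minus_left scaleR_zero_left add_0 diff_conv_add_uminus[of "_ *\<^sub>R _"])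
  have cm: "cross_measurable M M (residual eh mh) (residual eh mh)"
    "cross_measurable M M (residual eh mh) m" "cross_measurable M M m m"
    unfolding res mres by (intro cross_measurable_lincomb3 sm feat)+
  define K where "K z w = \<phi>k (X_of z) \<bullet> \<phi>k (X_of w)" for z w :: "bool \<times> 'x \<times> 'y"
  have Km: "(\<lambda>(z, w). K z w) \<in> borel_measurable (M \<Otimes>\<^sub>M M)"
    using XX[OF k_cross] by (simp add: cross_measurable_def K_def)
  \<comment> \<open>For fixed \<open>w\<close>, \<open>K z w\<close> is a bounded function of the
    covariate of \<open>z\<close>, hence an admissible multiplier in
    \<open>residual_mean\<close>.\<close>
  have key: "(\<integral>z. (residual eh mh z \<bullet> h) * K z w \<partial>M) = (\<integral>z. (m z \<bullet> h) * K z w \<partial>M)" for h w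
  proof -
    define r where "r x = mh x - mu x" for x
    have rm: "(\<lambda>x. r x \<bullet> h) \<in> borel_measurable borel"
      using mh(4)[of h] mh(5)[of h] by (simp add: r_def inner_diff_left)
    have ri: "integrable M (\<lambda>z. r (X_of z) \<bullet> h)"
    proof (rule Bochner_Integration.integrable_bound)
      show "integrable M (\<lambda>z. \<rho> (X_of z) * norm h)" using \<rho>1 by simp
      show "AE z in M. norm (r (X_of z) \<bullet> h) \<le> norm (\<rho> (X_of z) * norm h)"
        using Cauchy_Schwarz_ineq2 by (intro AE_I2) (simp add: r_def \<rho>_def norm_minus_commute[of "mu _"])
      show "(\<lambda>z. r (X_of z) \<bullet> h) \<in> borel_measurable M" by (rule measurable_compose[OF X_meas rm])
    qed
    have km: "(\<lambda>x. \<phi>k x \<bullet> \<phi>k (X_of w)) \<in> borel_measurable borel"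
      using k_weak[of "\<phi>k (X_of w)"] by (simp add: inner_commute)
    show ?thesis
      using residual_mean[OF rm ri eh \<delta> km kernel_bound]
      by (simp add: residual_eq K_def m_def r_def)
  qed
  have geq: "g = (\<lambda>z w. (residual eh mh z \<bullet> residual eh mh w) * K z w)"
    by (simp add: g_def K_def fun_eq_iff)
  have KB: "\<bar>K z w\<bar> \<le> B\<^sup>2" and Ks: "K z w = K w z" for z w
    by (simp_all add: K_def kernel_bound inner_commute)
  show "integrable (M \<Otimes>\<^sub>M M) (\<lambda>(z, w). g z w)"
    unfolding geq by (rule off_diagonal_bound(1)[OF cm Km KB Ks FI Fb HI Hb key])
  have "(\<integral>z. (case z of (z, w) \<Rightarrow> g z w) \<partial>(M \<Otimes>\<^sub>M M)) \<le> B\<^sup>2 * (\<integral>z. H z \<partial>M)\<^sup>2"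
    unfolding geq by (rule off_diagonal_bound(2)[OF cm Km KB Ks FI Fb HI Hb key])
  also have "\<dots> \<le> B\<^sup>2 * (a * b / \<delta>)\<^sup>2"
    using Hle Hpos by (intro mult_left_mono power_mono) auto
  finally show "(\<integral>z. (case z of (z, w) \<Rightarrow> g z w) \<partial>(M \<Otimes>\<^sub>M M)) \<le> B\<^sup>2 * (a * b / \<delta>)\<^sup>2" .
  have gb: "\<bar>g z z\<bar> \<le> B\<^sup>2 * (2 * (c1\<^sup>2 + c2\<^sup>2 * (\<rho> (X_of z))\<^sup>2))" if z: "z \<in> space M" for z
  proof -
    have "residual eh mh z \<bullet> residual eh mh z \<le> (F z)\<^sup>2"
      using Fb[OF z] by (simp add: dot_square_norm power_mono)
    then have "(residual eh mh z \<bullet> residual eh mh z) * \<bar>K z z\<bar> \<le> 2 * (c1\<^sup>2 + c2\<^sup>2 * (\<rho> (X_of z))\<^sup>2) * B\<^sup>2"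
      using F2[of z] KB[of z z] by (intro mult_mono) auto
    then show ?thesis by (simp add: geq abs_mult mult.commute)
  qed
  have gm: "(\<lambda>z. g z z) \<in> borel_measurable M"
    unfolding geq K_def
    by (intro borel_measurable_times cross_measurable_diag[OF cm(1) measurable_ident measurable_ident, simplified]
        cross_measurable_diag[OF k_cross X_meas X_meas])
  show gi: "integrable M (\<lambda>z. g z z)"
    by (rule Bochner_Integration.integrable_bound[OF integrable_mult_right[OF F2I, of "B\<^sup>2"] gm])
      (use gb in \<open>auto intro!: AE_I2 order_trans[OF _ abs_ge_self]\<close>)
  have "(\<integral>z. g z z \<partial>M) \<le> (\<integral>z. B\<^sup>2 * (2 * (c1\<^sup>2 + c2\<^sup>2 * (\<rho> (X_of z))\<^sup>2)) \<partial>M)"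
    using gi integrable_mult_right[OF F2I, of "B\<^sup>2"] order_trans[OF abs_ge_self gb]
    by (intro integral_mono) auto
  also have "\<dots> = B\<^sup>2 * (2 * (c1\<^sup>2 + c2\<^sup>2 * (\<integral>z. (\<rho> (X_of z))\<^sup>2 \<partial>M)))"
    using \<rho>2 by (simp add: prob_space)
  also have "\<dots> \<le> B\<^sup>2 * (2 * (c1\<^sup>2 + c2\<^sup>2 * b\<^sup>2))"
    using \<rho>2(2) by (intro mult_left_mono add_left_mono) auto
  finally show "(\<integral>z. g z z \<partial>M) \<le> B\<^sup>2 * (2 * ((2 * L / \<delta>)\<^sup>2 + (1 + 1 / \<delta>)\<^sup>2 * b\<^sup>2))"
    by (simp add: c1_def c2_def)
qed

text \<open>\<open>\<xi>\<close> is centred, since \<open>Cu\<close> is the mean of its first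
  summand. The off-diagonal bound with conditional mean 0 and constant kernel 1 therefore gives 0;
  the diagonal constant comes from
  \<open>norm (\<xi> z) \<le> 2 * B\<^sup>2 * norm u\<close>.\<close>

lemma covariance_moments:
  assumes Cu: "\<And>h. Cu \<bullet> h = (\<integral>x. (u \<bullet> \<phi>k x) * (h \<bullet> \<phi>k x) \<partial>R)" and nCu: "norm Cu \<le> B\<^sup>2 * norm u"
  defines "\<xi> \<equiv> \<lambda>z. (\<phi>k (X_of z) \<bullet> u) *\<^sub>R \<phi>k (X_of z) - Cu"
  shows "cross_measurable M M \<xi> \<xi>"
    and "integrable M (\<lambda>z. \<xi> z \<bullet> \<xi> z)" and "(\<integral>z. \<xi> z \<bullet> \<xi> z \<partial>M) \<le> (2 * B\<^sup>2 * norm u)\<^sup>2"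
    and "integrable (M \<Otimes>\<^sub>M M) (\<lambda>(z, w). \<xi> z \<bullet> \<xi> w)"
    and "(\<integral>z. (case z of (z, w) \<Rightarrow> \<xi> z \<bullet> \<xi> w) \<partial>(M \<Otimes>\<^sub>M M)) \<le> 0"
proof -
  note [measurable] = X_meas
  have B0: "0 \<le> B" using order_trans[OF norm_ge_zero k_bound] .
  have wk: "(\<lambda>z. \<phi>k (X_of z) \<bullet> h) \<in> borel_measurable M" for h
    using measurable_compose[OF X_meas k_weak[of h]] by (simp add: inner_commute)
  have c\<phi>: "cross_measurable M M (\<lambda>z. \<phi>k (X_of z)) (\<lambda>z. \<phi>k (X_of z))"
    by (rule cross_measurable_compose[OF k_cross X_meas X_meas])
  have cc: "cross_measurable M M (\<lambda>z. \<phi>k (X_of z)) (\<lambda>z. Cu)"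
    unfolding cross_measurable_def using measurable_compose[OF measurable_fst wk[of Cu]]
    by (simp add: split_beta')
  have c0: "cross_measurable M M (\<lambda>z. Cu) (\<lambda>z. Cu)" by (simp add: cross_measurable_def)
  have "cross_measurable M M (\<lambda>z. (\<phi>k (X_of z) \<bullet> u) *\<^sub>R \<phi>k (X_of z) + (- 1) *\<^sub>R Cu + 0 *\<^sub>R Cu)
      (\<lambda>z. (\<phi>k (X_of z) \<bullet> u) *\<^sub>R \<phi>k (X_of z) + (- 1) *\<^sub>R Cu + 0 *\<^sub>R Cu)"
    by (intro cross_measurable_lincomb3 wk borel_measurable_const c\<phi> cc c0)
  then show cm: "cross_measurable M M \<xi> \<xi>" by (simp add: \<xi>_def)
  have nb: "norm (\<xi> z) \<le> 2 * B\<^sup>2 * norm u" for z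
  proof -
    have "\<bar>\<phi>k (X_of z) \<bullet> u\<bar> \<le> B * norm u"
      using Cauchy_Schwarz_ineq2[of "\<phi>k (X_of z)" u] k_bound[of "X_of z"]
      by (meson mult_right_mono norm_ge_zero order_trans)
    then have "\<bar>\<phi>k (X_of z) \<bullet> u\<bar> * norm (\<phi>k (X_of z)) \<le> (B * norm u) * B"
      using k_bound[of "X_of z"] B0 by (intro mult_mono) auto
    then show ?thesis
      using norm_triangle_ineq4[of "(\<phi>k (X_of z) \<bullet> u) *\<^sub>R \<phi>k (X_of z)" Cu] nCu
      by (simp add: \<xi>_def power2_eq_square mult_ac)
  qed
  have mean: "(\<integral>z. (\<xi> z \<bullet> h) * 1 \<partial>M) = (\<integral>z. ((\<lambda>_. 0) z \<bullet> h) * 1 \<partial>M)" for h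
  proof -
    have mm: "(\<lambda>x. (u \<bullet> \<phi>k x) * (h \<bullet> \<phi>k x)) \<in> borel_measurable borel"
      using k_weak by (intro borel_measurable_times)
    have le: "\<bar>(u \<bullet> \<phi>k x) * (h \<bullet> \<phi>k x)\<bar> \<le> (norm u * B) * (norm h * B)" for x
      unfolding abs_mult
      using order_trans[OF Cauchy_Schwarz_ineq2 mult_left_mono[OF k_bound[of x] norm_ge_zero]] B0
      by (intro mult_mono) auto
    have i: "integrable M (\<lambda>z. (u \<bullet> \<phi>k (X_of z)) * (h \<bullet> \<phi>k (X_of z)))"
      by (rule integrable_const_bound[where B = "(norm u * B) * (norm h * B)"])
        (use le measurable_compose[OF X_meas mm] in auto)
    have "(\<integral>z. (\<xi> z \<bullet> h) * 1 \<partial>M) = (\<integral>z. (u \<bullet> \<phi>k (X_of z)) * (h \<bullet> \<phi>k (X_of z)) - Cu \<bullet> h \<partial>M)"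
      by (intro Bochner_Integration.integral_cong refl) (simp add: \<xi>_def inner_diff_left inner_commute[of "\<phi>k _" u] inner_commute[of "\<phi>k _" h])
    also have "\<dots> = (\<integral>z. (u \<bullet> \<phi>k (X_of z)) * (h \<bullet> \<phi>k (X_of z)) \<partial>M) - Cu \<bullet> h"
      using i by (simp add: prob_space)
    also have "\<dots> = 0" unfolding Cu R_law using integral_distr[OF X_meas mm] by simp
    finally show ?thesis by simp
  qed
  have z0: "cross_measurable M M \<xi> (\<lambda>_. 0)" "cross_measurable M M (\<lambda>_. 0 :: 'hk) (\<lambda>_. 0)"
    by (simp_all add: cross_measurable_def)
  have FI: "integrable M (\<lambda>_. 2 * B\<^sup>2 * norm u)" "integrable M (\<lambda>_. 0 :: real)" by simp_all
  have nz: "norm ((\<lambda>_. 0 :: 'hk) z) \<le> 0" for z :: "bool \<times> 'x \<times> 'y" by simp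
  note off = off_diagonal_bound[OF cm z0, where K = "\<lambda>_ _. 1" and B = 1, OF _ _ _ FI(1) nb FI(2) nz mean]
  show "integrable (M \<Otimes>\<^sub>M M) (\<lambda>(z, w). \<xi> z \<bullet> \<xi> w)" using off(1) by simp
  show "(\<integral>z. (case z of (z, w) \<Rightarrow> \<xi> z \<bullet> \<xi> w) \<partial>(M \<Otimes>\<^sub>M M)) \<le> 0" using off(2) by simp
  have sq: "\<xi> z \<bullet> \<xi> z \<le> (2 * B\<^sup>2 * norm u)\<^sup>2" for z
    unfolding dot_square_norm using nb by (intro power_mono) auto
  show i: "integrable M (\<lambda>z. \<xi> z \<bullet> \<xi> z)"
    by (rule integrable_const_bound[where B = "(2 * B\<^sup>2 * norm u)\<^sup>2"])
      (use sq cross_measurable_diag[OF cm measurable_ident measurable_ident] in auto)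
  have "(\<integral>z. \<xi> z \<bullet> \<xi> z \<partial>M) \<le> (\<integral>z. (2 * B\<^sup>2 * norm u)\<^sup>2 \<partial>M)"
    using i sq by (intro integral_mono) auto
  then show "(\<integral>z. \<xi> z \<bullet> \<xi> z \<partial>M) \<le> (2 * B\<^sup>2 * norm u)\<^sup>2" by (simp add: prob_space)
qed

end

section \<open>Tail bounds for the two V-statistics\<close>

text \<open>On the set \<open>G\<close> of training outcomes with model errors at most
  \<open>a\<close> and \<open>b\<close>, the moments of the residual are controlled for each frozen
  outcome, so Markov's inequality applies conditionally. Most of the work is measurability jointly
  in the training outcome and the test sample.\<close>

lemma (in dr_model) residual_tail:
  fixes S :: "'w \<Rightarrow> 's" and D :: "nat \<Rightarrow> 'w \<Rightarrow> bool \<times> 'x \<times> 'y"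
  assumes Pr: "prob_space Pr" and S: "S \<in> measurable Pr N"
    and eh: "(\<lambda>(s, x). eh s x) \<in> borel_measurable (N \<Otimes>\<^sub>M borel)"
    and mh: "strongly_measurable (N \<Otimes>\<^sub>M borel) (\<lambda>(s, x). mh s x)"
    and muw: "\<And>h. (\<lambda>x. mu x \<bullet> h) \<in> borel_measurable borel"
    and lw: "\<And>h. (\<lambda>y. \<phi>l y \<bullet> h) \<in> borel_measurable MY"
    and iv: "prob_space.indep_vars Pr (\<lambda>_. M) D {..<n}"
    and law: "\<And>i. i < n \<Longrightarrow> distr Pr M (D i) = M"
    and ind: "prob_space.indep_set Pr (sets (vimage_algebra (space Pr) S N))
      (sets (vimage_algebra (space Pr) (\<lambda>\<omega>. \<lambda>i\<in>{..<n}. D i \<omega>) (Pi\<^sub>M {..<n} (\<lambda>_. M))))"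
    and \<delta>: "\<And>s x. s \<in> space N \<Longrightarrow> \<delta> < eh s x" "0 < \<delta>"
    and n: "0 < n" and ab: "0 \<le> a" "0 \<le> b" and t: "0 < t"
  shows "\<exists>A\<in>sets Pr. {\<omega>\<in>space Pr.
      (\<integral>\<^sup>+x. ennreal ((e x - eh (S \<omega>) x)\<^sup>2) \<partial>R) \<le> ennreal (a\<^sup>2) \<and>
      (\<integral>\<^sup>+x. ennreal ((norm (mu x - mh (S \<omega>) x))\<^sup>2) \<partial>R) \<le> ennreal (b\<^sup>2) \<and>
      t * (real n * (B\<^sup>2 * (2 * ((2 * L / \<delta>)\<^sup>2 + (1 + 1 / \<delta>)\<^sup>2 * b\<^sup>2)) + 1)
          + (real n)\<^sup>2 * (B\<^sup>2 * (a * b / \<delta>)\<^sup>2))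
        < (\<Sum>i<n. \<Sum>j<n. (residual (eh (S \<omega>)) (mh (S \<omega>)) (D i \<omega>) \<bullet> residual (eh (S \<omega>)) (mh (S \<omega>)) (D j \<omega>))
            * (\<phi>k (X_of (D i \<omega>)) \<bullet> \<phi>k (X_of (D j \<omega>))))} \<subseteq> A \<and> measure Pr A \<le> 1 / t"
    (is "\<exists>A\<in>_. ?E \<subseteq> A \<and> _")
proof -
  let ?P = "N \<Otimes>\<^sub>M M"
  let ?B = "N \<Otimes>\<^sub>M borel"
  interpret Pr: prob_space Pr by fact
  note [measurable] = X_meas W_meas T_meas e_meas
  have Rs: "sets R = sets borel" by (simp add: R_law)
  interpret R: prob_space R unfolding R_law by (rule prob_space_distr[OF X_meas])
  \<comment> \<open>The fitted mean as one map of the pair of training outcome and covariate, so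
    that cross-measurability applies to it as to any other feature.\<close>
  define mh' where "mh' p = mh (fst p) (snd p)" for p
  have mh': "strongly_measurable ?B mh'" using mh by (simp add: mh'_def[abs_def] split_beta')
  have eh' [measurable]: "(\<lambda>p. eh (fst p) (snd p)) \<in> borel_measurable ?B"
    using eh by (simp add: split_beta')
  have mhw: "(\<lambda>p. h \<bullet> mh' p) \<in> borel_measurable ?B" for h
    by (rule approximable_inner_measurable[OF strongly_measurable_approximable[OF mh']])
  have c_mm: "cross_measurable ?B ?B mh' mh'"
    by (rule cross_measurable_strongly[OF mh' mhw])
  have c_mu: "cross_measurable borel ?B mu mh'"
    by (rule cross_measurable_commute[OF cross_measurable_strongly[OF mh']])
      (use muw in \<open>simp add: inner_commute\<close>)
  have c_lm: "cross_measurable MY ?B \<phi>l mh'"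
    by (rule cross_measurable_commute[OF cross_measurable_strongly[OF mh']])
      (use lw in \<open>simp add: inner_commute\<close>)
  define G where "G = {s\<in>space N. (\<integral>\<^sup>+x. ennreal ((e x - eh s x)\<^sup>2) \<partial>R) \<le> ennreal (a\<^sup>2) \<and>
      (\<integral>\<^sup>+x. ennreal ((norm (mu x - mh s x))\<^sup>2) \<partial>R) \<le> ennreal (b\<^sup>2)}"
  have G: "G \<in> sets N"
  proof -
    have 1: "(\<lambda>p. ennreal ((e (snd p) - eh (fst p) (snd p))\<^sup>2)) \<in> borel_measurable (N \<Otimes>\<^sub>M R)"
      unfolding measurable_cong_sets[OF sets_pair_measure_cong[OF refl Rs] refl] by measurable
    have "(\<lambda>p. mu (snd p) \<bullet> mu (snd p) - 2 * (mu (snd p) \<bullet> mh' p) + mh' p \<bullet> mh' p)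
        \<in> borel_measurable ?B"
      by (intro borel_measurable_add borel_measurable_diff borel_measurable_times borel_measurable_const
          cross_measurable_diag[OF mu_cross(1) measurable_snd measurable_snd]
          cross_measurable_diag[OF c_mu measurable_snd measurable_ident, simplified]
          cross_measurable_diag[OF c_mm measurable_ident measurable_ident, simplified])
    moreover have "mu (snd p) \<bullet> mu (snd p) - 2 * (mu (snd p) \<bullet> mh' p) + mh' p \<bullet> mh' p
        = (norm (mu (snd p) - mh (fst p) (snd p)))\<^sup>2" for p
      by (simp add: mh'_def power2_norm_eq_inner inner_diff_left inner_diff_right inner_commute)
    ultimately have "(\<lambda>p. (norm (mu (snd p) - mh (fst p) (snd p)))\<^sup>2) \<in> borel_measurable ?B"
      by simp
    then have 2: "(\<lambda>p. ennreal ((norm (mu (snd p) - mh (fst p) (snd p)))\<^sup>2)) \<in> borel_measurable (N \<Otimes>\<^sub>M R)"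
      unfolding measurable_cong_sets[OF sets_pair_measure_cong[OF refl Rs] refl] by measurable
    note [measurable] = R.borel_measurable_nn_integral_fst[OF 1, simplified]
      R.borel_measurable_nn_integral_fst[OF 2, simplified]
    show ?thesis unfolding G_def by measurable
  qed
  define \<epsilon> where "\<epsilon> p = residual (eh (fst p)) (mh (fst p)) (snd p)" for p
  have c\<epsilon>: "cross_measurable ?P ?P \<epsilon> \<epsilon>"
  proof -
    have q [measurable]: "(\<lambda>p. (fst p, X_of (snd p))) \<in> measurable ?P ?B" by measurable
    have Xs: "(\<lambda>p. X_of (snd p)) \<in> measurable ?P borel"
      and Ws: "(\<lambda>p. W_of (snd p)) \<in> measurable ?P MY" by measurable
    have ehq: "(\<lambda>p. eh (fst p) (X_of (snd p))) \<in> borel_measurable ?P"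
      using measurable_compose[OF q eh'] by simp
    note [measurable] = ehq
    let ?f = "\<lambda>p. (T_of (snd p) / eh (fst p) (X_of (snd p))) *\<^sub>R \<phi>l (W_of (snd p))
        + (1 - T_of (snd p) / eh (fst p) (X_of (snd p))) *\<^sub>R mh' (fst p, X_of (snd p))
        + (- 1) *\<^sub>R mu (X_of (snd p))"
    have "cross_measurable ?P ?P ?f ?f"
      by (rule cross_measurable_lincomb3[OF _ _ _ _ _ _
            cross_measurable_compose[OF l_cross Ws Ws] cross_measurable_compose[OF c_lm Ws q]
            cross_measurable_compose[OF mu_cross(2) Ws Xs] cross_measurable_compose[OF c_mm q q]
            cross_measurable_compose[OF cross_measurable_commute[OF c_mu] q Xs]
            cross_measurable_compose[OF mu_cross(1) Xs Xs]]) measurable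
    then show ?thesis by (simp add: \<epsilon>_def[abs_def] residual_lincomb mh'_def)
  qed
  define g where "g s z w = (residual (eh s) (mh s) z \<bullet> residual (eh s) (mh s) w) * (\<phi>k (X_of z) \<bullet> \<phi>k (X_of w))"
    for s z w
  \<comment> \<open>Stated for arbitrary measurable choices \<open>p\<close> and \<open>p'\<close>
    of a test point, in order to cover the coordinates of the product space.\<close>
  have gm: "(\<lambda>q. g (fst q) (p q) (p' q)) \<in> borel_measurable (N \<Otimes>\<^sub>M L')"
    if "p \<in> measurable (N \<Otimes>\<^sub>M L') M" "p' \<in> measurable (N \<Otimes>\<^sub>M L') M" for p p' and L' :: "'z measure"
  proof -
    have "(\<lambda>q. (fst q, p q)) \<in> measurable (N \<Otimes>\<^sub>M L') ?P"
      "(\<lambda>q. (fst q, p' q)) \<in> measurable (N \<Otimes>\<^sub>M L') ?P" using that by measurable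
    from cross_measurable_diag[OF c\<epsilon> this]
      cross_measurable_diag[OF k_cross measurable_compose[OF that(1) X_meas] measurable_compose[OF that(2) X_meas]]
    show ?thesis unfolding g_def \<epsilon>_def by simp
  qed
  have mom: "integrable M (\<lambda>z. g s z z)" (is ?thesis1)
      "(\<integral>z. g s z z \<partial>M) \<le> B\<^sup>2 * (2 * ((2 * L / \<delta>)\<^sup>2 + (1 + 1 / \<delta>)\<^sup>2 * b\<^sup>2))" (is ?thesis2)
      "integrable (M \<Otimes>\<^sub>M M) (\<lambda>(z, w). g s z w)" (is ?thesis3)
      "(\<integral>z. (case z of (z, w) \<Rightarrow> g s z w) \<partial>(M \<Otimes>\<^sub>M M)) \<le> B\<^sup>2 * (a * b / \<delta>)\<^sup>2" (is ?thesis4)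
    if s: "s \<in> G" for s
  proof -
    have sN: "s \<in> space N" using s by (simp add: G_def)
    have ps: "Pair s \<in> measurable borel ?B" using sN by (rule measurable_Pair1')
    have ehs: "eh s \<in> borel_measurable borel" using measurable_compose[OF ps eh'] by simp
    note m = residual_moments[of "eh s" \<delta> "mh s" a b, OF ehs \<delta>(1)[OF sN] \<delta>(2)
        cross_measurable_compose[OF c_mm ps ps, unfolded mh'_def, simplified]
        cross_measurable_compose[OF c_lm measurable_ident ps, unfolded mh'_def, simplified]
        cross_measurable_compose[OF c_mu measurable_ident ps, unfolded mh'_def, simplified]
        _ muw ab(1) _ ab(2) _, folded g_def]
    have w: "(\<lambda>x. mh s x \<bullet> h) \<in> borel_measurable borel" for h
      using measurable_compose[OF ps mhw[of h]] by (simp add: mh'_def inner_commute)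
    from m[OF w] s show ?thesis1 ?thesis2 ?thesis3 ?thesis4
      by (auto simp: G_def)
  qed
  define Z where "Z \<omega> = (\<lambda>i\<in>{..<n}. D i \<omega>)" for \<omega>
  define V where "V s d = (\<Sum>i<n. \<Sum>j<n. g s (d i) (d j))" for s d
  have VZ: "V s (Z \<omega>) = (\<Sum>i<n. \<Sum>j<n. g s (D i \<omega>) (D j \<omega>))" for s \<omega>
    unfolding V_def Z_def by (intro sum.cong) auto
  have Dm: "D i \<in> measurable Pr M" if "i < n" for i
    using iv that by (simp add: Pr.indep_vars_def)
  have Zm: "Z \<in> measurable Pr (Pi\<^sub>M {..<n} (\<lambda>_. M))"
    unfolding Z_def by (rule measurable_restrict) (simp add: Dm)
  \<comment> \<open>The summand 1 keeps the threshold positive, as Markov's inequality requires,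
    even if all other constants vanish.\<close>
  define c where "c = real n * (B\<^sup>2 * (2 * ((2 * L / \<delta>)\<^sup>2 + (1 + 1 / \<delta>)\<^sup>2 * b\<^sup>2)) + 1)
          + (real n)\<^sup>2 * (B\<^sup>2 * (a * b / \<delta>)\<^sup>2)"
  have c0: "0 < c" unfolding c_def using n by (intro add_pos_nonneg mult_pos_pos add_nonneg_pos) auto
  have mom2: "(\<integral>z. g s z z \<partial>M) \<le> B\<^sup>2 * (2 * ((2 * L / \<delta>)\<^sup>2 + (1 + 1 / \<delta>)\<^sup>2 * b\<^sup>2)) + 1" if "s \<in> G" for s
    using mom(2)[OF that] by simp
  have "\<exists>A\<in>sets Pr. {\<omega>\<in>space Pr. S \<omega> \<in> G \<and> t * c < V (S \<omega>) (Z \<omega>)} \<subseteq> A \<and> measure Pr A \<le> 1 / t"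
  proof (rule Pr.markov_given_independent[OF S Zm _ G])
    show "Pr.indep_set (sets (vimage_algebra (space Pr) S N)) (sets (vimage_algebra (space Pr) Z (Pi\<^sub>M {..<n} (\<lambda>_. M))))"
      using ind unfolding Z_def .
    show "(\<lambda>(s, d). V s d) \<in> borel_measurable (N \<Otimes>\<^sub>M Pi\<^sub>M {..<n} (\<lambda>_. M))"
    proof -
      have "(\<lambda>q. snd q i) \<in> measurable (N \<Otimes>\<^sub>M Pi\<^sub>M {..<n} (\<lambda>_. M)) M" if "i \<in> {..<n}" for i
        using that by measurable
      then show ?thesis unfolding V_def split_beta' by (intro borel_measurable_sum gm) auto
    qed
    show "integrable Pr (\<lambda>\<omega>. V s (Z \<omega>))" if "s \<in> G" for s
      unfolding VZ by (rule Pr.v_statistic_expectation(1)[OF iv law mom(1) mom2 mom(3) mom(4)]) (use that in auto)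
    show "(\<integral>\<omega>. V s (Z \<omega>) \<partial>Pr) \<le> c" if "s \<in> G" for s
      unfolding VZ c_def by (rule Pr.v_statistic_expectation(2)[OF iv law mom(1) mom2 mom(3) mom(4)]) (use that in auto)
    show "0 \<le> V s d" for s d
      unfolding V_def g_def by (rule schur_product_nonneg) simp
  qed (use c0 t in auto)
  then obtain A where A: "A \<in> sets Pr" "measure Pr A \<le> 1 / t"
    "{\<omega>\<in>space Pr. S \<omega> \<in> G \<and> t * c < V (S \<omega>) (Z \<omega>)} \<subseteq> A" by blast
  show ?thesis
  proof (intro bexI conjI)
    show "?E \<subseteq> A"
      using A(3) measurable_space[OF S] by (auto simp: G_def VZ g_def c_def)
  qed (use A in auto)
qed

lemma (in dr_model) covariance_tail:
  fixes D :: "nat \<Rightarrow> 'w \<Rightarrow> bool \<times> 'x \<times> 'y"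
  assumes Pr: "prob_space Pr"
    and iv: "prob_space.indep_vars Pr (\<lambda>_. M) D {..<n}"
    and law: "\<And>i. i < n \<Longrightarrow> distr Pr M (D i) = M"
    and Cu: "\<And>h. Cu \<bullet> h = (\<integral>x. (u \<bullet> \<phi>k x) * (h \<bullet> \<phi>k x) \<partial>R)" "norm Cu \<le> B\<^sup>2 * norm u"
    and n: "0 < n" and t: "0 < t"
  defines "\<xi> \<equiv> \<lambda>z. (\<phi>k (X_of z) \<bullet> u) *\<^sub>R \<phi>k (X_of z) - Cu"
  shows "\<exists>A\<in>sets Pr. {\<omega>\<in>space Pr. t * (real n * ((2 * B\<^sup>2 * norm u)\<^sup>2 + 1))
      < (\<Sum>i<n. \<Sum>j<n. \<xi> (D i \<omega>) \<bullet> \<xi> (D j \<omega>))} \<subseteq> A \<and> measure Pr A \<le> 1 / t"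
proof -
  interpret Pr: prob_space Pr by fact
  have m2: "integrable M (\<lambda>z. \<xi> z \<bullet> \<xi> z)" unfolding \<xi>_def by (rule covariance_moments(2)[OF Cu])
  have m3: "(\<integral>z. \<xi> z \<bullet> \<xi> z \<partial>M) \<le> (2 * B\<^sup>2 * norm u)\<^sup>2 + 1"
    unfolding \<xi>_def using covariance_moments(3)[OF Cu] by simp
  have m4: "integrable (M \<Otimes>\<^sub>M M) (\<lambda>(z, w). \<xi> z \<bullet> \<xi> w)"
    "(\<integral>z. (case z of (z, w) \<Rightarrow> \<xi> z \<bullet> \<xi> w) \<partial>(M \<Otimes>\<^sub>M M)) \<le> 0"
    unfolding \<xi>_def by (rule covariance_moments(4,5)[OF Cu])+
  define V where "V \<omega> = (\<Sum>i<n. \<Sum>j<n. \<xi> (D i \<omega>) \<bullet> \<xi> (D j \<omega>))" for \<omega>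
  define c where "c = real n * ((2 * B\<^sup>2 * norm u)\<^sup>2 + 1)"
  have c0: "0 < c" unfolding c_def using n by (intro mult_pos_pos add_nonneg_pos) auto
  note v = Pr.v_statistic_expectation[OF iv law m2 m3 m4 order_refl]
  have i: "integrable Pr V" using v(1) by (simp add: V_def[abs_def])
  have E: "(\<integral>\<omega>. V \<omega> \<partial>Pr) \<le> c" using v(2) by (simp add: V_def[abs_def] c_def)
  have V0: "0 \<le> V \<omega>" for \<omega>
    using schur_product_nonneg[of "{..<n}" "\<lambda>i. \<xi> (D i \<omega>)" "\<lambda>_. 1::real"] by (simp add: V_def)
  define A where "A = {\<omega>\<in>space Pr. t * c \<le> V \<omega>}"
  have Am: "A \<in> sets Pr" unfolding A_def using borel_measurable_integrable[OF i] by measurable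
  have "measure Pr A \<le> (\<integral>\<omega>. V \<omega> \<partial>Pr) / (t * c)"
    unfolding A_def by (rule integral_Markov_inequality_measure[OF i, of A])
      (use Am V0 t c0 in auto)
  also have "\<dots> \<le> c / (t * c)" using E t c0 by (intro divide_right_mono) auto
  also have "\<dots> = 1 / t" using c0 by simp
  finally have "measure Pr A \<le> 1 / t" .
  moreover have "{\<omega>\<in>space Pr. t * c < V \<omega>} \<subseteq> A" by (auto simp: A_def)
  ultimately show ?thesis using Am unfolding V_def c_def by blast
qed

text \<open>Purely deterministic, for one sample \<open>d\<close>. In the bias,
  \<open>B / lam\<close> combines the bound \<open>B\<close> for the form of \<open>C\<close> with
  the factor \<open>1 / lam\<close> in the distance from \<open>v\<close> to \<open>u\<close>. In
  the noise, \<open>1 / lam\<close> comes from the identity for the weights and \<open>B\<close>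
  from \<open>norm v \<le> B\<close>.\<close>

lemma dr_error_bound:
  fixes \<phi>k :: "'x \<Rightarrow> 'hk::real_inner" and \<phi>l :: "'y \<Rightarrow> 'hl::real_inner" and C :: "'hk \<Rightarrow> 'hk"
    and eh :: "'x \<Rightarrow> real" and mh :: "'x \<Rightarrow> 'hl"
  assumes k: "\<And>a b. k a b = \<phi>k a \<bullet> \<phi>k b" and kb: "\<And>a. norm (\<phi>k a) \<le> B"
    and lam: "0 < lam" and n: "0 < n"
    and C: "linear C" "\<And>f g. C f \<bullet> g = f \<bullet> C g" "\<And>f. 0 \<le> C f \<bullet> f" "\<And>f. C f \<bullet> f \<le> B\<^sup>2 * (norm f)\<^sup>2"
    and u: "C u + lam *\<^sub>R u = lam *\<^sub>R \<phi>k x" and Mb: "0 \<le> Mb"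
    and bias: "\<And>\<beta> xs. norm (mu x - (\<Sum>i<n. \<beta> i *\<^sub>R mu (xs i)))
      \<le> Mb * sqrt (C (\<phi>k x - (\<Sum>i<n. \<beta> i *\<^sub>R \<phi>k (xs i))) \<bullet> (\<phi>k x - (\<Sum>i<n. \<beta> i *\<^sub>R \<phi>k (xs i))))"
  defines "\<epsilon> \<equiv> \<lambda>z. (T_of z / eh (X_of z)) *\<^sub>R (\<phi>l (W_of z) - mh (X_of z)) + mh (X_of z) - mu (X_of z)"
    and "\<xi> \<equiv> \<lambda>z. (\<phi>k (X_of z) \<bullet> u) *\<^sub>R \<phi>k (X_of z) - C u"
  shows "norm (mu x - dr_estimator k \<phi>l lam eh mh n d x)
    \<le> Mb * (sqrt lam * B + B / lam * (sqrt (\<Sum>i<n. \<Sum>j<n. \<xi> (d i) \<bullet> \<xi> (d j)) / real n))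
      + B / lam * (sqrt (\<Sum>i<n. \<Sum>j<n. (\<epsilon> (d i) \<bullet> \<epsilon> (d j)) * (\<phi>k (X_of (d i)) \<bullet> \<phi>k (X_of (d j)))) / real n)"
proof -
  have B0: "0 \<le> B" using order_trans[OF norm_ge_zero kb] .
  define xs where "xs i = X_of (d i)" for i
  define \<beta> where "\<beta> = ridge_weights k lam n xs x"
  define v where "v = \<phi>k x - (\<Sum>j<n. \<beta> j *\<^sub>R \<phi>k (xs j))"
  define V where "V = (\<Sum>i<n. \<Sum>j<n. (\<epsilon> (d i) \<bullet> \<epsilon> (d j)) * (\<phi>k (xs i) \<bullet> \<phi>k (xs j)))"
  define S where "S = (\<Sum>i<n. \<Sum>j<n. \<xi> (d i) \<bullet> \<xi> (d j))"
  have \<beta>: "lam * real n * \<beta> i = \<phi>k (xs i) \<bullet> v" if "i < n" for i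
    unfolding \<beta>_def v_def by (rule ridge_weights_residual[OF k lam that])
  note rb = ridge_residual_bounds[where \<phi> = \<phi>k and xs = xs and \<beta> = \<beta> and x = x and v = v,
      OF lam n \<beta> v_def]
  have nv: "norm v \<le> B" using rb(1) kb[of x] by simp
  have "S = (norm (\<Sum>i<n. \<xi> (d i)))\<^sup>2"
    unfolding S_def power2_norm_eq_inner by (simp add: inner_sum_left inner_sum_right inner_commute)
  then have "norm ((1 / real n) *\<^sub>R (\<Sum>i<n. \<xi> (d i))) = sqrt S / real n" by simp
  then have "lam * norm (v - u) \<le> sqrt S / real n"
    using rb(2)[OF _ C(1) u] n by (simp add: \<xi>_def xs_def)
  then have vu: "norm (v - u) \<le> sqrt S / real n / lam"
    using lam by (simp only: pos_le_divide_eq mult.commute[of _ lam])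
  have "sqrt (C v \<bullet> v) \<le> sqrt (C u \<bullet> u) + sqrt (C (v - u) \<bullet> (v - u))"
    using sqrt_form_triangle[OF C(1-3), of u "v - u"] by simp
  also have "sqrt (C u \<bullet> u) \<le> sqrt (lam * B\<^sup>2)"
  proof (rule real_sqrt_le_mono)
    have "C u \<bullet> u \<le> lam * (norm (\<phi>k x))\<^sup>2" by (rule ridge_population_bounds(2)[where C = C and u = u, OF C(3) lam u])
    also have "\<dots> \<le> lam * B\<^sup>2" using lam kb by (intro mult_left_mono power_mono) auto
    finally show "C u \<bullet> u \<le> lam * B\<^sup>2" .
  qed
  also have "sqrt (lam * B\<^sup>2) = sqrt lam * B" using B0 by (simp add: real_sqrt_mult)
  also have "sqrt (C (v - u) \<bullet> (v - u)) \<le> B * norm (v - u)"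
    using real_sqrt_le_mono[OF C(4)[of "v - u"]] B0 by (simp add: real_sqrt_mult)
  also have "B * norm (v - u) \<le> B / lam * (sqrt S / real n)"
    using mult_left_mono[OF vu B0] by (simp add: mult_ac)
  finally have Cv: "sqrt (C v \<bullet> v) \<le> sqrt lam * B + B / lam * (sqrt S / real n)" by simp
  have b: "norm (mu x - (\<Sum>i<n. \<beta> i *\<^sub>R mu (xs i))) \<le> Mb * (sqrt lam * B + B / lam * (sqrt S / real n))"
    using bias[of \<beta> xs] mult_left_mono[OF Cv Mb] by (simp add: v_def)
  have "norm (\<Sum>i<n. (\<phi>k (xs i) \<bullet> v) *\<^sub>R \<epsilon> (d i)) \<le> B * sqrt V"
  proof -
    have "(norm (\<Sum>i<n. (\<phi>k (xs i) \<bullet> v) *\<^sub>R \<epsilon> (d i)))\<^sup>2 \<le> (norm v)\<^sup>2 * V"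
      unfolding V_def by (rule schur_product_mono) simp
    then have "norm (\<Sum>i<n. (\<phi>k (xs i) \<bullet> v) *\<^sub>R \<epsilon> (d i)) \<le> sqrt ((norm v)\<^sup>2 * V)" by (rule real_le_rsqrt)
    also have "\<dots> = norm v * sqrt V" by (simp add: real_sqrt_mult)
    also have "\<dots> \<le> B * sqrt V"
      using nv schur_product_nonneg[of "{..<n}" "\<lambda>i. \<epsilon> (d i)" "\<lambda>i. \<phi>k (xs i)"]
      by (intro mult_right_mono) (auto simp: V_def)
    finally show ?thesis .
  qed
  moreover have "(\<Sum>i<n. \<beta> i *\<^sub>R \<epsilon> (d i)) = (1 / (lam * real n)) *\<^sub>R (\<Sum>i<n. (\<phi>k (xs i) \<bullet> v) *\<^sub>R \<epsilon> (d i))"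
    unfolding scaleR_sum_right using lam n by (intro sum.cong refl) (simp add: \<beta>[symmetric])
  ultimately have "norm (\<Sum>i<n. \<beta> i *\<^sub>R \<epsilon> (d i)) \<le> 1 / (lam * real n) * (B * sqrt V)"
    using lam by (simp add: divide_right_mono)
  also have "\<dots> = B / lam * (sqrt V / real n)" by simp
  finally have N: "norm (\<Sum>i<n. \<beta> i *\<^sub>R \<epsilon> (d i)) \<le> B / lam * (sqrt V / real n)" .
  have "dr_estimator k \<phi>l lam eh mh n d x = (\<Sum>i<n. \<beta> i *\<^sub>R (\<epsilon> (d i) + mu (xs i)))"
    unfolding dr_estimator_def \<beta>_def xs_def[abs_def] \<epsilon>_def by simp
  then have "mu x - dr_estimator k \<phi>l lam eh mh n d x
      = (mu x - (\<Sum>i<n. \<beta> i *\<^sub>R mu (xs i))) - (\<Sum>i<n. \<beta> i *\<^sub>R \<epsilon> (d i))"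
    by (simp add: scaleR_add_right sum.distrib)
  then have "norm (mu x - dr_estimator k \<phi>l lam eh mh n d x)
      \<le> norm (mu x - (\<Sum>i<n. \<beta> i *\<^sub>R mu (xs i))) + norm (\<Sum>i<n. \<beta> i *\<^sub>R \<epsilon> (d i))"
    by (simp only: norm_triangle_ineq4)
  then show ?thesis using b N unfolding V_def S_def xs_def by linarith
qed

subsection \<open>Rate of convergence\<close>

text \<open>A finite bound rules out the value \<infinity> that \<open>rms\<close> takes on
  functions that are not square integrable, so the integral itself can be bounded.\<close>

lemma rms_le_imp:
  assumes r: "rms M f \<le> ennreal c" and c: "0 \<le> c"
  shows "(\<integral>\<^sup>+x. ennreal ((f x)\<^sup>2) \<partial>M) \<le> ennreal (c\<^sup>2)"
proof -
  define I where "I = (\<integral>\<^sup>+x. ennreal ((f x)\<^sup>2) \<partial>M)"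
  have fin: "I \<noteq> \<infinity>" using r by (auto simp: rms_def I_def[symmetric] Let_def top_unique)
  then have "ennreal (sqrt (enn2real I)) \<le> ennreal c" using r by (simp add: rms_def I_def[symmetric] Let_def)
  then have "sqrt (enn2real I) \<le> c" using c by (simp add: ennreal_le_iff)
  then have "enn2real I \<le> c\<^sup>2" by (rule sqrt_le_D)
  then have "ennreal (enn2real I) \<le> ennreal (c\<^sup>2)" by (rule ennreal_leI)
  moreover have "ennreal (enn2real I) = I" using fin by (intro ennreal_enn2real) (simp add: less_top)
  ultimately show ?thesis by (simp only: I_def)
qed

text \<open>For a V-statistic \<open>S\<close>, the diagonal part \<open>a * real n\<close> yields
  the rate \<open>real n powr (- (1/2))\<close>, while the off-diagonal part passes through as
  \<open>b\<close>.\<close>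

lemma sqrt_div_le_add:
  assumes n: "0 < n" and S: "S \<le> a * real n + (b * real n)\<^sup>2" and ab: "0 \<le> a" "0 \<le> b"
  shows "sqrt S / real n \<le> sqrt a * real n powr (- (1/2)) + b"
proof -
  have h: "real n powr (- (1/2)) = sqrt (real n) / real n"
  proof -
    have "real n powr (- (1/2)) = 1 / sqrt (real n)"
      using n by (simp add: powr_minus_divide powr_half_sqrt)
    also have "\<dots> = sqrt (real n) / real n" using n by (simp add: frac_eq_eq)
    finally show ?thesis .
  qed
  have "sqrt S \<le> sqrt (a * real n + (b * real n)\<^sup>2)" using S by simp
  also have "\<dots> \<le> sqrt (a * real n) + sqrt ((b * real n)\<^sup>2)" using ab by (intro sqrt_add_le_add_sqrt) auto
  also have "\<dots> = sqrt a * sqrt (real n) + b * real n" using ab by (simp add: real_sqrt_mult)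
  finally have "sqrt S / real n \<le> (sqrt a * sqrt (real n) + b * real n) / real n" by (rule divide_right_mono) simp
  then show ?thesis using n by (simp add: h add_divide_distrib)
qed

lemma sqrt_div_le:
  assumes "0 < n" "S \<le> a * real n" "0 \<le> a"
  shows "sqrt S / real n \<le> sqrt a * real n powr (- (1/2))"
  using sqrt_div_le_add[OF assms(1), of S a 0] assms(2,3) by simp

theorem theorem4p7:
  fixes P Q :: "'o measure"
    and X :: "'o \<Rightarrow> 'x::topological_space"
    and MY :: "'y measure" and Y Z :: "'o \<Rightarrow> 'y"
    and PX QX RX :: "'x measure" and \<alpha> :: real
    and \<kappa>P \<kappa>Q :: "'x \<Rightarrow> 'y measure"
    and k :: "'x \<Rightarrow> 'x \<Rightarrow> real" and l :: "'y \<Rightarrow> 'y \<Rightarrow> real" and kmax :: real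
    and fnk :: "'hk::{real_inner,complete_space} \<Rightarrow> 'x \<Rightarrow> real" and \<phi>k :: "'x \<Rightarrow> 'hk"
    and fnl :: "'hl::{real_inner,complete_space} \<Rightarrow> 'y \<Rightarrow> real" and \<phi>l :: "'y \<Rightarrow> 'hl"
    and CXX :: "'hk \<Rightarrow> 'hk" and mu :: "'x \<Rightarrow> 'hl"
    and PTXW :: "(bool \<times> 'x \<times> 'y) measure" and e :: "'x \<Rightarrow> real"
    and Pr :: "'w measure"
    and N :: "nat \<Rightarrow> 's measure" and train :: "nat \<Rightarrow> 'w \<Rightarrow> 's"
    and D :: "nat \<Rightarrow> nat \<Rightarrow> 'w \<Rightarrow> bool \<times> 'x \<times> 'y"
    and ehat :: "nat \<Rightarrow> 's \<Rightarrow> 'x \<Rightarrow> real" and muhat :: "nat \<Rightarrow> 's \<Rightarrow> 'x \<Rightarrow> 'hl"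
    and lam \<zeta> \<eta> :: "nat \<Rightarrow> real" and x :: 'x
  \<comment> \<open>the two populations\<close>
  assumes "prob_space P" and "prob_space Q" and "sets Q = sets P"
    and "X \<in> measurable P borel" and "Y \<in> measurable P MY" and "Z \<in> measurable P MY"
    and "PX = distr P borel X" and "QX = distr Q borel X"
    and "full_support PX" and "full_support QX"
    and "absolutely_continuous PX QX" and "absolutely_continuous QX PX"
    and "regular_cond_distr P borel X MY Y \<kappa>P"
    and "regular_cond_distr Q borel X MY Z \<kappa>Q"
    and "0 \<le> \<alpha>" and "\<alpha> \<le> 1" and "RX = mixture \<alpha> PX QX"
  \<comment> \<open>kernels, RKHSs, covariance operator and conditional mean embedding\<close>
    and "pd_kernel UNIV k" and "is_rkhs UNIV k fnk \<phi>k"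
    and "continuous_on UNIV (\<lambda>(x, x'). k x x')"
    and "0 < kmax" and "\<And>x. k x x \<le> kmax"
    and "pd_kernel (space MY) l" and "is_rkhs (space MY) l fnl \<phi>l"
    and "(\<lambda>(y, y'). l y y') \<in> borel_measurable (MY \<Otimes>\<^sub>M MY)"
    and "characteristic MY \<phi>l"
    and "CXX = cov_op RX fnk \<phi>k"
    and "mu = (\<lambda>x. weak_integral (\<kappa>P x) \<phi>l)"
    and "\<And>g. \<exists>\<gamma>\<ge>1/2. \<exists>f\<in>range (op_power CXX \<gamma>). \<forall>x. (\<integral>y. fnl g y \<partial>\<kappa>P x) = fnk f x"
    and "\<And>g. \<exists>\<gamma>\<ge>1/2. \<exists>f\<in>range (op_power CXX \<gamma>). \<forall>x. (\<integral>y. fnl g y \<partial>\<kappa>Q x) = fnk f x"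
  \<comment> \<open>mixture model and propensity score\<close>
    and "PTXW = treatment_law \<alpha> (distr P (borel \<Otimes>\<^sub>M MY) (\<lambda>\<omega>. (X \<omega>, Y \<omega>)))
                                (distr Q (borel \<Otimes>\<^sub>M MY) (\<lambda>\<omega>. (X \<omega>, Z \<omega>)))"
    and "is_propensity PTXW e"
    and "AE x in RX. 0 < e x \<and> e x < 1"
  \<comment> \<open>fitted models, and test data independent of the training data\<close>
    and "prob_space Pr"
    and "\<And>n. train n \<in> measurable Pr (N n)"
    and "\<And>n. (\<lambda>(s, x). ehat n s x) \<in> borel_measurable (N n \<Otimes>\<^sub>M borel)"
    and "\<And>n. strongly_measurable (N n \<Otimes>\<^sub>M borel) (\<lambda>(s, x). muhat n s x)"
    and "\<And>n. prob_space.indep_vars Pr (\<lambda>_. PTXW) (D n) {..<n}"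
    and "\<And>n i. i < n \<Longrightarrow> distr Pr PTXW (D n i) = PTXW"
    and "\<And>n. prob_space.indep_set Pr
               (sets (vimage_algebra (space Pr) (train n) (N n)))
               (sets (vimage_algebra (space Pr) (\<lambda>\<omega>. \<lambda>i\<in>{..<n}. D n i \<omega>) (Pi\<^sub>M {..<n} (\<lambda>_. PTXW))))"
    and "\<exists>\<delta>>0. \<forall>x. \<delta> < e x \<and> (\<forall>n. \<forall>s\<in>space (N n). \<delta> < ehat n s x)"
  \<comment> \<open>rates\<close>
    and "\<And>n. 0 \<le> \<zeta> n" and "\<And>n. 0 \<le> \<eta> n" and "\<And>n. 0 < lam n"
    and "\<zeta> \<in> o(\<lambda>_. 1)" and "\<eta> \<in> o(\<lambda>_. 1)"
    and "big_O_p Pr (\<lambda>n \<omega>. rms RX (\<lambda>x. \<bar>e x - ehat n (train n \<omega>) x\<bar>)) \<zeta>"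
    and "big_O_p Pr (\<lambda>n \<omega>. rms RX (\<lambda>x. norm (mu x - muhat n (train n \<omega>) x))) \<eta>"
  shows "big_O_p Pr
     (\<lambda>n \<omega>. ennreal (norm (mu x -
        dr_estimator k \<phi>l (lam n) (ehat n (train n \<omega>)) (muhat n (train n \<omega>)) n (\<lambda>i. D n i \<omega>) x)))
     (\<lambda>n. sqrt (lam n) + inverse (lam n) * real n powr (- (1/2)) + inverse (lam n) * \<zeta> n * \<eta> n)"
proof -
  let ?err = "\<lambda>n \<omega>. norm (mu x - dr_estimator k \<phi>l (lam n) (ehat n (train n \<omega>)) (muhat n (train n \<omega>)) n (\<lambda>i. D n i \<omega>) x)"
  let ?rate = "\<lambda>n. sqrt (lam n) + inverse (lam n) * real n powr (- (1/2)) + inverse (lam n) * \<zeta> n * \<eta> n"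
  interpret P: prob_space P by fact
  interpret Q: prob_space Q by fact
  interpret Pr: prob_space Pr by fact
  define B where "B = sqrt kmax"
  have B: "0 < B" "B\<^sup>2 = kmax" using assms(21) by (simp_all add: B_def)
  have XQ: "X \<in> measurable Q borel" and ZQ: "Z \<in> measurable Q MY"
    using assms(4,6) by (simp_all add: measurable_cong_sets[OF assms(3) refl])
  have k\<phi>: "k a b = \<phi>k a \<bullet> \<phi>k b" for a b
  proof -
    note rk = assms(19)[unfolded is_rkhs_def, THEN conjunct2, THEN conjunct2, THEN conjunct2]
    have "\<phi>k a \<bullet> \<phi>k b = fnk (\<phi>k a) b" using rk[THEN conjunct2] by simp
    also have "\<dots> = k b a" using rk[THEN conjunct1] by simp
    also have "\<dots> = k a b" using assms(18) by (simp add: pd_kernel_def)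
    finally show ?thesis ..
  qed
  have fnk: "fnk f a = f \<bullet> \<phi>k a" for f a using assms(19) by (simp add: is_rkhs_def)
  have l\<phi>: "l a b = \<phi>l a \<bullet> \<phi>l b" if "a \<in> space MY" "b \<in> space MY" for a b
  proof -
    note rk = assms(24)[unfolded is_rkhs_def, THEN conjunct2, THEN conjunct2, THEN conjunct2]
    have "\<phi>l a \<bullet> \<phi>l b = fnl (\<phi>l a) b" using rk[THEN conjunct2] that by simp
    also have "\<dots> = l b a" using rk[THEN conjunct1] that by simp
    also have "\<dots> = l a b" using assms(23) that by (simp add: pd_kernel_def)
    finally show ?thesis ..
  qed
  have fnl: "fnl f a = f \<bullet> \<phi>l a" if "a \<in> space MY" for f a using assms(24) that by (simp add: is_rkhs_def)
  have kB: "norm (\<phi>k a) \<le> B" for a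
  proof -
    have "(norm (\<phi>k a))\<^sup>2 \<le> kmax" using assms(22)[of a] by (simp add: k\<phi> power2_norm_eq_inner)
    then show ?thesis unfolding B_def by (rule real_le_rsqrt)
  qed
  have pPX: "prob_space PX" unfolding assms(7) using assms(4) by (rule P.prob_space_distr)
  have pQX: "prob_space QX" unfolding assms(8) using XQ by (rule Q.prob_space_distr)
  have sPX: "sets PX = sets borel" "sets QX = sets PX" by (simp_all add: assms(7,8))
  have pRX: "prob_space RX" unfolding assms(17)
    by (rule prob_space_mixture[OF pPX pQX sPX(2) assms(15,16)])
  have sRX: "sets RX = sets borel" by (simp add: assms(17) sPX)
  have "continuous_on UNIV \<phi>k" by (rule continuous_feature_map[OF k\<phi> assms(20)])
  \<comment> \<open>Full support of the law of \<open>X\<close> enters here: it gives the continuous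
    feature map a separable range.\<close>
  then have apk: "countably_approximable borel \<phi>k" by (rule continuous_approximable[OF pPX sPX(1) assms(9)])
  have kw: "(\<lambda>x. g \<bullet> \<phi>k x) \<in> borel_measurable borel" for g by (rule approximable_inner_measurable[OF apk])
  have kc: "cross_measurable borel borel \<phi>k \<phi>k" by (rule cross_measurable_approximable[OF apk kw])
  have \<kappa>m: "\<kappa>P \<in> measurable borel (prob_algebra MY)" using assms(13) by (simp add: regular_cond_distr_def)
  have \<kappa>p: "prob_space (\<kappa>P a)" "sets (\<kappa>P a) = sets MY" for a
    using measurable_space[OF \<kappa>m, of a] by (simp_all add: space_prob_algebra)
  have \<kappa>s: "space (\<kappa>P a) = space MY" for a by (rule sets_eq_imp_space_eq[OF \<kappa>p(2)])
  obtain y0 where y0: "y0 \<in> space MY" using prob_space.not_empty[OF \<kappa>p(1)] \<kappa>s by blast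
  have lw: "(\<lambda>y. \<phi>l y \<bullet> h) \<in> borel_measurable MY" for h
    by (rule characteristic_measurable[OF assms(26) y0])
  \<comment> \<open>The bound on the outcome features comes from the characteristic property, that
    is, from the existence of all mean embeddings.\<close>
  obtain L where L: "\<And>y. y \<in> space MY \<Longrightarrow> norm (\<phi>l y) \<le> L" using characteristic_bounded[OF assms(26)] by blast
  have L0: "0 \<le> L" using order_trans[OF norm_ge_zero L[OF y0]] .
  have lc: "cross_measurable MY MY \<phi>l \<phi>l"
    unfolding cross_measurable_def
    by (rule measurable_cong[THEN iffD1, OF _ assms(25)]) (auto simp: space_pair_measure l\<phi>)
  have mu: "has_weak_integral (\<kappa>P a) \<phi>l (mu a)" for a
  proof -
    obtain m where m: "has_weak_integral (\<kappa>P a) \<phi>l m"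
      using assms(26) \<kappa>p unfolding characteristic_def by blast
    then show ?thesis by (simp add: assms(28) weak_integral_eq[OF m])
  qed
  have mui: "mu a \<bullet> h = (\<integral>y. \<phi>l y \<bullet> h \<partial>\<kappa>P a)" "integrable (\<kappa>P a) (\<lambda>y. \<phi>l y \<bullet> h)" for a h
    using mu[of a] by (auto simp: has_weak_integral_def)
  have l_le: "\<bar>\<phi>l y \<bullet> h\<bar> \<le> L * norm h" if "y \<in> space MY" for y h
    using order_trans[OF Cauchy_Schwarz_ineq2 mult_right_mono[OF L[OF that] norm_ge_zero]] .
  have mu_L: "norm (mu a) \<le> L" for a
  proof (cases "mu a = 0")
    case False
    have "mu a \<bullet> mu a \<le> (\<integral>y. L * norm (mu a) \<partial>\<kappa>P a)"
      unfolding mui(1)[of a "mu a"] using mui(2) l_le \<kappa>p(1)[of a]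
      by (intro integral_mono) (auto simp: \<kappa>s prob_space.finite_measure finite_measure.integrable_const intro: order_trans[OF abs_ge_self])
    also have "\<dots> = L * norm (mu a)" using prob_space.prob_space[OF \<kappa>p(1)] by simp
    finally show ?thesis using False by (simp add: dot_square_norm power2_eq_square)
  qed (simp add: L0)
  have mul: "cross_measurable MY borel \<phi>l mu"
    by (rule cross_measurable_commute[OF cross_measurable_weak_integral[OF \<kappa>m mu lc]])
  have mumu: "cross_measurable borel borel mu mu" by (rule cross_measurable_weak_integral[OF \<kappa>m mu mul])
  have muw: "(\<lambda>x. mu x \<bullet> h) \<in> borel_measurable borel" for h
    unfolding mui(1) by (intro integral_measurable_kernel[OF _ \<kappa>m])
      (simp add: split_beta' measurable_compose[OF measurable_snd lw])
  define M1 where "M1 = distr P (borel \<Otimes>\<^sub>M MY) (\<lambda>\<omega>. (X \<omega>, Y \<omega>))"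
  define M0 where "M0 = distr Q (borel \<Otimes>\<^sub>M MY) (\<lambda>\<omega>. (X \<omega>, Z \<omega>))"
  have XY: "(\<lambda>\<omega>. (X \<omega>, Y \<omega>)) \<in> measurable P (borel \<Otimes>\<^sub>M MY)" using assms(4,5) by measurable
  have XZ: "(\<lambda>\<omega>. (X \<omega>, Z \<omega>)) \<in> measurable Q (borel \<Otimes>\<^sub>M MY)" using XQ ZQ by measurable
  have M: "PTXW = treatment_law \<alpha> M1 M0" by (simp add: assms(31) M1_def M0_def)
  have sM: "sets M1 = sets (borel \<Otimes>\<^sub>M MY)" "sets M0 = sets M1" by (simp_all add: M1_def M0_def)
  have pM1: "prob_space M1" unfolding M1_def by (rule P.prob_space_distr[OF XY])
  have pM0: "prob_space M0" unfolding M0_def by (rule Q.prob_space_distr[OF XZ])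
  have pM: "prob_space PTXW" unfolding M by (rule prob_space_treatment_law[OF pM1 pM0 sM(2) assms(15,16)])
  note tm = treatment_law_measurable[OF sM(1), of \<alpha> M0, folded M]
  have RX: "RX = distr PTXW borel X_of"
  proof -
    have "distr M1 borel fst = PX" "distr M0 borel fst = QX"
      unfolding M1_def M0_def assms(7,8) using XY XZ by (simp_all add: distr_distr comp_def)
    then show ?thesis unfolding M distr_X_of[OF sM] assms(17) by simp
  qed
  interpret M: prob_space PTXW by (rule pM)
  interpret dr_model PTXW MY RX e \<phi>k B \<phi>l mu L
  proof
    fix h :: 'hl and r :: "'x \<Rightarrow> 'hl" and eh c :: "'x \<Rightarrow> real" and \<delta> Bc :: real
    assume *: "(\<lambda>x. r x \<bullet> h) \<in> borel_measurable borel" "integrable PTXW (\<lambda>z. r (X_of z) \<bullet> h)"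
      "eh \<in> borel_measurable borel" "\<And>x. \<delta> < eh x" "0 < \<delta>"
      "c \<in> borel_measurable borel" "\<And>x. \<bar>c x\<bar> \<le> Bc"
    show "(\<integral>z. (((T_of z / eh (X_of z)) *\<^sub>R (\<phi>l (W_of z) - mu (X_of z))
          + (1 - T_of z / eh (X_of z)) *\<^sub>R r (X_of z)) \<bullet> h) * c (X_of z) \<partial>PTXW)
      = (\<integral>z. (((1 - e (X_of z) / eh (X_of z)) *\<^sub>R r (X_of z)) \<bullet> h) * c (X_of z) \<partial>PTXW)"
    proof (rule dr_residual_conditional_mean[OF assms(1,4,5,13) M1_def sM(2) pM0 assms(15,16) M assms(32) lw l_le])
      show "\<bar>mu a \<bullet> h\<bar> \<le> L * norm h" for a
        using order_trans[OF Cauchy_Schwarz_ineq2 mult_right_mono[OF mu_L norm_ge_zero]] .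
    qed (use * mui muw in auto)
  qed (use tm RX kc kB kw lc L mumu mul mu_L assms(32) in \<open>auto simp: is_propensity_def\<close>)
  have kwR: "(\<lambda>x. g \<bullet> \<phi>k x) \<in> borel_measurable RX" for g
    using kw[of g] by (simp add: measurable_cong_sets[OF sRX refl])
  note C = cov_op_props[OF pRX kwR kB fnk, folded assms(27)]
  interpret C: bounded_linear CXX by (rule C(3))
  \<comment> \<open>Pairs for which every representation of \<open>mu x \<bullet> g\<close> as
    \<open>f \<bullet> \<phi>k x\<close> carries over to
    \<open>m \<bullet> g = f \<bullet> v\<close>. The bias vector and the ridge residual form such a
    pair for all weights, sample points and sample sizes, so the constant \<open>Mb\<close> does not
    depend on the data.\<close>
  define Rel where "Rel = {(m, v). \<forall>g f. (\<forall>x. mu x \<bullet> g = f \<bullet> \<phi>k x) \<longrightarrow> m \<bullet> g = f \<bullet> v}"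
  have "\<exists>M. \<forall>(m, v)\<in>Rel. (m \<bullet> g)\<^sup>2 \<le> M * (CXX v \<bullet> v)" for g
  proof -
    \<comment> \<open>Exponent and representer belong to this \<open>g\<close> alone;
      \<open>uniform_form_bound\<close> removes the dependence afterwards.\<close>
    obtain \<gamma> f where \<gamma>: "1/2 \<le> \<gamma>" and f: "f \<in> range (op_power CXX \<gamma>)"
      and fg: "\<And>x. (\<integral>y. fnl g y \<partial>\<kappa>P x) = fnk f x" using assms(29)[of g] by blast
    obtain h where h: "f = op_power CXX \<gamma> h" using f by blast
    have rep: "mu x \<bullet> g = f \<bullet> \<phi>k x" for x
    proof -
      have "mu x \<bullet> g = (\<integral>y. fnl g y \<partial>\<kappa>P x)" unfolding mui(1)
        by (intro Bochner_Integration.integral_cong refl) (simp add: \<kappa>s fnl inner_commute)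
      then show ?thesis by (simp add: fg fnk)
    qed
    have "0 < B\<^sup>2" using B(1) by simp
    from op_power_form_bound[OF C(3,4,5) this C(6) \<gamma>, of h]
    obtain M where "\<forall>v. (op_power CXX \<gamma> h \<bullet> v)\<^sup>2 \<le> M * (CXX v \<bullet> v)" by blast
    moreover have "m \<bullet> g = op_power CXX \<gamma> h \<bullet> v" if "(m, v) \<in> Rel" for m v
      using that rep unfolding Rel_def h by blast
    ultimately have "\<forall>(m, v)\<in>Rel. (m \<bullet> g)\<^sup>2 \<le> M * (CXX v \<bullet> v)" by auto
    then show ?thesis ..
  qed
  from uniform_form_bound[OF this C(5)] obtain Mb where Mb: "0 \<le> Mb"
    "\<And>m v. (m, v) \<in> Rel \<Longrightarrow> norm m \<le> Mb * sqrt (CXX v \<bullet> v)" by blast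
  have bias: "norm (mu x - (\<Sum>i<n. \<beta> i *\<^sub>R mu (xs i)))
      \<le> Mb * sqrt (CXX (\<phi>k x - (\<Sum>i<n. \<beta> i *\<^sub>R \<phi>k (xs i))) \<bullet> (\<phi>k x - (\<Sum>i<n. \<beta> i *\<^sub>R \<phi>k (xs i))))"
    for n :: nat and \<beta> xs
    by (rule Mb(2)) (simp add: Rel_def inner_diff_left inner_diff_right inner_sum_left inner_sum_right)
  obtain \<delta> where \<delta>: "0 < \<delta>" "\<And>n s x. s \<in> space (N n) \<Longrightarrow> \<delta> < ehat n s x" using assms(41) by blast
  have "\<exists>u. CXX u + lam n *\<^sub>R u = lam n *\<^sub>R \<phi>k x" for n
  proof (rule coercive_surj)
    show "bounded_linear (\<lambda>u. CXX u + lam n *\<^sub>R u)"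
      by (intro bounded_linear_add C(3) bounded_linear_scaleR_right)
    show "lam n * (norm v)\<^sup>2 \<le> (CXX v + lam n *\<^sub>R v) \<bullet> v" for v
      using C(5)[of v] by (simp add: inner_add_left power2_norm_eq_inner)
  qed (rule assms(44))
  then obtain u where u: "\<And>n. CXX (u n) + lam n *\<^sub>R u n = lam n *\<^sub>R \<phi>k x" by metis
  have uB: "norm (u n) \<le> B" for n
    using ridge_population_bounds(1)[where C = CXX and u = "u n", OF C(5) assms(44) u] kB[of x] by (rule order_trans)
  define \<epsilon> where "\<epsilon> n s = residual (ehat n s) (muhat n s)" for n s
  define \<xi> where "\<xi> n z = (\<phi>k (X_of z) \<bullet> u n) *\<^sub>R \<phi>k (X_of z) - CXX (u n)" for n and z :: "bool \<times> 'x \<times> 'y"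
  \<comment> \<open>The diagonal constant of the covariance tail with \<open>norm (u n)\<close>
    replaced by its bound \<open>B\<close>, hence uniform in \<open>n\<close>.\<close>
  define a\<^sub>1 where "a\<^sub>1 = (2 * B\<^sup>2 * B)\<^sup>2 + 1"
  show ?thesis
    unfolding big_O_p_def
  proof (intro allI impI)
    fix r :: real assume r: "0 < r"
    \<comment> \<open>A quarter of the probability for each of four exceptional events: two from the
      assumed model rates, two from the tail bounds.\<close>
    then have r4: "0 < r / 4" by simp
    obtain C1 where C1: "0 < C1" and ev1: "\<forall>\<^sub>F n in sequentially. \<exists>A\<in>sets Pr.
        {\<omega>\<in>space Pr. ennreal (C1 * \<zeta> n) < rms RX (\<lambda>x. \<bar>e x - ehat n (train n \<omega>) x\<bar>)} \<subseteq> A \<and> measure Pr A \<le> r / 4"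
      using assms(47) r4 unfolding big_O_p_def by blast
    obtain C2 where C2: "0 < C2" and ev2: "\<forall>\<^sub>F n in sequentially. \<exists>A\<in>sets Pr.
        {\<omega>\<in>space Pr. ennreal (C2 * \<eta> n) < rms RX (\<lambda>x. norm (mu x - muhat n (train n \<omega>) x))} \<subseteq> A \<and> measure Pr A \<le> r / 4"
      using assms(48) r4 unfolding big_O_p_def by blast
    \<comment> \<open>Eventually \<open>\<eta> n < 1\<close>, so \<open>C2 * \<eta> n\<close> may be
      replaced by \<open>C2\<close> in the diagonal constant \<open>a\<^sub>2\<close>, which is then
      free of \<open>n\<close>.\<close>
    have "\<eta> \<longlonglongrightarrow> 0" using assms(46) by (rule smalloD_tendsto[where g = "\<lambda>_. 1", simplified])
    then have ev3: "\<forall>\<^sub>F n in sequentially. \<eta> n < 1" by (rule order_tendstoD) simp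
    define t where "t = 4 / r"
    have t: "0 < t" "1 / t = r / 4" using r by (simp_all add: t_def)
    define a\<^sub>2 where "a\<^sub>2 = B\<^sup>2 * (2 * ((2 * L / \<delta>)\<^sup>2 + (1 + 1 / \<delta>)\<^sup>2 * C2\<^sup>2)) + 1"
    have a0: "0 \<le> a\<^sub>1" "0 \<le> a\<^sub>2" by (simp_all add: a\<^sub>1_def a\<^sub>2_def)
    \<comment> \<open>\<open>K1\<close>, \<open>K2\<close> and \<open>K3\<close> are the
      coefficients of the three rates; \<open>K2\<close> collects the sampling errors of the bias
      and of the noise.\<close>
    define K1 where "K1 = Mb * B"
    define K2 where "K2 = Mb * B * sqrt (t * a\<^sub>1) + B * sqrt (t * a\<^sub>2)"
    define K3 where "K3 = B * sqrt t * B * (C1 * C2 / \<delta>)"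
    have K0: "0 \<le> K1" "0 \<le> K2" "0 \<le> K3"
      using Mb(1) B(1) t(1) a0 C1 C2 \<delta>(1) by (simp_all add: K1_def K2_def K3_def)
    define K where "K = K1 + K2 + K3 + 1"
    have "\<forall>\<^sub>F n in sequentially. \<exists>A\<in>sets Pr.
        {\<omega>\<in>space Pr. ennreal (K * ?rate n)
          < ennreal (?err n \<omega>)}
        \<subseteq> A \<and> measure Pr A \<le> r"
      using ev1 ev2 ev3 eventually_gt_at_top[of 0]
    proof eventually_elim
      case (elim n)
      then have n: "0 < n" by simp
      obtain A1 where A1: "A1 \<in> sets Pr" "measure Pr A1 \<le> r / 4"
        "{\<omega>\<in>space Pr. ennreal (C1 * \<zeta> n) < rms RX (\<lambda>x. \<bar>e x - ehat n (train n \<omega>) x\<bar>)} \<subseteq> A1" using elim(1) by blast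
      obtain A2 where A2: "A2 \<in> sets Pr" "measure Pr A2 \<le> r / 4"
        "{\<omega>\<in>space Pr. ennreal (C2 * \<eta> n) < rms RX (\<lambda>x. norm (mu x - muhat n (train n \<omega>) x))} \<subseteq> A2" using elim(2) by blast
      have z0: "0 \<le> C1 * \<zeta> n" "0 \<le> C2 * \<eta> n" using C1 C2 assms(42)[of n] assms(43)[of n] by simp_all
      define S where "S \<omega> = (\<Sum>i<n. \<Sum>j<n. \<xi> n (D n i \<omega>) \<bullet> \<xi> n (D n j \<omega>))" for \<omega>
      define V where "V \<omega> = (\<Sum>i<n. \<Sum>j<n. (\<epsilon> n (train n \<omega>) (D n i \<omega>) \<bullet> \<epsilon> n (train n \<omega>) (D n j \<omega>))
            * (\<phi>k (X_of (D n i \<omega>)) \<bullet> \<phi>k (X_of (D n j \<omega>))))" for \<omega>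
      obtain A3 where A3: "A3 \<in> sets Pr" "measure Pr A3 \<le> r / 4"
        "{\<omega>\<in>space Pr. t * (real n * ((2 * B\<^sup>2 * norm (u n))\<^sup>2 + 1)) < S \<omega>} \<subseteq> A3"
        using covariance_tail[OF assms(34,38,39) C(1)[of "u n"] C(7)[of "u n"] n t(1)]
        unfolding t(2) S_def \<xi>_def by blast
      obtain A4 where A4: "A4 \<in> sets Pr" "measure Pr A4 \<le> r / 4"
        "{\<omega>\<in>space Pr.
          (\<integral>\<^sup>+x. ennreal ((e x - ehat n (train n \<omega>) x)\<^sup>2) \<partial>RX) \<le> ennreal ((C1 * \<zeta> n)\<^sup>2) \<and>
          (\<integral>\<^sup>+x. ennreal ((norm (mu x - muhat n (train n \<omega>) x))\<^sup>2) \<partial>RX) \<le> ennreal ((C2 * \<eta> n)\<^sup>2) \<and>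
          t * (real n * (B\<^sup>2 * (2 * ((2 * L / \<delta>)\<^sup>2 + (1 + 1 / \<delta>)\<^sup>2 * (C2 * \<eta> n)\<^sup>2)) + 1)
            + (real n)\<^sup>2 * (B\<^sup>2 * (C1 * \<zeta> n * (C2 * \<eta> n) / \<delta>)\<^sup>2)) < V \<omega>} \<subseteq> A4"
        using residual_tail[OF assms(34,35,36,37) muw lw assms(38,39,40) \<delta>(2,1) n z0 t(1)]
        unfolding t(2) V_def \<epsilon>_def by blast
      define A where "A = A1 \<union> A2 \<union> (A3 \<union> A4)"
      have A: "A \<in> sets Pr" using A1(1) A2(1) A3(1) A4(1) by (simp add: A_def)
      have "measure Pr A \<le> (measure Pr A1 + measure Pr A2) + (measure Pr A3 + measure Pr A4)"
        unfolding A_def using A1(1) A2(1) A3(1) A4(1)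
        by (intro order_trans[OF measure_Un_le] add_mono measure_Un_le) auto
      then have Ar: "measure Pr A \<le> r" using A1(2) A2(2) A3(2) A4(2) by simp
      have "?err n \<omega>
          \<le> K * ?rate n"
        if \<omega>: "\<omega> \<in> space Pr" "\<omega> \<notin> A" for \<omega>
      proof -
        have lam: "0 < lam n" by (rule assms(44))
        have "S \<omega> \<le> t * (real n * ((2 * B\<^sup>2 * norm (u n))\<^sup>2 + 1))"
          using A3(3) \<omega> unfolding A_def by (auto simp: not_less[symmetric])
        also have "\<dots> \<le> t * (real n * a\<^sub>1)"
          unfolding a\<^sub>1_def using uB[of n] t(1) B(1)
          by (intro mult_left_mono add_right_mono power_mono) auto
        finally have S: "sqrt (S \<omega>) / real n \<le> sqrt (t * a\<^sub>1) * real n powr (- (1/2))"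
          using n a0 t(1) by (intro sqrt_div_le) (simp_all add: mult_ac)
        have r1: "rms RX (\<lambda>x. \<bar>e x - ehat n (train n \<omega>) x\<bar>) \<le> ennreal (C1 * \<zeta> n)"
          using A1(3) \<omega> unfolding A_def by (auto simp: not_less[symmetric])
        have r2: "rms RX (\<lambda>x. norm (mu x - muhat n (train n \<omega>) x)) \<le> ennreal (C2 * \<eta> n)"
          using A2(3) \<omega> unfolding A_def by (auto simp: not_less[symmetric])
        have "V \<omega> \<le> t * (real n * (B\<^sup>2 * (2 * ((2 * L / \<delta>)\<^sup>2 + (1 + 1 / \<delta>)\<^sup>2 * (C2 * \<eta> n)\<^sup>2)) + 1)
            + (real n)\<^sup>2 * (B\<^sup>2 * (C1 * \<zeta> n * (C2 * \<eta> n) / \<delta>)\<^sup>2))"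
          using A4(3) \<omega> rms_le_imp[OF r1 z0(1)] rms_le_imp[OF r2 z0(2)] unfolding A_def
          by (auto simp: not_less[symmetric])
        also have "\<dots> \<le> t * (real n * a\<^sub>2 + (real n)\<^sup>2 * (B\<^sup>2 * (C1 * \<zeta> n * (C2 * \<eta> n) / \<delta>)\<^sup>2))"
        proof -
          have "(C2 * \<eta> n)\<^sup>2 \<le> C2\<^sup>2"
            using elim(3) assms(43)[of n] C2 by (intro power_mono) (auto intro: mult_left_le)
          then show ?thesis unfolding a\<^sub>2_def using t(1)
            by (intro mult_left_mono add_right_mono add_left_mono) auto
        qed
        also have "\<dots> = (t * a\<^sub>2) * real n + (sqrt t * B * (C1 * C2 / \<delta>) * (\<zeta> n * \<eta> n) * real n)\<^sup>2"
          using t(1) by (simp add: power_mult_distrib distrib_left power_divide mult_ac)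
        finally have V: "sqrt (V \<omega>) / real n
            \<le> sqrt (t * a\<^sub>2) * real n powr (- (1/2)) + sqrt t * B * (C1 * C2 / \<delta>) * (\<zeta> n * \<eta> n)"
          using n t(1) a0 B(1) C1 C2 \<delta>(1) assms(42)[of n] assms(43)[of n]
          by (intro sqrt_div_le_add) auto
        have "?err n \<omega>
          \<le> Mb * (sqrt (lam n) * B + B / lam n * (sqrt (S \<omega>) / real n)) + B / lam n * (sqrt (V \<omega>) / real n)"
          using dr_error_bound[where \<phi>l = \<phi>l and eh = "ehat n (train n \<omega>)" and mh = "muhat n (train n \<omega>)"
              and d = "\<lambda>i. D n i \<omega>" and k = k and \<phi>k = \<phi>k and B = B and lam = "lam n" and n = n
              and C = CXX and u = "u n" and x = x and Mb = Mb and mu = mu, OF k\<phi> kB lam n C.linear_axioms C(4,5,6) u Mb(1) bias]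
          unfolding S_def V_def \<xi>_def \<epsilon>_def residual_def .
        also have "\<dots> \<le> Mb * (sqrt (lam n) * B + B / lam n * (sqrt (t * a\<^sub>1) * real n powr (- (1/2))))
            + B / lam n * (sqrt (t * a\<^sub>2) * real n powr (- (1/2)) + sqrt t * B * (C1 * C2 / \<delta>) * (\<zeta> n * \<eta> n))"
          using S V Mb(1) B(1) lam by (intro add_mono mult_left_mono order_refl) auto
        also have "\<dots> = K1 * sqrt (lam n) + K2 * (inverse (lam n) * real n powr (- (1/2)))
            + K3 * (inverse (lam n) * \<zeta> n * \<eta> n)"
        proof -
          \<comment> \<open>Regroups the bound by the three rates, with their ingredients
            generalised to arbitrary reals so that the identity is purely algebraic.\<close>
          have "Mb * (s * B + B / i * (p * h)) + B / i * (q * h + v * B * d * (z * y))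
            = Mb * B * s + (Mb * B * p + B * q) * (inverse i * h) + B * v * B * d * (inverse i * z * y)"
            for s i p h q v d z y :: real
            by (simp add: divide_inverse algebra_simps)
          then show ?thesis by (simp only: K1_def K2_def K3_def)
        qed
        also have "\<dots> \<le> K * sqrt (lam n) + K * (inverse (lam n) * real n powr (- (1/2)))
            + K * (inverse (lam n) * \<zeta> n * \<eta> n)"
          using K0 lam assms(42)[of n] assms(43)[of n] unfolding K_def
          by (intro add_mono mult_right_mono) auto
        finally show ?thesis by (simp add: distrib_left)
      qed
      then have "ennreal (?err n \<omega>)
          \<le> ennreal (K * ?rate n)"
        if "\<omega> \<in> space Pr" "\<omega> \<notin> A" for \<omega>
        using that by (intro ennreal_leI)
      then have sub: "{\<omega>\<in>space Pr. ennreal (K * ?rate n)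
          < ennreal (?err n \<omega>)}
        \<subseteq> A"
        unfolding not_less[symmetric] by blast
      then show ?case using A Ar by (intro bexI[of _ A] conjI)
    qed
    moreover have "0 < K" using K0 by (simp add: K_def)
    ultimately show "\<exists>C>0. \<forall>\<^sub>F n in sequentially. \<exists>A\<in>sets Pr.
        {\<omega>\<in>space Pr. ennreal (C * ?rate n)
          < ennreal (?err n \<omega>)}
        \<subseteq> A \<and> measure Pr A \<le> r" by blast
  qed
qed

end
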